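(* Let $a,b,k$ be integers such that $2\le k<a\le\lfloor 3k/2\rfloor$ and $0\le b\le 3k-2a$, and let $K:=3k+3$. Then \[ \mathcal{F}_{2k-a,\,a+b-k;\,k}(q)-q^{b+1}\mathcal{F}_{2k-a-b-1,\,a-k-1;\,k}(q)=\frac{(q^K;q^K)_\infty^2}{(q;q)_\infty^3}\,\theta\big(q^{a+1},q^{b+1},q^{a+b+2};q^K\big). \]
   Context: $(a;q)_n=(a;q)_\infty/(aq^n;q)_\infty$ with $(a;q)_\infty=\prod_{j\ge0}(1-aq^j)$; $1/(q;q)_n=0$ for $n<0$. $\binom{n}{m}_p=\frac{(p;p)_n}{(p;p)_m(p;p)_{n-m}}$ for $0\le m\le n$, $0$ otherwise. $\theta(z;q)=(z;q)_\infty(q/z;q)_\infty$, $\theta(z_1,\dots,z_n;q)=\prod_i\theta(z_i;q)$. For $n,m\in\mathbb{N}_0$, $g_{n,m;0}(q):=\frac{1}{(q;q)_{n+m}(q^2;q)_{n+m}}\binom{n+m}{n}_{q^3}$. For integers $0\le a,b\le k$, \[\mathcal{F}_{a,b;k}(q):=\sum_{\substack{\lambda_1\ge\cdots\ge\lambda_k\ge0\\ \mu_1\ge\cdots\ge\mu_k\ge0}}\frac{1-q^{\lambda_a+\mu_b+1}}{1-q}\frac{q^{\sum_{i=1}^k(\lambda_i^2-\lambda_i\mu_i+\mu_i^2)+\sum_{i=a+1}^k\lambda_i+\sum_{i=b+1}^k\mu_i}}{\prod_{i=1}^{k-1}(q;q)_{\lambda_i-\lambda_{i+1}}(q;q)_{\mu_i-\mu_{i+1}}}\,g_{\lambda_k,\mu_k;0}(q),\]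 with the convention $q^{\lambda_0}=q^{\mu_0}:=0$. *)

theory Defs
  imports "HOL-Analysis.Analysis"
begin

definition qpoch :: "complex \<Rightarrow> complex \<Rightarrow> nat \<Rightarrow> complex" where
  "qpoch a q n = (\<Prod>j<n. 1 - a * q ^ j)"

definition qpoch_inf :: "complex \<Rightarrow> complex \<Rightarrow> complex" where
  "qpoch_inf a q = prodinf (\<lambda>j. 1 - a * q ^ j)"

definition qbinom :: "complex \<Rightarrow> nat \<Rightarrow> nat \<Rightarrow> complex" where
  "qbinom p n m = (if m \<le> n then qpoch p p n / (qpoch p p m * qpoch p p (n - m)) else 0)"

definition qtheta :: "complex \<Rightarrow> complex \<Rightarrow> complex" where
  "qtheta z q = qpoch_inf z q * qpoch_inf (q / z) q"

definition g0 :: "nat \<Rightarrow> nat \<Rightarrow> complex \<Rightarrow> complex" where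
  "g0 n m q = 1 / (qpoch q q (n + m) * qpoch (q ^ 2) q (n + m)) * qbinom (q ^ 3) (n + m) n"

text \<open>Partitions with at most k parts, as weakly decreasing sequences
  l 1 \<ge> ... \<ge> l k \<ge> 0, with l i = 0 outside {1..k}.\<close>
definition parts :: "nat \<Rightarrow> (nat \<Rightarrow> nat) set" where
  "parts k = {l. (\<forall>i. i \<notin> {1..k} \<longrightarrow> l i = 0) \<and> (\<forall>i\<in>{1..<k}. l (Suc i) \<le> l i)}"

text \<open>q^{lambda_a}, with the convention q^{lambda_0} = 0.\<close>
definition qpow_conv :: "complex \<Rightarrow> (nat \<Rightarrow> nat) \<Rightarrow> nat \<Rightarrow> complex" where
  "qpow_conv q l a = (if a = 0 then 0 else q ^ l a)"

definition Fterm :: "nat \<Rightarrow> nat \<Rightarrow> nat \<Rightarrow> complex \<Rightarrow> (nat \<Rightarrow> nat) \<times> (nat \<Rightarrow> nat) \<Rightarrow> complex" where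
  "Fterm a b k q lm = (case lm of (l, m) \<Rightarrow>
     (1 - qpow_conv q l a * qpow_conv q m b * q) / (1 - q)
     * q ^ ((\<Sum>i=1..k. (l i)^2 + (m i)^2 - l i * m i)
            + (\<Sum>i\<in>{a+1..k}. l i) + (\<Sum>i\<in>{b+1..k}. m i))
     / (\<Prod>i\<in>{1..<k}. qpoch q q (l i - l (Suc i)) * qpoch q q (m i - m (Suc i)))
     * g0 (l k) (m k) q)"

definition Fcal :: "nat \<Rightarrow> nat \<Rightarrow> nat \<Rightarrow> complex \<Rightarrow> complex" where
  "Fcal a b k q = infsum (Fterm a b k q) (parts k \<times> parts k)"

end

theory Submission
  imports Defs "HOL-Computational_Algebra.Polynomial"
begin

text \<open>
  Write \<open>\<kappa> = (\<kappa>\<^sub>1, \<kappa>\<^sub>2, \<kappa>\<^sub>3)\<close> for a point of the \<open>A\<^sub>2\<close> root lattice. The kernels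
  \<open>(q)\<^sub>l\<^sub>+\<^sub>m / \<Prod>\<^sub>i (q)\<^bsub>l + \<kappa>\<^sub>i\<^esub> (q)\<^bsub>m - \<kappa>\<^sub>i\<^esub>\<close> are eigenfunctions of the summation
  step of \<open>\<F>\<close> that carries the weight \<open>q^(l^2 - l m + m^2)\<close>, and shifted versions of them are eigenfunctions of the steps
  with additional linear exponents (\<open>A\<^sub>2\<close> Bailey chain). The identity
  \<open>(z^3;q^3)\<^sub>N = (z;q)\<^sub>N (\<omega>z;q)\<^sub>N (\<omega>^2 z;q)\<^sub>N\<close> expands \<open>g\<^bsub>n,m;0\<^esub>\<close> in these kernels with coefficients that contain the
  Vandermonde determinant of the \<open>q^\<kappa>\<^sub>i\<close>. That determinant is used up when passing from one type of
  kernel to the next; the factor \<open>1 - q^(\<lambda>\<^sub>a + \<mu>\<^sub>b + 1)\<close> is exactly what makes the second passage possible. The outcome, for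
  \<open>0 \<le> b \<le> a \<le> k\<close>, is that \<open>\<F>\<^bsub>a,b;k\<^esub>\<close> equals \<open>(q)\<^sub>\<infinity>^(-3)\<close> times a lattice sum with the character
  \<open>\<omega>^f - \<omega>^(-f)\<close>, \<open>f = \<kappa>\<^sub>1 - \<kappa>\<^sub>2\<close>. A reflection and a translation turn the two sums of the theorem into
  copies of a single one with \<open>f\<close> shifted by \<open>\<plusminus>1\<close>, and \<open>\<omega>^f + \<omega>^(f+1) + \<omega>^(f-1) = 0\<close> combines them. The result is
  the Macdonald identity for \<open>A\<^sub>2\<close>, which follows from three Jacobi triple products and the pentagonal number theorem.
\<close>

section \<open>Reciprocal q-factorials and q-Vandermonde sums\<close>

text \<open>Going outward from \<open>g0\<close>, the layers of the multisum carry the linear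
  exponents (1, 1), then (0, 1), then (0, 0), in numbers k - a, a - b and b. The kernels
  \<open>Psi 2\<close>, \<open>Psi 1\<close>, \<open>Psi 0\<close> are adapted to these three
  weights, so the kernel has to be changed twice on the way. Both changes are Lagrange
  interpolations, with three and with two nodes, and the determinant is there to clear their
  denominators. The second one also needs a factor 1 - q^(m - \<alpha>) that varies from summand to
  summand. It arises because multiplication by q^(\<lambda>_a + \<mu>_b) lowers both indices by one:
  \<F> is a difference of two chains whose summands differ by a power of q involving \<alpha>.

  The sums are kept finite by an outer pair (L, L). As L grows, every kernel tends to the same
  constant, so only the accumulated eigenvalues remain in the lattice sum. Integer powers of q occur
  throughout, hence the assumption q \<noteq> 0; the point q = 0 is treated separately.\<close>

lemma qpoch_Suc: "qpoch a p (Suc n) = qpoch a p n * (1 - a * p ^ n)"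
  by (simp add: qpoch_def)

locale nome =
  fixes q :: complex
  assumes norm_q: "norm q < 1" and q_nz: "q \<noteq> 0"
begin

text \<open>The value 0 at negative integers lets summands vanish by themselves outside their
  natural range and makes \<open>rq_rec\<close> hold without a side condition.\<close>

definition rq :: "int \<Rightarrow> complex" where
  "rq n = (if n < 0 then 0 else 1 / qpoch q q (nat n))"

lemma one_minus_power_nz: "n > 0 \<Longrightarrow> 1 - q ^ n \<noteq> 0"
  using norm_q power_eq_1_iff[of q n] by auto

lemma qpoch_q_Suc: "qpoch q q (Suc n) = qpoch q q n * (1 - q ^ Suc n)"
  by (simp add: qpoch_def)

lemma qpoch_q_nz: "qpoch q q n \<noteq> 0"
  using one_minus_power_nz[of "Suc _"] by (simp add: qpoch_def)

lemma rq_neg [simp]: "n < 0 \<Longrightarrow> rq n = 0"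
  by (simp add: rq_def)

lemma rq_0 [simp]: "rq 0 = 1"
  by (simp add: rq_def qpoch_def)

lemma rq_nat: "rq (int n) = 1 / qpoch q q n"
  by (simp add: rq_def)

lemma qpoch_rq [simp]: "qpoch q q n * rq (int n) = 1"
  using qpoch_q_nz by (simp add: rq_nat)

definition qp :: "int \<Rightarrow> complex" where "qp n = q powi n"

lemma qp_add: "qp (m + n) = qp m * qp n"
  using q_nz by (simp add: qp_def power_int_add)

lemma qp_0 [simp]: "qp 0 = 1"
  by (simp add: qp_def)

lemma qp_nz [simp]: "qp n \<noteq> 0"
  using q_nz by (simp add: qp_def)

lemma qp_nat: "qp (int n) = q ^ n"
  by (simp add: qp_def)

lemma qp_minus_nz: "n > 0 \<Longrightarrow> 1 - qp n \<noteq> 0"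
  using one_minus_power_nz[of "nat n"] qp_nat[of "nat n"] by simp

lemma qp_cancel: "n > 0 \<Longrightarrow> (1 - qp n) * x = (1 - qp n) * y \<Longrightarrow> x = y"
  using qp_minus_nz[of n] by simp

lemma rq_rec: "(1 - qp n) * rq n = rq (n - 1)"
proof (cases "n \<le> 0")
  case True
  then show ?thesis by (cases "n = 0") (auto simp: rq_def)
next
  case False
  define m where "m = nat (n - 1)"
  have n: "n = int (Suc m)" using False m_def by simp
  have "1 - q ^ Suc m \<noteq> 0" using one_minus_power_nz[of "Suc m"] by simp
  then have "(1 - q ^ Suc m) * (1 / qpoch q q (Suc m)) = 1 / qpoch q q m"
    using qpoch_q_nz[of m] by (simp add: qpoch_q_Suc divide_simps del: power_Suc)
  then have "(1 - qp (int (Suc m))) * rq (int (Suc m)) = rq (int m)"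
    unfolding rq_nat qp_nat .
  then show ?thesis unfolding n by simp
qed

text \<open>In the three summations below, one factor \<open>1 - q^N\<close> is split so that each half lowers an index.\<close>

lemma rq_durfee_sum:
  "(\<Sum>t\<le>N. qp (int t * int t + int c * int t) * rq (int N - int t) * rq (int t) * rq (int t + int c))
    = rq (int N) * rq (int N + int c)"
proof (induction N arbitrary: c)
  case 0
  then show ?case by simp
next
  case (Suc N)
  let ?T = "\<lambda>N c t. qp (int t * int t + int c * int t) * rq (int N - int t) * rq (int t) * rq (int t + int c)"
  let ?U = "\<lambda>t. qp (int t * int t + int c * int t + (int (Suc N) - int t)) * rq (int (Suc N) - int t) * rq (int t - 1) * rq (int t + int c)"
  have split: "(1 - qp (int (Suc N))) * ?T (Suc N) c t = ?T N c t + ?U t" for t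
  proof -
    have a: "1 - qp (int (Suc N)) = (1 - qp (int (Suc N) - int t))
        + qp (int (Suc N) - int t) * (1 - qp (int t))"
      by (simp add: algebra_simps flip: qp_add)
    have b: "rq (int N - int t) = (1 - qp (int (Suc N) - int t)) * rq (int (Suc N) - int t)"
      by (subst rq_rec) (simp add: algebra_simps)
    show ?thesis unfolding a b rq_rec[of "int t", symmetric] qp_add[of _ "int (Suc N) - int t"]
      by (simp only: ring_distribs mult_ac)
  qed
  have "(1 - qp (int (Suc N))) * (\<Sum>t\<le>Suc N. ?T (Suc N) c t) =
     (\<Sum>t\<le>Suc N. ?T N c t) + (\<Sum>t\<le>Suc N. ?U t)"
    unfolding sum_distrib_left split sum.distrib ..
  also have "(\<Sum>t\<le>Suc N. ?T N c t) = (\<Sum>t\<le>N. ?T N c t)"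
    by simp
  also have "(\<Sum>t\<le>Suc N. ?U t) = qp (int (Suc N + c)) * (\<Sum>t\<le>N. ?T N (Suc c) t)"
    unfolding sum.atMost_Suc_shift sum_distrib_left
    by (simp add: algebra_simps qp_add)
  also have "(\<Sum>t\<le>N. ?T N c t) + qp (int (Suc N + c)) * (\<Sum>t\<le>N. ?T N (Suc c) t)
    = rq (int N) * (rq (int (Suc N + c) - 1) + qp (int (Suc N + c)) * rq (int (Suc N + c)))"
    unfolding Suc.IH by (simp add: algebra_simps)
  also have "\<dots> = (1 - qp (int (Suc N))) * (rq (int (Suc N)) * rq (int (Suc N) + int c))"
    unfolding rq_rec[symmetric, of "int (Suc N + c)"] mult.assoc[symmetric] rq_rec[of "int (Suc N)"]
    by (simp add: algebra_simps)
  finally show ?case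
    by (rule qp_cancel[rotated]) simp
qed

lemma qpoch_qp_Suc: "qpoch q q (Suc n) = qpoch q q n * (1 - qp (int (Suc n)))"
  unfolding qp_nat by (rule qpoch_q_Suc)

lemma rq_vandermonde:
  "(\<Sum>j\<le>s. qp (int j * int j + int z * int j) * rq (int s - int j) * rq (int t - int j) * rq (int j) * rq (int z + int j))
    = qpoch q q (z + s + t) * rq (int z + int s) * rq (int z + int t) * rq (int s) * rq (int t)"
proof (induction s arbitrary: t z)
  case 0
  have "qpoch q q (z + t) * rq (int z + int t) = 1" using qpoch_rq[of "z + t"] by simp
  then show ?case by (simp add: mult_ac)
next
  case (Suc s)
  have rq_s: "rq (int s) = (1 - qp (int (Suc s))) * rq (int (Suc s))"
    by (subst rq_rec) simp
  let ?T = "\<lambda>s t z j. qp (int j * int j + int z * int j) * rq (int s - int j) * rq (t - int j) * rq (int j) * rq (int z + int j)"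
  let ?U = "\<lambda>j. qp (int j * int j + int z * int j + (int (Suc s) - int j)) * rq (int (Suc s) - int j) * rq (int t - int j) * rq (int j - 1) * rq (int z + int j)"
  have split: "(1 - qp (int (Suc s))) * ?T (Suc s) (int t) z j = ?T s (int t) z j + ?U j" for j
  proof -
    have a: "1 - qp (int (Suc s)) = (1 - qp (int (Suc s) - int j))
        + qp (int (Suc s) - int j) * (1 - qp (int j))"
      by (simp add: algebra_simps flip: qp_add)
    have b: "rq (int s - int j) = (1 - qp (int (Suc s) - int j)) * rq (int (Suc s) - int j)"
      by (subst rq_rec) (simp add: algebra_simps)
    show ?thesis unfolding a b rq_rec[of "int j", symmetric] qp_add[of _ "int (Suc s) - int j"]
      by (simp only: ring_distribs mult_ac)
  qed
  have "(1 - qp (int (Suc s))) * (\<Sum>j\<le>Suc s. ?T (Suc s) (int t) z j) =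
     (\<Sum>j\<le>Suc s. ?T s (int t) z j) + (\<Sum>j\<le>Suc s. ?U j)"
    unfolding sum_distrib_left split sum.distrib ..
  also have "(\<Sum>j\<le>Suc s. ?T s (int t) z j) = (\<Sum>j\<le>s. ?T s (int t) z j)"
    by simp
  also have "(\<Sum>j\<le>Suc s. ?U j) = qp (int (Suc s + z)) * (\<Sum>j\<le>s. ?T s (int t - 1) (Suc z) j)"
    unfolding sum.atMost_Suc_shift sum_distrib_left
    by (simp add: algebra_simps qp_add)
  also have "(\<Sum>j\<le>s. ?T s (int t - 1) (Suc z) j) =
      qpoch q q (z + s + t) * rq (int z + int (Suc s)) * rq (int z + int t) * rq (int s) * rq (int t - 1)"
  \<comment> \<open>The induction hypothesis speaks of natural t only. For t = 0 the lowered index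
    is -1 and both sides vanish.\<close>
  proof (cases t)
    case 0 then show ?thesis by simp
  next
    case (Suc t')
    have "(\<Sum>j\<le>s. ?T s (int t - 1) (Suc z) j) = (\<Sum>j\<le>s. ?T s (int t') (Suc z) j)"
      unfolding Suc by simp
    then show ?thesis unfolding Suc.IH unfolding Suc by (simp add: algebra_simps)
  qed
  also have "(\<Sum>j\<le>s. ?T s (int t) z j) + qp (int (Suc s + z)) * (qpoch q q (z + s + t) * rq (int z + int (Suc s)) * rq (int z + int t) * rq (int s) * rq (int t - 1))
    = qpoch q q (z + s + t) * rq (int z + int t) * rq (int s) * (rq (int (Suc s + z) - 1) * rq (int t)
        + qp (int (Suc s + z)) * rq (int (Suc s + z)) * rq (int t - 1))"
    unfolding Suc.IH by (simp add: algebra_simps)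
  also have "\<dots> = qpoch q q (z + s + t) * (1 - qp (int (Suc (z + s + t)))) * rq (int z + int t) * rq (int s)
       * rq (int (Suc s + z)) * rq (int t)"
    unfolding rq_rec[symmetric, of "int (Suc s + z)"] rq_rec[symmetric, of "int t"]
    by (simp add: algebra_simps flip: qp_add)
  also have "\<dots> = (1 - qp (int (Suc s))) * (qpoch q q (z + Suc s + t) * rq (int z + int (Suc s)) * rq (int z + int t) * rq (int (Suc s)) * rq (int t))"
    unfolding qpoch_qp_Suc[symmetric] rq_s by (simp add: mult_ac add_ac)
  finally show ?case
    by (rule qp_cancel[rotated]) simp
qed

text \<open>The second form of the q-Chu-Vandermonde sum, with the same right-hand side as
  \<open>rq_vandermonde\<close>. This form expands a kernel; the other one sums it back after the
  variables have been separated.\<close>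

lemma rq_vandermonde_reversed:
  "(\<Sum>j\<le>s. qp ((int s - int j) * (int t - int j)) * rq (int s - int j) * rq (int t - int j) * rq (int j) * rq (int z + int j))
    = qpoch q q (z + s + t) * rq (int z + int s) * rq (int z + int t) * rq (int s) * rq (int t)"
proof (induction s arbitrary: t z)
  case 0
  have "qpoch q q (z + t) * rq (int z + int t) = 1" using qpoch_rq[of "z + t"] by simp
  then show ?case by (simp add: mult_ac)
next
  case (Suc s)
  have rq_s: "rq (int s) = (1 - qp (int (Suc s))) * rq (int (Suc s))"
    by (subst rq_rec) simp
  let ?T = "\<lambda>s t z j. qp ((int s - int j) * (t - int j)) * rq (int s - int j) * rq (t - int j) * rq (int j) * rq (int z + int j)"
  let ?U = "\<lambda>j. qp ((int (Suc s) - int j) * (int t - int j)) * rq (int (Suc s) - int j) * rq (int t - int j) * rq (int j - 1) * rq (int z + int j)"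
  have split: "(1 - qp (int (Suc s))) * ?T (Suc s) (int t) z j = qp (int t) * ?T s (int t) z j + ?U j" for j
  proof -
    have a: "1 - qp (int (Suc s)) = qp (int j) * (1 - qp (int (Suc s) - int j)) + (1 - qp (int j))"
      by (simp add: algebra_simps flip: qp_add)
    have b: "rq (int s - int j) = (1 - qp (int (Suc s) - int j)) * rq (int (Suc s) - int j)"
      by (subst rq_rec) (simp add: algebra_simps)
    have c: "qp ((int (Suc s) - int j) * (int t - int j)) * qp (int j) = qp (int t) * qp ((int s - int j) * (int t - int j))"
      by (simp add: algebra_simps flip: qp_add)
    have "(1 - qp (int (Suc s))) * ?T (Suc s) (int t) z j
      = (qp ((int (Suc s) - int j) * (int t - int j)) * qp (int j))
          * ((1 - qp (int (Suc s) - int j)) * rq (int (Suc s) - int j) * rq (int t - int j) * rq (int j) * rq (int z + int j))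
        + ?U j"
      unfolding a rq_rec[of "int j", symmetric] by (simp only: ring_distribs mult_ac)
    then show ?thesis unfolding b c by (simp only: mult_ac)
  qed
  have "(1 - qp (int (Suc s))) * (\<Sum>j\<le>Suc s. ?T (Suc s) (int t) z j) =
     qp (int t) * (\<Sum>j\<le>Suc s. ?T s (int t) z j) + (\<Sum>j\<le>Suc s. ?U j)"
    unfolding sum_distrib_left split sum.distrib ..
  also have "(\<Sum>j\<le>Suc s. ?T s (int t) z j) = (\<Sum>j\<le>s. ?T s (int t) z j)"
    by simp
  also have "(\<Sum>j\<le>Suc s. ?U j) = (\<Sum>j\<le>s. ?T s (int t - 1) (Suc z) j)"
    unfolding sum.atMost_Suc_shift
    by (simp add: algebra_simps)
  also have "(\<Sum>j\<le>s. ?T s (int t - 1) (Suc z) j) =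
      qpoch q q (z + s + t) * rq (int z + int (Suc s)) * rq (int z + int t) * rq (int s) * rq (int t - 1)"
  proof (cases t)
    case 0 then show ?thesis by simp
  next
    case (Suc t')
    have "(\<Sum>j\<le>s. ?T s (int t - 1) (Suc z) j) = (\<Sum>j\<le>s. ?T s (int t') (Suc z) j)"
      unfolding Suc by simp
    then show ?thesis unfolding Suc.IH unfolding Suc by (simp add: algebra_simps)
  qed
  also have "qp (int t) * (\<Sum>j\<le>s. ?T s (int t) z j) + qpoch q q (z + s + t) * rq (int z + int (Suc s)) * rq (int z + int t) * rq (int s) * rq (int t - 1)
    = qpoch q q (z + s + t) * rq (int z + int t) * rq (int s) * (qp (int t) * rq (int (Suc s + z) - 1) * rq (int t)
        + rq (int (Suc s + z)) * rq (int t - 1))"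
    unfolding Suc.IH by (simp add: algebra_simps)
  also have "\<dots> = qpoch q q (z + s + t) * (1 - qp (int (Suc (z + s + t)))) * rq (int z + int t) * rq (int s)
       * rq (int (Suc s + z)) * rq (int t)"
    unfolding rq_rec[symmetric, of "int (Suc s + z)"] rq_rec[symmetric, of "int t"]
    by (simp add: algebra_simps flip: qp_add)
  also have "\<dots> = (1 - qp (int (Suc s))) * (qpoch q q (z + Suc s + t) * rq (int z + int (Suc s)) * rq (int z + int t) * rq (int (Suc s)) * rq (int t))"
    unfolding qpoch_qp_Suc[symmetric] rq_s by (simp add: mult_ac add_ac)
  finally show ?case
    by (rule qp_cancel[rotated]) simp
qed

end

section \<open>The Bailey step and its eigenfunctions\<close>

lemma sum_atMost_shift_zero:
  fixes f :: "nat \<Rightarrow> complex"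
  assumes "\<And>l. l < n \<Longrightarrow> f l = 0"
  shows "(\<Sum>l\<le>M + n. f l) = (\<Sum>s\<le>M. f (s + n))"
proof -
  have "(\<Sum>l\<le>M + n. f l) = (\<Sum>l\<in>{n..M + n}. f l)"
    by (rule sum.mono_neutral_right) (use assms in auto)
  also have "\<dots> = (\<Sum>s\<le>M. f (s + n))"
    using sum.shift_bounds_cl_nat_ivl[of f 0 n M] by (simp add: atMost_atLeast0)
  finally show ?thesis .
qed

context nome
begin

text \<open>The factor \<open>rq (int s - int j)\<close> makes the sum start at s = j, and s = t + j
  reduces it to \<open>rq_durfee_sum\<close> with c + j in place of c. For j > M both sides
  vanish.\<close>

lemma rq_durfee_sum_shifted:
  "(\<Sum>s\<le>M. qp (int s * int s - int j * int s + int c * int s) * rq (int M - int s) * rq (int s - int j) * rq (int s + int c))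
    = qp (int c * int j) * rq (int M - int j) * rq (int M + int c)"
proof (cases "j \<le> M")
  case True
  define N where "N = M - j"
  have M: "M = N + j" using True N_def by simp
  have "(\<Sum>s\<le>M. qp (int s * int s - int j * int s + int c * int s) * rq (int M - int s) * rq (int s - int j) * rq (int s + int c))
    = (\<Sum>t\<le>N. qp (int (t + j) * int (t + j) - int j * int (t + j) + int c * int (t + j)) * rq (int M - int (t + j)) * rq (int (t + j) - int j) * rq (int (t + j) + int c))"
    unfolding M by (rule sum_atMost_shift_zero) simp
  also have "\<dots> = (\<Sum>t\<le>N. qp (int c * int j) * (qp (int t * int t + int (j + c) * int t) * rq (int N - int t) * rq (int t) * rq (int t + int (j + c))))"
    unfolding M by (rule sum.cong) (simp_all add: algebra_simps qp_add)
  also have "\<dots> = qp (int c * int j) * (rq (int N) * rq (int N + int (j + c)))"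
    unfolding sum_distrib_left[symmetric] rq_durfee_sum ..
  finally show ?thesis unfolding M by (simp add: algebra_simps)
next
  case False
  then show ?thesis by simp
qed

text \<open>The sum \<open>rq_vandermonde_reversed\<close> absorbs the mixed factor \<open>q^(-s t)\<close>, after which the summations over \<open>s\<close> and \<open>t\<close> decouple.\<close>

lemma double_sum_basic:
  "(\<Sum>s\<le>M1. \<Sum>t\<le>M2. qp (int s * int s - int s * int t + int t * int t + int c * int s + int b * int t)
      * rq (int M1 - int s) * rq (int M2 - int t) * (qpoch q q (b + c + s + t)
      * rq (int s) * rq (int s + int c) * rq (int (b + c) + int s)
      * rq (int t) * rq (int t + int b) * rq (int (b + c) + int t)))
   = qpoch q q (b + c + M1 + M2) * rq (int M1) * rq (int M1 + int c) * rq (int (b + c) + int M1)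
      * rq (int M2) * rq (int M2 + int b) * rq (int (b + c) + int M2)" (is "?L = ?R")
proof -
  let ?z = "b + c"
  let ?U = "\<lambda>M c j s. qp (int s * int s - int j * int s + int c * int s) * rq (int M - int s) * rq (int s - int j) * rq (int s + int c)"
  let ?J = "\<lambda>j. qp (int j * int j) * rq (int j) * rq (int ?z + int j)"
  have "?L = (\<Sum>s\<le>M1. \<Sum>t\<le>M2. \<Sum>j\<le>M1. ?J j * (?U M1 c j s * ?U M2 b j t))"
  proof (intro sum.cong refl)
    fix s t assume s: "s \<in> {..M1}"
    let ?A = "\<lambda>j. qp ((int s - int j) * (int t - int j)) * rq (int s - int j) * rq (int t - int j) * rq (int j) * rq (int ?z + int j)"
    let ?B = "qp (int s * int s - int s * int t + int t * int t + int c * int s + int b * int t)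
      * rq (int M1 - int s) * rq (int M2 - int t) * rq (int s + int c) * rq (int t + int b)"
    have "qpoch q q (?z + s + t) * rq (int ?z + int s) * rq (int ?z + int t) * rq (int s) * rq (int t) = (\<Sum>j\<le>s. ?A j)"
      by (rule rq_vandermonde_reversed[symmetric])
    \<comment> \<open>A bound that does not depend on s allows the sum over j to be moved
      outside.\<close>
    also have "\<dots> = (\<Sum>j\<le>M1. ?A j)"
      by (rule sum.mono_neutral_left) (use s in auto)
    finally have e: "qpoch q q (?z + s + t) * rq (int ?z + int s) * rq (int ?z + int t) * rq (int s) * rq (int t) = (\<Sum>j\<le>M1. ?A j)" .
    have "?B * ?A j = ?J j * (?U M1 c j s * ?U M2 b j t)" for j
    proof -
      have "qp (int s * int s - int s * int t + int t * int t + int c * int s + int b * int t) * qp ((int s - int j) * (int t - int j))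
         = qp (int j * int j) * qp (int s * int s - int j * int s + int c * int s) * qp (int t * int t - int j * int t + int b * int t)"
        by (simp add: algebra_simps flip: qp_add)
      then have "(qp (int s * int s - int s * int t + int t * int t + int c * int s + int b * int t) * qp ((int s - int j) * (int t - int j))) * X
         = (qp (int j * int j) * qp (int s * int s - int j * int s + int c * int s) * qp (int t * int t - int j * int t + int b * int t)) * X" for X
        by simp
      from this[of "rq (int M1 - int s) * rq (int M2 - int t) * rq (int s + int c) * rq (int t + int b) * rq (int s - int j) * rq (int t - int j) * rq (int j) * rq (int ?z + int j)"]
      show ?thesis by (simp only: mult_ac)
    qed
    then have "?B * (\<Sum>j\<le>M1. ?A j) = (\<Sum>j\<le>M1. ?J j * (?U M1 c j s * ?U M2 b j t))"
      unfolding sum_distrib_left by (intro sum.cong refl)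
    then show "qp (int s * int s - int s * int t + int t * int t + int c * int s + int b * int t)
      * rq (int M1 - int s) * rq (int M2 - int t) * (qpoch q q (b + c + s + t)
      * rq (int s) * rq (int s + int c) * rq (int (b + c) + int s)
      * rq (int t) * rq (int t + int b) * rq (int (b + c) + int t)) = (\<Sum>j\<le>M1. ?J j * (?U M1 c j s * ?U M2 b j t))"
      unfolding e[symmetric] by (simp only: mult_ac)
  qed
  also have "\<dots> = (\<Sum>s\<le>M1. \<Sum>j\<le>M1. \<Sum>t\<le>M2. ?J j * (?U M1 c j s * ?U M2 b j t))"
    by (intro sum.cong refl sum.swap)
  also have "\<dots> = (\<Sum>j\<le>M1. \<Sum>s\<le>M1. \<Sum>t\<le>M2. ?J j * (?U M1 c j s * ?U M2 b j t))"
    by (rule sum.swap)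
  also have "\<dots> = (\<Sum>j\<le>M1. ?J j * ((\<Sum>s\<le>M1. ?U M1 c j s) * (\<Sum>t\<le>M2. ?U M2 b j t)))"
    unfolding sum_product by (simp only: sum_distrib_left)
  \<comment> \<open>The two inner sums contribute q^(c j) and q^(b j), which is the linear exponent
    of \<open>rq_vandermonde\<close> with z = b + c.\<close>
  also have "\<dots> = (\<Sum>j\<le>M1. rq (int M1 + int c) * rq (int M2 + int b) *
       (qp (int j * int j + int ?z * int j) * rq (int M1 - int j) * rq (int M2 - int j) * rq (int j) * rq (int ?z + int j)))"
    unfolding rq_durfee_sum_shifted by (rule sum.cong) (simp_all add: algebra_simps qp_add)
  also have "\<dots> = ?R"
    unfolding sum_distrib_left[symmetric] rq_vandermonde by (simp only: mult_ac)
  finally show ?thesis .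
qed

text \<open>Used with w = 0, 1, 2 and parameters adding up to 0, 1, 3. By \<open>Tstep_Psi\<close>
  these values belong to the linear exponents (0, 0), (0, 1), (1, 1).\<close>

definition Psi :: "nat \<Rightarrow> int \<Rightarrow> int \<Rightarrow> int \<Rightarrow> nat \<Rightarrow> nat \<Rightarrow> complex" where
  "Psi w a1 a2 a3 l m = qpoch q q (l + m + w)
     * rq (int l + a1) * rq (int l + a2) * rq (int l + a3)
     * rq (int m + int w - a1) * rq (int m + int w - a2) * rq (int m + int w - a3)"

text \<open>One layer of the multisum: (L1, L2) is the pair of parts outside the layer, (l, m) the
  pair that is summed over.\<close>

definition Tstep :: "int \<Rightarrow> int \<Rightarrow> (nat \<Rightarrow> nat \<Rightarrow> complex) \<Rightarrow> nat \<Rightarrow> nat \<Rightarrow> complex" where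
  "Tstep x y f L1 L2 = (\<Sum>l\<le>L1. \<Sum>m\<le>L2.
     qp (int l * int l - int l * int m + int m * int m + x * int l + y * int m)
      * rq (int L1 - int l) * rq (int L2 - int m) * f l m)"

lemma Psi_swap12: "Psi w a2 a1 a3 = Psi w a1 a2 a3"
  and Psi_swap23: "Psi w a1 a3 a2 = Psi w a1 a2 a3"
  by (simp_all add: Psi_def fun_eq_iff)

text \<open>The smallest parameter decides where the sum over l begins, namely at -a3, and the
  largest where the sum over m begins, at a1 - w. The last two assumptions say that these starting
  points are not negative. Shifting both sums to start at 0 gives \<open>double_sum_basic\<close>
  with the gaps a1 - a2 and a2 - a3 as b and c.\<close>

lemma Tstep_Psi_sorted:
  assumes "a1 \<ge> a2" "a2 \<ge> a3" "a3 \<le> 0" "a1 \<ge> int w"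
  shows "Tstep (a1 + a2 + a3 - int w) (2 * int w - (a1 + a2 + a3)) (Psi w a1 a2 a3) L1 L2
    = qp ((a1 + a2 + a3) * int w - int w * int w - (a1 * a2 + a1 * a3 + a2 * a3)) * Psi w a1 a2 a3 L1 L2"
proof (cases "int L1 + a3 \<ge> 0 \<and> int L2 + int w - a1 \<ge> 0")
  case False
  then consider "int L1 + a3 < 0" | "int L2 + int w - a1 < 0" by linarith
  then show ?thesis
    by cases (simp_all add: Tstep_def Psi_def)
next
  case True
  define n3 where "n3 = nat (- a3)"
  define n1 where "n1 = nat (a1 - int w)"
  define M1 where "M1 = nat (int L1 + a3)"
  define M2 where "M2 = nat (int L2 + int w - a1)"
  define b where "b = nat (a1 - a2)"
  define c where "c = nat (a2 - a3)"
  note defs = n3_def n1_def M1_def M2_def b_def c_def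
  have L: "L1 = M1 + n3" "L2 = M2 + n1" using assms True unfolding defs by linarith+
  have a3: "a3 = - int n3" and a2: "a2 = int c - int n3" and a1: "a1 = int b + int c - int n3"
    and wn: "w + n1 + n3 = b + c"
    using assms True unfolding defs by linarith+
  have w: "int w = int b + int c - int n1 - int n3" using wn by linarith
  let ?e = "(a1 + a2 + a3) * int w - int w * int w - (a1 * a2 + a1 * a3 + a2 * a3)"
  let ?F = "\<lambda>l m. qp (int l * int l - int l * int m + int m * int m + (a1 + a2 + a3 - int w) * int l + (2 * int w - (a1 + a2 + a3)) * int m)
      * rq (int L1 - int l) * rq (int L2 - int m) * Psi w a1 a2 a3 l m"
  have "Tstep (a1 + a2 + a3 - int w) (2 * int w - (a1 + a2 + a3)) (Psi w a1 a2 a3) L1 L2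
     = (\<Sum>l\<le>M1 + n3. \<Sum>m\<le>M2 + n1. ?F l m)"
    unfolding Tstep_def L ..
  also have "\<dots> = (\<Sum>s\<le>M1. \<Sum>m\<le>M2 + n1. ?F (s + n3) m)"
    by (rule sum_atMost_shift_zero) (simp add: Psi_def a3)
  also have "\<dots> = (\<Sum>s\<le>M1. \<Sum>t\<le>M2. ?F (s + n3) (t + n1))"
    by (intro sum.cong refl sum_atMost_shift_zero) (simp add: Psi_def a1 w)
  also have "\<dots> = (\<Sum>s\<le>M1. \<Sum>t\<le>M2. qp ?e * (qp (int s * int s - int s * int t + int t * int t + int c * int s + int b * int t)
      * rq (int M1 - int s) * rq (int M2 - int t) * (qpoch q q (b + c + s + t)
      * rq (int s) * rq (int s + int c) * rq (int (b + c) + int s)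
      * rq (int t) * rq (int t + int b) * rq (int (b + c) + int t))))"
  proof (intro sum.cong refl)
    fix s t
    let ?l = "s + n3" and ?m = "t + n1"
    have i: "?l + ?m + w = b + c + s + t" using wn by simp
    have e: "qp (int ?l * int ?l - int ?l * int ?m + int ?m * int ?m + (a1 + a2 + a3 - int w) * int ?l + (2 * int w - (a1 + a2 + a3)) * int ?m)
       = qp ?e * qp (int s * int s - int s * int t + int t * int t + int c * int s + int b * int t)"
      unfolding qp_add[symmetric] a1 a2 a3 w by (rule arg_cong[of _ _ qp]) (simp add: algebra_simps)
    have p: "Psi w a1 a2 a3 ?l ?m = qpoch q q (b + c + s + t)
      * rq (int s) * rq (int s + int c) * rq (int (b + c) + int s)
      * rq (int t) * rq (int t + int b) * rq (int (b + c) + int t)"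
      unfolding Psi_def i a1 a2 a3 w by (simp add: algebra_simps)
    show "?F ?l ?m = qp ?e * (qp (int s * int s - int s * int t + int t * int t + int c * int s + int b * int t)
      * rq (int M1 - int s) * rq (int M2 - int t) * (qpoch q q (b + c + s + t)
      * rq (int s) * rq (int s + int c) * rq (int (b + c) + int s)
      * rq (int t) * rq (int t + int b) * rq (int (b + c) + int t)))"
      unfolding e p L by (simp add: algebra_simps)
  qed
  also have "\<dots> = qp ?e * (qpoch q q (b + c + M1 + M2) * rq (int M1) * rq (int M1 + int c) * rq (int (b + c) + int M1)
      * rq (int M2) * rq (int M2 + int b) * rq (int (b + c) + int M2))"
    unfolding sum_distrib_left[symmetric] double_sum_basic ..
  also have "qpoch q q (b + c + M1 + M2) * rq (int M1) * rq (int M1 + int c) * rq (int (b + c) + int M1)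
      * rq (int M2) * rq (int M2 + int b) * rq (int (b + c) + int M2) = Psi w a1 a2 a3 L1 L2"
  proof -
    have i: "L1 + L2 + w = b + c + M1 + M2" using wn L by simp
    show ?thesis unfolding Psi_def i unfolding L a1 a2 a3 w by (simp add: algebra_simps)
  qed
  finally show ?thesis .
qed

text \<open>Everything is symmetric in the three parameters, so they may be sorted. The exponents x,
  y, e are separate variables so that the rule applies to exponents in any written form.\<close>

lemma Tstep_Psi:
  assumes "a1 \<le> 0 \<or> a2 \<le> 0 \<or> a3 \<le> 0" "a1 \<ge> int w \<or> a2 \<ge> int w \<or> a3 \<ge> int w"
    and x: "x = a1 + a2 + a3 - int w" and y: "y = 2 * int w - (a1 + a2 + a3)"
    and e: "e = (a1 + a2 + a3) * int w - int w * int w - (a1 * a2 + a1 * a3 + a2 * a3)"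
  shows "Tstep x y (Psi w a1 a2 a3) L1 L2 = qp e * Psi w a1 a2 a3 L1 L2"
proof -
  define G where "G a1 a2 a3 \<longleftrightarrow> Tstep (a1 + a2 + a3 - int w) (2 * int w - (a1 + a2 + a3)) (Psi w a1 a2 a3) L1 L2
    = qp ((a1 + a2 + a3) * int w - int w * int w - (a1 * a2 + a1 * a3 + a2 * a3)) * Psi w a1 a2 a3 L1 L2" for a1 a2 a3
  have G: "G a1 a2 a3" if "a1 \<ge> a2" "a2 \<ge> a3" "a3 \<le> 0" "a1 \<ge> int w" for a1 a2 a3
    unfolding G_def using Tstep_Psi_sorted[OF that] .
  have s1: "G a2 a1 a3 = G a1 a2 a3" for a1 a2 a3
    unfolding G_def Psi_swap12[of w a2 a1] by (simp add: algebra_simps)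
  have s2: "G a1 a3 a2 = G a1 a2 a3" for a1 a2 a3
    unfolding G_def Psi_swap23[of w a1 a3 a2] by (simp add: algebra_simps)
  have "G a1 a2 a3"
  proof -
    consider "a1 \<ge> a2 \<and> a2 \<ge> a3" | "a1 \<ge> a3 \<and> a3 \<ge> a2" | "a2 \<ge> a1 \<and> a1 \<ge> a3"
      | "a2 \<ge> a3 \<and> a3 \<ge> a1" | "a3 \<ge> a1 \<and> a1 \<ge> a2" | "a3 \<ge> a2 \<and> a2 \<ge> a1" by linarith
    then show ?thesis
    proof cases
      case 1 with assms show ?thesis by (intro G) auto
    next
      case 2 with assms have "G a1 a3 a2" by (intro G) auto
      then show ?thesis using s2 by simp
    next
      case 3 with assms have "G a2 a1 a3" by (intro G) auto
      then show ?thesis using s1 by simp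
    next
      case 4 with assms have "G a2 a3 a1" by (intro G) auto
      then show ?thesis using s1[of a1 a2 a3] s2[of a2 a1 a3] by simp
    next
      case 5 with assms have "G a3 a1 a2" by (intro G) auto
      then show ?thesis using s2[of a1 a2 a3] s1[of a1 a3 a2] by simp
    next
      case 6 with assms have "G a3 a2 a1" by (intro G) auto
      then show ?thesis using s1[of a1 a2 a3] s2[of a2 a1 a3] s1[of a2 a3 a1] by simp
    qed
  qed
  then show ?thesis unfolding G_def x y e .
qed

end

section \<open>Relations between the kernels\<close>

text \<open>Lagrange interpolation of the quadratic (t - Y)(t - Y') at the nodes x, y, z, evaluated
  at t = 1/X, with denominators cleared. The last factor on the right is the Vandermonde determinant
  (z - y)(x - y)(x - z).\<close>

lemma vandermonde_reduction:
  fixes x y z X Y Y' :: complex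
  shows "(x - Y) * (x - Y') * (z - y) * (1 - X * y) * (1 - X * z)
       + (y - Y) * (y - Y') * (x - z) * (1 - X * z) * (1 - X * x)
       + (z - Y) * (z - Y') * (y - x) * (1 - X * x) * (1 - X * y)
       = (1 - X * Y) * (1 - X * Y') * (x\<^sup>2 * (z - y) + y\<^sup>2 * (x - z) + z\<^sup>2 * (y - x))"
  by (simp add: algebra_simps power2_eq_square)

context nome
begin

text \<open>With \<open>x\<^sub>i = q^(1 + \<kappa>\<^sub>i)\<close>, the factor \<open>vdm\<close> is the Vandermonde determinant of the \<open>x\<^sub>i\<close>, expanded along the squares.\<close>

definition dcoef :: "int \<Rightarrow> int \<Rightarrow> int \<Rightarrow> complex" where
  "dcoef \<alpha> \<beta> \<gamma> = (qp (1 + \<alpha>))\<^sup>2 * (qp (1 + \<gamma>) - qp (1 + \<beta>))"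

definition vdm :: "int \<Rightarrow> int \<Rightarrow> int \<Rightarrow> complex" where
  "vdm \<alpha> \<beta> \<gamma> = dcoef \<alpha> \<beta> \<gamma> + dcoef \<beta> \<gamma> \<alpha> + dcoef \<gamma> \<alpha> \<beta>"

text \<open>The extra factor turns 1/(q)_(m - \<alpha>) into 1/(q)_(m - \<alpha> - 1), which is the
  factor that \<open>Psi 0\<close> with first parameter 1 + \<alpha> has.\<close>

definition Kker :: "int \<Rightarrow> int \<Rightarrow> int \<Rightarrow> nat \<Rightarrow> nat \<Rightarrow> complex" where
  "Kker \<alpha> \<beta> \<gamma> l m = (1 - qp (int m - \<alpha>)) * Psi 1 (1 + \<alpha>) \<beta> \<gamma> l m"

definition Pcommon :: "int \<Rightarrow> int \<Rightarrow> int \<Rightarrow> nat \<Rightarrow> nat \<Rightarrow> complex" where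
  "Pcommon \<alpha> \<beta> \<gamma> l m = qpoch q q (l + m + 1)
     * (rq (int l + (1 + \<alpha>)) * rq (int l + (1 + \<beta>)) * rq (int l + (1 + \<gamma>)))
     * (rq (int m + 1 - \<alpha>) * rq (int m + 1 - \<beta>) * rq (int m + 1 - \<gamma>))"

lemma Psi2_common:
  "Psi 2 (1 + \<alpha>) (1 + \<beta>) (1 + \<gamma>) l m = (1 - qp (int l) * qp (int m + 2)) * Pcommon \<alpha> \<beta> \<gamma> l m"
proof -
  have "qpoch q q (l + m + 2) = qpoch q q (l + m + 1) * (1 - qp (int l) * qp (int m + 2))"
    using qpoch_qp_Suc[of "l + m + 1"] by (simp add: algebra_simps flip: qp_add)
  moreover have "int m + int 2 - (1 + \<delta>) = int m + 1 - \<delta>" for \<delta>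
    by simp
  ultimately show ?thesis unfolding Psi_def Pcommon_def by (simp only: mult_ac)
qed

lemma Psi1_common:
  "Psi 1 (1 + \<alpha>) \<beta> \<gamma> l m = (1 - qp (int m + 1 - \<alpha>)) * (1 - qp (int l) * qp (1 + \<beta>)) * (1 - qp (int l) * qp (1 + \<gamma>))
      * Pcommon \<alpha> \<beta> \<gamma> l m"
proof -
  have l: "rq (int l + \<delta>) = (1 - qp (int l) * qp (1 + \<delta>)) * rq (int l + (1 + \<delta>))" for \<delta>
    using rq_rec[of "int l + (1 + \<delta>)"] by (simp add: algebra_simps flip: qp_add)
  have m: "rq (int m + 1 - (1 + \<alpha>)) = (1 - qp (int m + 1 - \<alpha>)) * rq (int m + 1 - \<alpha>)"
    using rq_rec[of "int m + 1 - \<alpha>"] by (simp add: algebra_simps)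
  show ?thesis unfolding Psi_def Pcommon_def of_nat_1 m l[of \<beta>] l[of \<gamma>] by (simp only: mult_ac)
qed

lemma Pcommon_rot: "Pcommon \<beta> \<gamma> \<alpha> = Pcommon \<alpha> \<beta> \<gamma>"
  by (simp add: Pcommon_def fun_eq_iff mult_ac)

lemma qp_cancel_mid: "qp (1 + \<alpha>) * qp (n - \<alpha>) = qp (n + 1)"
  by (simp add: algebra_simps flip: qp_add)

text \<open>The difference with 0 keeps the shape of \<open>vandermonde_reduction\<close> for Y' =
  0.\<close>

lemma dcoef_Psi1:
  "dcoef \<alpha> \<beta> \<gamma> * Psi 1 (1 + \<alpha>) \<beta> \<gamma> l m
    = (qp (1 + \<alpha>) - qp (int m + 2)) * (qp (1 + \<alpha>) - 0) * (qp (1 + \<gamma>) - qp (1 + \<beta>))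
      * (1 - qp (int l) * qp (1 + \<beta>)) * (1 - qp (int l) * qp (1 + \<gamma>)) * Pcommon \<alpha> \<beta> \<gamma> l m"
proof -
  have "qp (1 + \<alpha>) - qp (int m + 2) = qp (1 + \<alpha>) * (1 - qp (int m + 1 - \<alpha>))"
    using qp_cancel_mid[of \<alpha> "int m + 1"] by (simp add: algebra_simps)
  then show ?thesis unfolding dcoef_def Psi1_common power2_eq_square by (simp only: mult_ac diff_zero)
qed

lemma dcoef_Kker:
  "dcoef \<alpha> \<beta> \<gamma> * Kker \<alpha> \<beta> \<gamma> l m
    = (qp (1 + \<alpha>) - qp (int m + 2)) * (qp (1 + \<alpha>) - qp (int m + 1)) * (qp (1 + \<gamma>) - qp (1 + \<beta>))
      * (1 - qp (int l) * qp (1 + \<beta>)) * (1 - qp (int l) * qp (1 + \<gamma>)) * Pcommon \<alpha> \<beta> \<gamma> l m"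
proof -
  have "qp (1 + \<alpha>) - qp (int m + 1) = qp (1 + \<alpha>) * (1 - qp (int m - \<alpha>))"
    using qp_cancel_mid[of \<alpha> "int m"] by (simp add: algebra_simps)
  then have "dcoef \<alpha> \<beta> \<gamma> * Kker \<alpha> \<beta> \<gamma> l m * qp (1 + \<alpha>)
     = (qp (1 + \<alpha>) - qp (int m + 1)) * (dcoef \<alpha> \<beta> \<gamma> * Psi 1 (1 + \<alpha>) \<beta> \<gamma> l m)"
    unfolding Kker_def by (simp only: mult_ac)
  then show ?thesis unfolding dcoef_Psi1 by simp
qed

text \<open>Interpolation with Y = q^(m+2) and Y' = 0: the factor 1 - X Y = 1 - q^(l+m+2) is the one
  by which \<open>Psi 2\<close> differs from \<open>Pcommon\<close>.\<close>

lemma vdm_Psi2: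
  "vdm \<alpha> \<beta> \<gamma> * Psi 2 (1 + \<alpha>) (1 + \<beta>) (1 + \<gamma>) l m
    = dcoef \<alpha> \<beta> \<gamma> * Psi 1 (1 + \<alpha>) \<beta> \<gamma> l m + dcoef \<beta> \<gamma> \<alpha> * Psi 1 (1 + \<beta>) \<gamma> \<alpha> l m
    + dcoef \<gamma> \<alpha> \<beta> * Psi 1 (1 + \<gamma>) \<alpha> \<beta> l m"
  unfolding dcoef_Psi1 Pcommon_rot[of \<beta> \<gamma> \<alpha>] Pcommon_rot[of \<gamma> \<alpha> \<beta>] Psi2_common distrib_right[symmetric]
    vandermonde_reduction
  unfolding vdm_def dcoef_def by simp

text \<open>The same interpolation with Y' = q^(m+1) instead of 0; the second factor 1 - X Y' is
  then 1 - q^(l+m+1).\<close>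

lemma vdm_Psi2_Kker:
  "(1 - qp (int (l + m + 1))) * (vdm \<alpha> \<beta> \<gamma> * Psi 2 (1 + \<alpha>) (1 + \<beta>) (1 + \<gamma>) l m)
    = dcoef \<alpha> \<beta> \<gamma> * Kker \<alpha> \<beta> \<gamma> l m + dcoef \<beta> \<gamma> \<alpha> * Kker \<beta> \<gamma> \<alpha> l m
    + dcoef \<gamma> \<alpha> \<beta> * Kker \<gamma> \<alpha> \<beta> l m"
proof -
  have e: "qp (int (l + m + 1)) = qp (int l) * qp (int m + 1)"
    by (simp add: algebra_simps flip: qp_add)
  show ?thesis
    unfolding dcoef_Kker Pcommon_rot[of \<beta> \<gamma> \<alpha>] Pcommon_rot[of \<gamma> \<alpha> \<beta>] Psi2_common distrib_right[symmetric]
      vandermonde_reduction e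
    unfolding vdm_def dcoef_def by simp
qed

text \<open>Linear interpolation of t - q^(m+1) at the nodes q^\<beta> and q^\<gamma>, evaluated at
  t = q^(-l). The resulting factor 1 - q^(l+m+1) accounts for the passage from (q)_(l+m) to
  (q)_(l+m+1). The difference on the left is the part of \<open>dcoef\<close> that clears the
  denominator.\<close>

lemma Kker_Psi0:
  "(qp (1 + \<gamma>) - qp (1 + \<beta>)) * Kker \<alpha> \<beta> \<gamma> l m
    = qp (1 + \<gamma>) * Psi 0 (1 + \<alpha>) (\<beta> - 1) \<gamma> l m - qp (1 + \<beta>) * Psi 0 (1 + \<alpha>) \<beta> (\<gamma> - 1) l m"
proof -
  define C where "C = qpoch q q (l + m) * rq (int l + (1 + \<alpha>)) * rq (int m - (1 + \<alpha>))
     * (rq (int l + \<beta>) * rq (int l + \<gamma>)) * (rq (int m + 1 - \<beta>) * rq (int m + 1 - \<gamma>))"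
  have p: "qpoch q q (l + m + 1) = qpoch q q (l + m) * (1 - qp (int l) * qp (int m + 1))"
    using qpoch_qp_Suc[of "l + m"] by (simp add: algebra_simps flip: qp_add)
  have k: "rq (int m - (1 + \<alpha>)) = (1 - qp (int m - \<alpha>)) * rq (int m - \<alpha>)"
    using rq_rec[of "int m - \<alpha>"] by (simp add: algebra_simps)
  have K: "Kker \<alpha> \<beta> \<gamma> l m = (1 - qp (int l) * qp (int m + 1)) * C"
    unfolding Kker_def Psi_def C_def k of_nat_1 p by (simp add: mult_ac)
  have l: "rq (int l + (\<delta> - 1)) = (1 - qp (int l) * qp \<delta>) * rq (int l + \<delta>)" for \<delta>
    using rq_rec[of "int l + \<delta>"] by (simp add: algebra_simps flip: qp_add)
  have m: "rq (int m - \<delta>) = (1 - qp (int m + 1 - \<delta>)) * rq (int m + 1 - \<delta>)" for \<delta>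
    using rq_rec[of "int m + 1 - \<delta>"] by (simp add: algebra_simps)
  have m': "int m - (\<delta> - 1) = int m + 1 - \<delta>" for \<delta>
    by simp
  have P1: "Psi 0 (1 + \<alpha>) (\<beta> - 1) \<gamma> l m = (1 - qp (int l) * qp \<beta>) * (1 - qp (int m + 1 - \<gamma>)) * C"
    unfolding Psi_def C_def l of_nat_0 add_0_right m[of \<gamma>] m' by (simp only: mult_ac)
  have P2: "Psi 0 (1 + \<alpha>) \<beta> (\<gamma> - 1) l m = (1 - qp (int l) * qp \<gamma>) * (1 - qp (int m + 1 - \<beta>)) * C"
    unfolding Psi_def C_def l of_nat_0 add_0_right m[of \<beta>] m' by (simp only: mult_ac)
  have x: "qp (1 + \<delta>) * (1 - qp (int m + 1 - \<delta>)) = q * (qp \<delta> - qp (int m + 1))" for \<delta>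
  proof -
    have "qp (1 + \<delta>) = q * qp \<delta>" "qp (int m + 1 + 1) = q * qp (int m + 1)"
      using qp_nat[of 1] qp_add[of 1 \<delta>] qp_add[of "int m + 1" 1] by (simp_all del: add.assoc)
    then show ?thesis
      using qp_cancel_mid[of \<delta> "int m + 1"] by (simp only: right_diff_distrib mult_1_right)
  qed
  have "qp (1 + \<gamma>) * Psi 0 (1 + \<alpha>) (\<beta> - 1) \<gamma> l m - qp (1 + \<beta>) * Psi 0 (1 + \<alpha>) \<beta> (\<gamma> - 1) l m
     = ((1 - qp (int l) * qp \<beta>) * (qp (1 + \<gamma>) * (1 - qp (int m + 1 - \<gamma>)))
      - (1 - qp (int l) * qp \<gamma>) * (qp (1 + \<beta>) * (1 - qp (int m + 1 - \<beta>)))) * C"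
    unfolding P1 P2 by (simp add: algebra_simps)
  also have "\<dots> = (q * qp \<gamma> - q * qp \<beta>) * ((1 - qp (int l) * qp (int m + 1)) * C)"
    unfolding x by (simp add: algebra_simps)
  also have "q * qp \<gamma> - q * qp \<beta> = qp (1 + \<gamma>) - qp (1 + \<beta>)"
    using qp_nat[of 1] by (simp add: qp_add)
  finally show ?thesis unfolding K by simp
qed

end

section \<open>Expansion of the initial term in kernels\<close>

definition omega :: complex where "omega = Complex (-1/2) (sqrt 3 / 2)"

definition wp :: "int \<Rightarrow> complex" where "wp n = omega powi n"

lemma omega_sum: "1 + omega + omega\<^sup>2 = 0"
  by (simp add: omega_def complex_eq_iff power2_eq_square)

lemma omega_cube: "omega ^ 3 = 1"
proof -
  have "omega ^ 3 - 1 = (omega - 1) * (1 + omega + omega\<^sup>2)"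
    by (simp add: algebra_simps power2_eq_square power3_eq_cube)
  then show ?thesis using omega_sum by simp
qed

lemma omega_nz: "omega \<noteq> 0"
  using omega_cube by auto

lemma wp_add: "wp (m + n) = wp m * wp n"
  using omega_nz by (simp add: wp_def power_int_add)

lemma wp_nat: "wp (int n) = omega ^ n"
  by (simp add: wp_def)

lemma wp_triple: "wp (3 * n) = 1"
proof -
  have "wp (3 * n) = (omega powi 3) powi n"
    unfolding wp_def by (rule power_int_mult)
  also have "omega powi 3 = 1"
    using omega_cube by (simp add: power_int_def)
  finally show ?thesis by simp
qed

lemma wp_cong: "m = n + 3 * k \<Longrightarrow> wp m = wp n"
  by (simp add: wp_add wp_triple)

lemma wp_three_term: "wp n + wp (n + 1) + wp (n - 1) = 0"
proof -
  have "wp n + wp (n + 1) + wp (n - 1) = wp (n - 1) * (1 + wp 1 + wp 2)"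
    by (simp add: algebra_simps flip: wp_add)
  also have "1 + wp 1 + wp 2 = 1 + omega + omega\<^sup>2"
    using wp_nat[of 1] wp_nat[of 2] by simp
  finally show ?thesis using omega_sum by simp
qed

lemma wp_1_neq: "wp 1 - wp (-1) \<noteq> 0"
proof -
  have "wp 1 - wp (-1) = wp 1 - wp 2"
    using wp_cong[of "-1" 2 "-1"] by simp
  also have "\<dots> = omega - omega\<^sup>2"
    using wp_nat[of 1] wp_nat[of 2] by simp
  also have "\<dots> \<noteq> 0"
    by (simp add: omega_def complex_eq_iff power2_eq_square)
  finally show ?thesis .
qed

lemma wp_abs: "norm (wp n) = 1"
proof -
  have "norm omega ^ 3 = 1" using omega_cube by (metis norm_one norm_power)
  then have "norm omega = 1" using power_eq_1_iff by (metis norm_ge_zero power_eq_imp_eq_base power_one zero_less_numeral zero_le_one)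
  then show ?thesis by (simp add: wp_def norm_power_int)
qed

definition tri :: "int \<Rightarrow> int" where "tri n = n * (n - 1) div 2"

lemma two_tri: "2 * tri n = n * (n - 1)"
  by (simp add: tri_def)

lemma tri_add1: "tri (n + 1) = tri n + n"
proof -
  have "2 * tri (n + 1) = 2 * (tri n + n)"
    unfolding two_tri distrib_left by (simp add: algebra_simps)
  then show ?thesis by simp
qed

lemma tri_0 [simp]: "tri 0 = 0"
  by (simp add: tri_def)

text \<open>Half the squared length of (u, v, -u - v), or minus its second elementary symmetric
  function; in the latter form it is the eigenvalue exponent of \<open>Tstep_Psi\<close> for w =
  0.\<close>

definition hexn :: "int \<Rightarrow> int \<Rightarrow> int" where "hexn u v = u * u + u * v + v * v"

lemma has_sum_shift2:
  fixes h :: "int \<times> int \<Rightarrow> complex"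
  assumes "(h has_sum s) UNIV"
  shows "((\<lambda>(u, v). h (u + a, v + b)) has_sum s) UNIV"
  by (subst has_sum_reindex_bij_witness[where T = UNIV and h = h and s' = s
      and j = "\<lambda>(u, v). (u + a, v + b)" and i = "\<lambda>(u, v). (u - a, v - b)"]) (use assms in auto)

lemma (in nome) nome_power: "n > 0 \<Longrightarrow> nome (q ^ n)"
  using norm_q q_nz by unfold_locales (auto simp: norm_power power_less_one_iff)

context nome
begin

section \<open>The q-binomial theorem and its cubed version\<close>

definition rothe_coeff :: "nat \<Rightarrow> int \<Rightarrow> complex" where
  "rothe_coeff N j = (- 1) powi j * qp (tri j) * rq j * rq (int N - j)"

lemma rothe_coeff_neg: "j < 0 \<Longrightarrow> rothe_coeff N j = 0" and rothe_coeff_gt: "j > int N \<Longrightarrow> rothe_coeff N j = 0"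
  by (simp_all add: rothe_coeff_def)

lemma q_binomial_theorem: "qpoch z q N = qpoch q q N * (\<Sum>j\<le>N. rothe_coeff N (int j) * z ^ j)"
proof (induction N)
  case 0
  then show ?case by (simp add: qpoch_def rothe_coeff_def)
next
  case (Suc N)
  have rec: "(1 - qp (int (Suc N))) * rothe_coeff (Suc N) j = rothe_coeff N j - qp (int N) * rothe_coeff N (j - 1)" for j
  proof -
    have a: "1 - qp (int (Suc N)) = (1 - qp (int (Suc N) - j)) + qp (int (Suc N) - j) * (1 - qp j)"
      by (simp add: algebra_simps flip: qp_add)
    have b: "rq (int N - j) = (1 - qp (int (Suc N) - j)) * rq (int (Suc N) - j)"
      by (subst rq_rec) (simp add: algebra_simps)
    have t: "tri j = tri (j - 1) + (j - 1)" using tri_add1[of "j - 1"] by simp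
    have s: "(- 1 :: complex) powi j = - ((- 1) powi (j - 1))"
      using power_int_add[of "- 1 :: complex" "j - 1" 1] by simp
    have d: "int N - (j - 1) = int (Suc N) - j" by simp
    have e: "qp (int (Suc N) - j) * qp (tri j) = qp (int N) * qp (tri (j - 1))"
      unfolding t by (simp add: algebra_simps flip: qp_add)
    have "(1 - qp (int (Suc N))) * rothe_coeff (Suc N) j = rothe_coeff N j
      + (- 1) powi j * (qp (int (Suc N) - j) * qp (tri j)) * ((1 - qp j) * rq j) * rq (int (Suc N) - j)"
      unfolding rothe_coeff_def a b by (simp only: ring_distribs mult_ac)
    also have "\<dots> = rothe_coeff N j - qp (int N) * rothe_coeff N (j - 1)"
      unfolding rothe_coeff_def e rq_rec d s by (simp add: mult_ac)
    finally show ?thesis .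
  qed
  have "qpoch z q (Suc N) = qpoch q q N * ((\<Sum>j\<le>N. rothe_coeff N (int j) * z ^ j) * (1 - z * q ^ N))"
    unfolding qpoch_Suc Suc.IH by (simp only: mult.assoc)
  also have "(\<Sum>j\<le>N. rothe_coeff N (int j) * z ^ j) * (1 - z * q ^ N)
      = (\<Sum>j\<le>N. rothe_coeff N (int j) * z ^ j) - qp (int N) * (\<Sum>j\<le>N. rothe_coeff N (int j) * z ^ Suc j)"
  proof -
    have "(\<Sum>j\<le>N. rothe_coeff N (int j) * z ^ Suc j) = z * (\<Sum>j\<le>N. rothe_coeff N (int j) * z ^ j)"
      unfolding sum_distrib_left by (simp add: mult_ac)
    then show ?thesis unfolding qp_nat
      by (simp only: right_diff_distrib left_diff_distrib mult_1_right mult_1_left mult_ac)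
  qed
  also have "(\<Sum>j\<le>N. rothe_coeff N (int j) * z ^ j) = (\<Sum>j\<le>Suc N. rothe_coeff N (int j) * z ^ j)"
    by (simp add: rothe_coeff_gt)
  also have "(\<Sum>j\<le>N. rothe_coeff N (int j) * z ^ Suc j) = (\<Sum>j\<le>Suc N. rothe_coeff N (int j - 1) * z ^ j)"
    unfolding sum.atMost_Suc_shift by (simp add: rothe_coeff_neg)
  also have "(\<Sum>j\<le>Suc N. rothe_coeff N (int j) * z ^ j) - qp (int N) * (\<Sum>j\<le>Suc N. rothe_coeff N (int j - 1) * z ^ j)
     = (\<Sum>j\<le>Suc N. (rothe_coeff N (int j) - qp (int N) * rothe_coeff N (int j - 1)) * z ^ j)"
    unfolding sum_distrib_left sum_subtractf[symmetric] by (simp only: left_diff_distrib mult.assoc)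
  also have "\<dots> = (1 - qp (int (Suc N))) * (\<Sum>j\<le>Suc N. rothe_coeff (Suc N) (int j) * z ^ j)"
    unfolding rec[symmetric] sum_distrib_left by (simp only: mult.assoc)
  finally show ?case unfolding qpoch_qp_Suc by (simp only: mult.assoc)
qed

definition rothe_poly :: "nat \<Rightarrow> complex \<Rightarrow> complex poly" where
  "rothe_poly N c = (\<Sum>j\<le>N. monom (rothe_coeff N (int j) * c ^ j) j)"

lemma coeff_rothe_poly: "coeff (rothe_poly N c) i = rothe_coeff N (int i) * c ^ i"
  by (simp add: rothe_poly_def coeff_sum rothe_coeff_gt)

lemma poly_rothe_poly: "qpoch q q N * poly (rothe_poly N c) z = qpoch (c * z) q N"
  unfolding q_binomial_theorem[of "c * z"] by (simp add: rothe_poly_def poly_sum poly_monom power_mult_distrib mult_ac)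

lemma qpoch_cube: "qpoch (z ^ 3) (q ^ 3) N = qpoch (1 * z) q N * qpoch (omega * z) q N * qpoch (omega\<^sup>2 * z) q N"
proof -
  have "1 - z ^ 3 * (q ^ 3) ^ j = (1 - 1 * z * q ^ j) * (1 - omega * z * q ^ j) * (1 - omega\<^sup>2 * z * q ^ j)" for j
  proof -
    define t where "t = z * q ^ j"
    have "(1 - t) * (1 - omega * t) * (1 - omega\<^sup>2 * t)
       = 1 - (1 + omega + omega\<^sup>2) * t + omega * (1 + omega + omega\<^sup>2) * t\<^sup>2 - omega ^ 3 * t ^ 3"
      by (simp add: algebra_simps power2_eq_square power3_eq_cube)
    then have "1 - t ^ 3 = (1 - t) * (1 - omega * t) * (1 - omega\<^sup>2 * t)"
      unfolding omega_sum omega_cube by simp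
    moreover have "t ^ 3 = z ^ 3 * (q ^ 3) ^ j"
      by (simp add: t_def power_mult_distrib mult.commute flip: power_mult)
    ultimately show ?thesis by (simp add: t_def mult.assoc)
  qed
  then show ?thesis unfolding qpoch_def prod.distrib[symmetric] by simp
qed

text \<open>By \<open>qpoch_cube\<close> both sides come from (z^3; q^3)_N: three Rothe expansions
  in base q multiply to one expansion in base q^3 and powers of z^3. Agreement at all z gives
  agreement of coefficients.\<close>

lemma rothe_cube_coeff:
  "qpoch q q N ^ 3 * coeff (rothe_poly N 1 * rothe_poly N omega * rothe_poly N (omega\<^sup>2)) (3 * n)
     = qpoch (q ^ 3) (q ^ 3) N * nome.rothe_coeff (q ^ 3) N (int n)"
proof -
  interpret c: nome "q ^ 3" by (rule nome_power) simp
  define R where "R = (\<Sum>j\<le>N. monom (c.rothe_coeff N (int j)) (3 * j))"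
  have "smult (qpoch q q N ^ 3) (rothe_poly N 1 * rothe_poly N omega * rothe_poly N (omega\<^sup>2)) = smult (qpoch (q ^ 3) (q ^ 3) N) R"
  proof (rule poly_eq_poly_eq_iff[THEN iffD1], rule ext)
    fix z
    have "poly (smult (qpoch q q N ^ 3) (rothe_poly N 1 * rothe_poly N omega * rothe_poly N (omega\<^sup>2))) z
      = (qpoch q q N * poly (rothe_poly N 1) z) * (qpoch q q N * poly (rothe_poly N omega) z) * (qpoch q q N * poly (rothe_poly N (omega\<^sup>2)) z)"
      by (simp add: power3_eq_cube mult_ac)
    also have "\<dots> = qpoch (z ^ 3) (q ^ 3) N"
      unfolding poly_rothe_poly qpoch_cube ..
    also have "\<dots> = poly (smult (qpoch (q ^ 3) (q ^ 3) N) R) z"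
      unfolding c.q_binomial_theorem[of "z ^ 3"] R_def by (simp add: poly_sum poly_monom power_mult)
    finally show "poly (smult (qpoch q q N ^ 3) (rothe_poly N 1 * rothe_poly N omega * rothe_poly N (omega\<^sup>2))) z
       = poly (smult (qpoch (q ^ 3) (q ^ 3) N) R) z" .
  qed
  then have "coeff (smult (qpoch q q N ^ 3) (rothe_poly N 1 * rothe_poly N omega * rothe_poly N (omega\<^sup>2))) (3 * n)
     = coeff (smult (qpoch (q ^ 3) (q ^ 3) N) R) (3 * n)" by simp
  moreover have "coeff R (3 * n) = c.rothe_coeff N (int n)"
    by (simp add: R_def coeff_sum c.rothe_coeff_gt)
  ultimately show ?thesis by simp
qed

text \<open>The three degrees add up to 3 n. Measured from their mean n they become a triple with
  sum zero, that is, a point of the root lattice.\<close>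

lemma rothe_cube_has_sum:
  "((\<lambda>(u, v). rothe_coeff N (int n + u) * rothe_coeff N (int n + v) * rothe_coeff N (int n - u - v) * wp (u - v))
     has_sum coeff (rothe_poly N 1 * rothe_poly N omega * rothe_poly N (omega\<^sup>2)) (3 * n)) UNIV"
proof -
  \<comment> \<open>Here j is the degree taken from the first factor and i the degree taken from the
    first two together.\<close>
  define g where "g = (\<lambda>(i, j). (int j - int n, int i - int j - int n))"
  define D where "D = Sigma {..3 * n} (\<lambda>i. {..i})"
  define f where "f = (\<lambda>(u, v). rothe_coeff N (int n + u) * rothe_coeff N (int n + v) * rothe_coeff N (int n - u - v) * wp (u - v))"
  have inj: "inj_on g D" by (auto simp: inj_on_def g_def)
  have "(f has_sum coeff (rothe_poly N 1 * rothe_poly N omega * rothe_poly N (omega\<^sup>2)) (3 * n)) UNIV"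
  proof (rule has_sum_finite_neutralI)
    show "finite (g ` D)" by (simp add: D_def)
    show "f x = 0" if "x \<in> UNIV - g ` D" for x
    proof (rule ccontr)
      assume nz: "f x \<noteq> 0"
      obtain u v where x: "x = (u, v)" by force
      have "int n + u \<ge> 0" "int n + v \<ge> 0" "int n - u - v \<ge> 0"
        using nz by (auto simp: f_def x rothe_coeff_def rq_def split: if_splits)
      then have "x = g (nat (2 * int n + u + v), nat (int n + u))" "(nat (2 * int n + u + v), nat (int n + u)) \<in> D"
        by (auto simp: g_def D_def x)
      then show False using that by blast
    qed
    have "coeff (rothe_poly N 1 * rothe_poly N omega * rothe_poly N (omega\<^sup>2)) (3 * n) =
       (\<Sum>i\<le>3 * n. \<Sum>j\<le>i. f (g (i, j)))"
      unfolding coeff_mult sum_distrib_right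
    proof (intro sum.cong refl)
      fix i j assume ij: "i \<in> {..3 * n}" "j \<in> {..i}"
      \<comment> \<open>The exponent of \<open>omega\<close> is (i - j) + 2 (3 n - i), congruent to
        u - v modulo 3.\<close>
      have w: "wp (int j - int n - (int i - int j - int n)) = omega ^ (i - j) * (omega\<^sup>2) ^ (3 * n - i)"
      proof -
        have "omega ^ (i - j) * (omega\<^sup>2) ^ (3 * n - i) = wp (int (i - j) + int (2 * (3 * n - i)))"
          unfolding wp_add wp_nat by (simp add: power_mult)
        also have "\<dots> = wp (int j - int n - (int i - int j - int n))"
          by (rule wp_cong[where k = "2 * int n - int j"]) (use ij in \<open>simp add: of_nat_diff algebra_simps\<close>)
        finally show ?thesis by simp
      qed
      show "coeff (rothe_poly N 1) j * coeff (rothe_poly N omega) (i - j) * coeff (rothe_poly N (omega\<^sup>2)) (3 * n - i) = f (g (i, j))"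
        unfolding coeff_rothe_poly f_def g_def prod.case w using ij by (simp add: of_nat_diff algebra_simps)
    qed
    also have "\<dots> = (\<Sum>x\<in>D. f (g x))"
      unfolding D_def by (subst sum.Sigma) auto
    also have "\<dots> = (\<Sum>x\<in>g ` D. f x)"
      by (subst sum.reindex[OF inj]) simp
    finally show "coeff (rothe_poly N 1 * rothe_poly N omega * rothe_poly N (omega\<^sup>2)) (3 * n) = (\<Sum>x\<in>g ` D. f x)" .
  qed simp
  then show ?thesis unfolding f_def .
qed

definition cube_term :: "nat \<Rightarrow> nat \<Rightarrow> int \<times> int \<Rightarrow> complex" where
  "cube_term n m = (\<lambda>(u, v). qp (hexn u v) * wp (u - v) * Psi 0 u v (- u - v) n m)"

lemma qbinom_cube_has_sum:
  "(cube_term n m has_sum (qbinom (q ^ 3) (n + m) n * (rq (int (n + m)))\<^sup>2)) UNIV"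
proof -
  interpret c: nome "q ^ 3" by (rule nome_power) simp
  let ?N = "n + m"
  \<comment> \<open>Removes the sign and the power of q from the Rothe coefficient in base q^3 and
    supplies the numerator (q)_N of \<open>Psi 0\<close>.\<close>
  let ?C = "(- 1) powi int n * qp (- 3 * tri (int n)) * qpoch q q ?N :: complex"
  let ?f = "\<lambda>(u, v). rothe_coeff ?N (int n + u) * rothe_coeff ?N (int n + v) * rothe_coeff ?N (int n - u - v) * wp (u - v)"
  have s: "(- 1 :: complex) powi x * (- 1) powi x = 1" for x
    by (simp add: power_int_add[symmetric] power_int_mult_distrib[symmetric] flip: power_int_mult_distrib)
  have "cube_term n m x = ?C * ?f x" for x
  proof -
    obtain u v where x: "x = (u, v)" by force
    have "2 * tri (int n + u) + 2 * tri (int n + v) + 2 * tri (int n - u - v) = 3 * (2 * tri (int n)) + 2 * hexn u v"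
      unfolding two_tri hexn_def by (simp add: algebra_simps)
    then have t: "hexn u v = - 3 * tri (int n) + tri (int n + u) + tri (int n + v) + tri (int n - u - v)"
      by simp
    have sg: "(- 1 :: complex) powi int n * ((- 1) powi (int n + u) * (- 1) powi (int n + v) * (- 1) powi (int n - u - v)) = 1"
    proof -
      have m1: "(- 1 :: complex) powi x * (- 1) powi y = (- 1) powi (x + y)" for x y
        by (simp add: power_int_add)
      have "int n + (int n + u + (int n + v) + (int n - u - v)) = 2 * (2 * int n)"
        by simp
      then show ?thesis unfolding m1 by (simp only: power_int_mult) simp
    qed
    have "?C * ?f x = ((- 1) powi int n * ((- 1) powi (int n + u) * (- 1) powi (int n + v) * (- 1) powi (int n - u - v)))
        * (qp (- 3 * tri (int n)) * qp (tri (int n + u)) * qp (tri (int n + v)) * qp (tri (int n - u - v)))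
        * wp (u - v) * (qpoch q q ?N * (rq (int n + u) * rq (int ?N - (int n + u))) * (rq (int n + v) * rq (int ?N - (int n + v)))
          * (rq (int n - u - v) * rq (int ?N - (int n - u - v))))"
      unfolding x prod.case rothe_coeff_def by (simp only: mult_ac)
    also have "\<dots> = cube_term n m x"
      unfolding sg cube_term_def x prod.case t qp_add Psi_def by (simp add: algebra_simps)
    finally show ?thesis ..
  qed
  then have h: "cube_term n m = (\<lambda>x. ?C * ?f x)" by blast
  have "((\<lambda>x. ?C * ?f x) has_sum (?C * coeff (rothe_poly ?N 1 * rothe_poly ?N omega * rothe_poly ?N (omega\<^sup>2)) (3 * n))) UNIV"
    by (rule has_sum_cmult_right[OF rothe_cube_has_sum])
  also have "?C * coeff (rothe_poly ?N 1 * rothe_poly ?N omega * rothe_poly ?N (omega\<^sup>2)) (3 * n)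
     = qbinom (q ^ 3) ?N n * (rq (int ?N))\<^sup>2"
  proof -
    have r: "(rq (int ?N))\<^sup>2 * qpoch q q ?N ^ 3 = qpoch q q ?N"
      unfolding power2_eq_square power3_eq_cube using qpoch_rq[of ?N] by (simp add: mult_ac)
    have q3: "c.qp (tri (int n)) = qp (3 * tri (int n))"
      unfolding c.qp_def qp_def power_int_mult by simp
    have z: "qp (- 3 * tri (int n)) * qp (3 * tri (int n)) = 1"
      by (simp flip: qp_add)
    have "?C * coeff (rothe_poly ?N 1 * rothe_poly ?N omega * rothe_poly ?N (omega\<^sup>2)) (3 * n)
       = (- 1) powi int n * qp (- 3 * tri (int n)) * (rq (int ?N))\<^sup>2
          * (qpoch q q ?N ^ 3 * coeff (rothe_poly ?N 1 * rothe_poly ?N omega * rothe_poly ?N (omega\<^sup>2)) (3 * n))"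
    proof -
      have "?C * X = (- 1) powi int n * qp (- 3 * tri (int n)) * ((rq (int ?N))\<^sup>2 * qpoch q q ?N ^ 3) * X" for X
        unfolding r ..
      from this[of "coeff (rothe_poly ?N 1 * rothe_poly ?N omega * rothe_poly ?N (omega\<^sup>2)) (3 * n)"]
      show ?thesis by (simp only: mult_ac)
    qed
    also have "\<dots> = ((- 1) powi int n * (- 1) powi int n) * (qp (- 3 * tri (int n)) * qp (3 * tri (int n))) * (rq (int ?N))\<^sup>2
          * (qpoch (q ^ 3) (q ^ 3) ?N * c.rq (int n) * c.rq (int m))"
      unfolding rothe_cube_coeff c.rothe_coeff_def q3 by (simp add: mult_ac)
    also have "\<dots> = qbinom (q ^ 3) ?N n * (rq (int ?N))\<^sup>2"
      unfolding s z qbinom_def c.rq_nat by (simp add: field_simps)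
    finally show ?thesis .
  qed
  finally show ?thesis unfolding h .
qed

definition g0_term :: "nat \<Rightarrow> nat \<Rightarrow> int \<times> int \<Rightarrow> complex" where
  "g0_term n m = (\<lambda>(u, v). qp (hexn u v) * wp (u - v) * (vdm u v (- u - v) * Psi 2 (1 + u) (1 + v) (1 + (- u - v)) n m))"

text \<open>The relations \<open>vdm_Psi2_Kker\<close> and \<open>Kker_Psi0\<close> produce six
  kernels \<open>Psi 0\<close>, which sit at the six nearest neighbours of (u, v, -u - v) in the
  root lattice. The powers of q in \<open>dcoef\<close> change \<open>hexn\<close> at the point into
  \<open>hexn\<close> at the neighbour, up to q^2. Modulo 3, u - v drops by 1 for three neighbours
  and grows by 1 for the others, whence the two characters.\<close>

lemma g0_term_cube_term:
  "(1 - qp (int (n + m + 1))) * g0_term n m (u, v)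
    = qp 2 * wp 1 * (cube_term n m (u + 1, v - 1) + cube_term n m (u, v + 1) + cube_term n m (u - 1, v))
    - qp 2 * wp (- 1) * (cube_term n m (u + 1, v) + cube_term n m (u - 1, v + 1) + cube_term n m (u, v - 1))"
proof -
  define t where "t = - u - v"
  have e: "qp (hexn u v) * ((qp (1 + \<alpha>))\<^sup>2 * qp (1 + \<gamma>)) = qp 2 * qp (hexn u' v')"
    if "hexn u v + 3 + 2 * \<alpha> + \<gamma> = 2 + hexn u' v'" for \<alpha> \<gamma> u' v'
  proof -
    have "qp (hexn u v) * ((qp (1 + \<alpha>))\<^sup>2 * qp (1 + \<gamma>)) = qp (hexn u v + 3 + 2 * \<alpha> + \<gamma>)"
      unfolding power2_eq_square by (simp add: algebra_simps flip: qp_add)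
    then show ?thesis unfolding that qp_add .
  qed
  have trm: "qp (hexn u v) * wp (u - v) * (dcoef \<alpha> \<beta> \<gamma> * Kker \<alpha> \<beta> \<gamma> n m)
    = qp (hexn u v) * ((qp (1 + \<alpha>))\<^sup>2 * qp (1 + \<gamma>)) * wp (u - v) * Psi 0 (1 + \<alpha>) (\<beta> - 1) \<gamma> n m
     - qp (hexn u v) * ((qp (1 + \<alpha>))\<^sup>2 * qp (1 + \<beta>)) * wp (u - v) * Psi 0 (1 + \<alpha>) \<beta> (\<gamma> - 1) n m" for \<alpha> \<beta> \<gamma>
    unfolding dcoef_def mult.assoc Kker_Psi0 by (simp add: algebra_simps)
  have rot: "Psi 0 a b c = Psi 0 b c a" for a b c
    using Psi_swap12 Psi_swap23 by metis
  have T1: "qp (hexn u v) * ((qp (1 + \<alpha>))\<^sup>2 * qp (1 + \<gamma>)) * wp (u - v) * P = qp 2 * qp (hexn u' v') * (wp 1 * wp (u' - v')) * P"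
    if A: "hexn u v + 3 + 2 * \<alpha> + \<gamma> = 2 + hexn u' v'" and B: "u' - v' = u - v - 1 + 3 * k" for \<alpha> \<gamma> u' v' k P
  proof -
    have "wp (u - v) = wp 1 * wp (u' - v')"
      unfolding wp_add[symmetric] by (rule wp_cong[of _ _ "- k"]) (use B in simp)
    then show ?thesis unfolding e[OF A] by simp
  qed
  have T2: "qp (hexn u v) * ((qp (1 + \<alpha>))\<^sup>2 * qp (1 + \<gamma>)) * wp (u - v) * P = qp 2 * qp (hexn u' v') * (wp (- 1) * wp (u' - v')) * P"
    if A: "hexn u v + 3 + 2 * \<alpha> + \<gamma> = 2 + hexn u' v'" and B: "u' - v' = u - v + 1 + 3 * k" for \<alpha> \<gamma> u' v' k P
  proof -
    have "wp (u - v) = wp (- 1) * wp (u' - v')"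
      unfolding wp_add[symmetric] by (rule wp_cong[of _ _ "- k"]) (use B in simp)
    then show ?thesis unfolding e[OF A] by simp
  qed
  have df: "u + 1 - (v - 1) = u - v - 1 + 3 * 1" "u - (v + 1) = u - v - 1 + 3 * 0" "u - 1 - v = u - v - 1 + 3 * 0"
    "u + 1 - v = u - v + 1 + 3 * 0" "u - 1 - (v + 1) = u - v + 1 + 3 * (- 1)" "u - (v - 1) = u - v + 1 + 3 * 0"
    by simp_all
  have hx: "hexn u v + 3 + 2 * u + t = 2 + hexn (u + 1) (v - 1)"
     "hexn u v + 3 + 2 * v + u = 2 + hexn u (v + 1)"
     "hexn u v + 3 + 2 * t + v = 2 + hexn (u - 1) v"
     "hexn u v + 3 + 2 * u + v = 2 + hexn (u + 1) v"
     "hexn u v + 3 + 2 * v + t = 2 + hexn (u - 1) (v + 1)"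
     "hexn u v + 3 + 2 * t + u = 2 + hexn u (v - 1)"
    by (simp_all add: hexn_def t_def algebra_simps)
  have "(1 - qp (int (n + m + 1))) * g0_term n m (u, v)
     = qp (hexn u v) * wp (u - v) * ((1 - qp (int (n + m + 1))) * (vdm u v t * Psi 2 (1 + u) (1 + v) (1 + t) n m))"
    unfolding g0_term_def t_def prod.case by (simp only: mult_ac)
  also have "\<dots> = qp (hexn u v) * wp (u - v) * (dcoef u v t * Kker u v t n m)
     + qp (hexn u v) * wp (u - v) * (dcoef v t u * Kker v t u n m)
     + qp (hexn u v) * wp (u - v) * (dcoef t u v * Kker t u v n m)"
    unfolding vdm_Psi2_Kker by (simp only: distrib_left)
  also have "\<dots> =
      qp 2 * qp (hexn (u + 1) (v - 1)) * (wp 1 * wp (u + 1 - (v - 1))) * Psi 0 (1 + u) (v - 1) t n m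
    - qp 2 * qp (hexn (u + 1) v) * (wp (- 1) * wp (u + 1 - v)) * Psi 0 (1 + u) v (t - 1) n m
    + (qp 2 * qp (hexn u (v + 1)) * (wp 1 * wp (u - (v + 1))) * Psi 0 (1 + v) (t - 1) u n m
    - qp 2 * qp (hexn (u - 1) (v + 1)) * (wp (- 1) * wp (u - 1 - (v + 1))) * Psi 0 (1 + v) t (u - 1) n m)
    + (qp 2 * qp (hexn (u - 1) v) * (wp 1 * wp (u - 1 - v)) * Psi 0 (1 + t) (u - 1) v n m
    - qp 2 * qp (hexn u (v - 1)) * (wp (- 1) * wp (u - (v - 1))) * Psi 0 (1 + t) u (v - 1) n m)"
    unfolding trm
    by (simp only: T1[OF hx(1) df(1)] T1[OF hx(2) df(2)] T1[OF hx(3) df(3)]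
        T2[OF hx(4) df(4)] T2[OF hx(5) df(5)] T2[OF hx(6) df(6)])
  also have "\<dots> = qp 2 * wp 1 * (cube_term n m (u + 1, v - 1) + cube_term n m (u, v + 1) + cube_term n m (u - 1, v))
    - qp 2 * wp (- 1) * (cube_term n m (u + 1, v) + cube_term n m (u - 1, v + 1) + cube_term n m (u, v - 1))"
  proof -
    have "Psi 0 (1 + v) (t - 1) u = Psi 0 u (1 + v) (t - 1)" "Psi 0 (1 + v) t (u - 1) = Psi 0 (u - 1) (1 + v) t"
      "Psi 0 (1 + t) (u - 1) v = Psi 0 (u - 1) v (1 + t)" "Psi 0 (1 + t) u (v - 1) = Psi 0 u (v - 1) (1 + t)"
      using rot by metis+
    moreover have "- (u + 1) - (v - 1) = t" "- (u + 1) - v = t - 1" "- u - (v + 1) = t - 1"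
      "- (u - 1) - (v + 1) = t" "- (u - 1) - v = 1 + t" "- u - (v - 1) = 1 + t"
      by (simp_all add: t_def)
    ultimately show ?thesis unfolding cube_term_def prod.case
      by (simp only: add.commute[of 1]) (simp only: ring_distribs mult_ac add_ac diff_conv_add_uminus minus_add_distrib)
  qed
  finally show ?thesis .
qed

lemma qpoch_q2: "(1 - q) * qpoch (q ^ 2) q N = qpoch q q (Suc N)"
  unfolding qpoch_def prod.lessThan_Suc_shift by (simp add: power2_eq_square mult.assoc)

text \<open>Each of the six translates has the same sum, three with \<open>wp 1\<close> and three
  with \<open>- wp (- 1)\<close>; this is the origin of the constant. Division by 1 - q^(n+m+1) then
  turns one (q)_(n+m) into the (q^2; q)_(n+m) of \<open>g0\<close>.\<close>

lemma g0_has_sum: "(g0_term n m has_sum (3 * q\<^sup>2 * (wp 1 - wp (- 1)) / (1 - q) * g0 n m q)) UNIV"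
proof -
  let ?N = "n + m" and ?h = "cube_term n m"
  let ?s = "qbinom (q ^ 3) (n + m) n * (rq (int (n + m)))\<^sup>2"
  have q1: "1 - q \<noteq> 0" using norm_q by auto
  have nz: "1 - qp (int (?N + 1)) \<noteq> 0" by (rule qp_minus_nz) simp
  note sh = has_sum_shift2[OF qbinom_cube_has_sum[of n m]]
  have "((\<lambda>(u, v). qp 2 * wp 1 * (?h (u + 1, v + (- 1)) + ?h (u + 0, v + 1) + ?h (u + (- 1), v + 0))
      + - (qp 2 * wp (- 1)) * (?h (u + 1, v + 0) + ?h (u + (- 1), v + 1) + ?h (u + 0, v + (- 1))))
     has_sum (qp 2 * wp 1 * (?s + ?s + ?s) + - (qp 2 * wp (- 1)) * (?s + ?s + ?s))) UNIV"
    unfolding split_def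
    by (intro has_sum_add has_sum_cmult_right sh[unfolded split_def])
  then have "((\<lambda>x. (1 - qp (int (?N + 1))) * g0_term n m x) has_sum (3 * q\<^sup>2 * (wp 1 - wp (- 1)) * ?s)) UNIV"
  proof (rule arg_cong2[of _ _ _ _ "\<lambda>f s. (f has_sum s) UNIV", THEN iffD1, rotated 2])
    show "(\<lambda>(u, v). qp 2 * wp 1 * (?h (u + 1, v + (- 1)) + ?h (u + 0, v + 1) + ?h (u + (- 1), v + 0))
      + - (qp 2 * wp (- 1)) * (?h (u + 1, v + 0) + ?h (u + (- 1), v + 1) + ?h (u + 0, v + (- 1))))
      = (\<lambda>x. (1 - qp (int (?N + 1))) * g0_term n m x)"
      unfolding fun_eq_iff split_paired_All prod.case g0_term_cube_term by simp
    show "qp 2 * wp 1 * (?s + ?s + ?s) + - (qp 2 * wp (- 1)) * (?s + ?s + ?s) = 3 * q\<^sup>2 * (wp 1 - wp (- 1)) * ?s"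
      using qp_nat[of 2] by (simp add: algebra_simps)
  qed
  then have "(g0_term n m has_sum (3 * q\<^sup>2 * (wp 1 - wp (- 1)) * ?s / (1 - qp (int (?N + 1))))) UNIV"
    by (rule has_sum_cmult_right_iff[OF nz, THEN iffD1])
  also have "3 * q\<^sup>2 * (wp 1 - wp (- 1)) * ?s / (1 - qp (int (?N + 1))) = 3 * q\<^sup>2 * (wp 1 - wp (- 1)) / (1 - q) * g0 n m q"
  proof -
    have a: "qpoch (q ^ 2) q ?N = qpoch q q ?N * (1 - qp (int (?N + 1))) / (1 - q)"
      using trans[OF qpoch_q2[of ?N] qpoch_qp_Suc[of ?N]] q1 by (simp add: nonzero_eq_divide_eq mult.commute)
    show ?thesis unfolding g0_def a rq_nat using q1 nz qpoch_q_nz[of ?N]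
      by (simp add: divide_simps power2_eq_square)
  qed
  finally show ?thesis .
qed

end

section \<open>Iterating the Bailey step\<close>

lemma has_sum_finite_sum:
  fixes f :: "'i \<Rightarrow> 'a \<Rightarrow> complex"
  assumes "finite I" "\<And>i. i \<in> I \<Longrightarrow> (f i has_sum F i) A"
  shows "((\<lambda>x. \<Sum>i\<in>I. f i x) has_sum (\<Sum>i\<in>I. F i)) A"
  using assms by (induction I rule: finite_induct) (auto intro: has_sum_add)

lemma has_sum_eqI:
  assumes "(f has_sum s) A" "\<And>x. x \<in> A \<Longrightarrow> f x = g x" "s = t"
  shows "(g has_sum t) A"
  using assms has_sum_cong[of A f g] by simp

context nome
begin

text \<open>The multisum without its first factor, with an outer bound (L1, L2). The recursion
  removes the outermost layer; an index that has reached 0 stays there by truncated subtraction, so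
  all deeper layers keep their linear exponent.\<close>

primrec chain :: "nat \<Rightarrow> nat \<Rightarrow> nat \<Rightarrow> nat \<Rightarrow> nat \<Rightarrow> complex" where
  "chain 0 a b = (\<lambda>L1 L2. g0 L1 L2 q)"
| "chain (Suc k) a b = Tstep (if a = 0 then 1 else 0) (if b = 0 then 1 else 0) (chain k (a - 1) (b - 1))"

lemma Tstep_has_sum:
  assumes "\<And>l m. ((\<lambda>x. f x l m) has_sum F l m) A"
  shows "((\<lambda>x. Tstep i j (f x) L1 L2) has_sum Tstep i j F L1 L2) A"
  unfolding Tstep_def by (intro has_sum_finite_sum has_sum_cmult_right assms) auto

lemma Tstep_cmult: "Tstep i j (\<lambda>l m. c * f l m) L1 L2 = c * Tstep i j f L1 L2"
  by (simp add: Tstep_def sum_distrib_left mult_ac)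

lemma Tstep_add: "Tstep i j (\<lambda>l m. f l m + g l m) L1 L2 = Tstep i j f L1 L2 + Tstep i j g L1 L2"
  by (simp add: Tstep_def distrib_left sum.distrib)

lemma Tstep_diff: "Tstep i j (\<lambda>l m. f l m - g l m) L1 L2 = Tstep i j f L1 L2 - Tstep i j g L1 L2"
  by (simp add: Tstep_def right_diff_distrib sum_subtractf)

text \<open>Powers of q attached to the summand are linear exponents of the layer; this is how a
  factor q^(\<lambda>_a + \<mu>_b) lowers the indices of a chain.\<close>

lemma Tstep_absorb:
  "Tstep (i + i') (j + j') f L1 L2 = Tstep i j (\<lambda>l m. qp (i' * int l + j' * int m) * f l m) L1 L2"
  unfolding Tstep_def
proof (intro sum.cong refl)
  fix l m
  have "qp (int l * int l - int l * int m + int m * int m + (i + i') * int l + (j + j') * int m)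
    = qp (int l * int l - int l * int m + int m * int m + i * int l + j * int m) * qp (i' * int l + j' * int m)"
    by (simp add: algebra_simps flip: qp_add)
  then show "qp (int l * int l - int l * int m + int m * int m + (i + i') * int l + (j + j') * int m) * rq (int L1 - int l) * rq (int L2 - int m) * f l m =
    qp (int l * int l - int l * int m + int m * int m + i * int l + j * int m) * rq (int L1 - int l) * rq (int L2 - int m) *
           (qp (i' * int l + j' * int m) * f l m)"
    by simp
qed

text \<open>At the origin all parameters of \<open>Psi 2\<close> equal 1, and
  \<open>Tstep_Psi\<close> does not apply, but there the determinant vanishes. Elsewhere one
  coordinate is at least 1 and another at most -1, as \<open>Tstep_Psi\<close> requires.\<close>

lemma Tstep_vdm_Psi2:
  assumes "t = - u - v"
  shows "Tstep 1 1 (\<lambda>l m. vdm u v t * Psi 2 (1 + u) (1 + v) (1 + t) l m) L1 L2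
    = qp (hexn u v - 1) * (vdm u v t * Psi 2 (1 + u) (1 + v) (1 + t) L1 L2)"
proof (cases "u = 0 \<and> v = 0")
  case True
  then have "vdm u v t = 0" using assms by (simp add: vdm_def dcoef_def)
  then show ?thesis by (simp add: Tstep_def)
next
  case False
  have "Tstep 1 1 (Psi 2 (1 + u) (1 + v) (1 + t)) L1 L2 = qp (hexn u v - 1) * Psi 2 (1 + u) (1 + v) (1 + t) L1 L2"
    by (rule Tstep_Psi) (use False in \<open>auto simp: assms hexn_def algebra_simps\<close>)
  then show ?thesis unfolding Tstep_cmult by simp
qed

lemma Tstep_Psi1:
  assumes "\<alpha> + \<beta> + \<gamma> = 0" "n = hexn \<alpha> \<beta>"
  shows "Tstep 0 1 (Psi 1 (1 + \<alpha>) \<beta> \<gamma>) L1 L2 = qp (n + \<alpha>) * Psi 1 (1 + \<alpha>) \<beta> \<gamma> L1 L2"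
proof -
  have \<gamma>: "\<gamma> = - \<alpha> - \<beta>" using assms by simp
  show ?thesis
    by (rule Tstep_Psi) (auto simp: assms(2) \<gamma> hexn_def algebra_simps)
qed

lemma Tstep_Psi0:
  assumes "\<alpha> + \<beta> + \<gamma> = 0" "n = hexn \<alpha> \<beta>"
  shows "Tstep 0 0 (Psi 0 \<alpha> \<beta> \<gamma>) L1 L2 = qp n * Psi 0 \<alpha> \<beta> \<gamma> L1 L2"
proof -
  have \<gamma>: "\<gamma> = - \<alpha> - \<beta>" using assms by simp
  show ?thesis
    by (rule Tstep_Psi) (auto simp: assms(2) \<gamma> hexn_def algebra_simps)
qed

definition g0_const :: complex where "g0_const = 3 * q\<^sup>2 * (wp 1 - wp (- 1)) / (1 - q)"

text \<open>The part of the weight that is unchanged by rotation of (u, v, -u - v); j counts the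
  layers with exponents (1, 1).\<close>

definition base :: "int \<Rightarrow> int \<times> int \<Rightarrow> complex" where
  "base j = (\<lambda>(u, v). qp (hexn u v) * wp (u - v) * qp (j * (hexn u v - 1)))"

definition cyc :: "(int \<Rightarrow> int \<Rightarrow> int \<Rightarrow> complex) \<Rightarrow> int \<times> int \<Rightarrow> complex" where
  "cyc f = (\<lambda>(u, v). f u v (- u - v) + f v (- u - v) u + f (- u - v) u v)"

text \<open>The three rotated triples share the sum zero and the value of \<open>hexn\<close>, which
  is all the eigenvalue computations need.\<close>

lemma cyc_cong:
  assumes "\<And>\<alpha> \<beta> \<gamma>. \<alpha> + \<beta> + \<gamma> = 0 \<Longrightarrow> hexn \<alpha> \<beta> = hexn (fst x) (snd x) \<Longrightarrow> f \<alpha> \<beta> \<gamma> = g \<alpha> \<beta> \<gamma>"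
  shows "cyc f x = cyc g x"
proof -
  obtain u v where x: "x = (u, v)" by force
  show ?thesis unfolding x cyc_def prod.case
    by (intro arg_cong2[of _ _ _ _ "(+)"] assms) (auto simp: x hexn_def algebra_simps)
qed

lemma cyc_cmult: "cyc (\<lambda>\<alpha> \<beta> \<gamma>. c * f \<alpha> \<beta> \<gamma>) x = c * cyc f x"
  by (simp add: cyc_def split_def algebra_simps)

lemma cyc_diff: "cyc (\<lambda>\<alpha> \<beta> \<gamma>. f \<alpha> \<beta> \<gamma> - g \<alpha> \<beta> \<gamma>) x = cyc f x - cyc g x"
  by (simp add: cyc_def split_def)

lemma Tstep_cyc: "Tstep i j (\<lambda>l m. cyc (\<lambda>\<alpha> \<beta> \<gamma>. f \<alpha> \<beta> \<gamma> l m) x) L1 L2 = cyc (\<lambda>\<alpha> \<beta> \<gamma>. Tstep i j (f \<alpha> \<beta> \<gamma>) L1 L2) x"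
  by (simp add: cyc_def split_def Tstep_add)

lemma base_Suc: "base (int (Suc k)) x = base (int k) x * qp (hexn (fst x) (snd x) - 1)"
  by (simp add: base_def split_def algebra_simps flip: qp_add)

lemma chain_00:
  "((\<lambda>x. base (int k) x * (case x of (u, v) \<Rightarrow> vdm u v (- u - v) * Psi 2 (1 + u) (1 + v) (1 + (- u - v)) L1 L2))
     has_sum g0_const * chain k 0 0 L1 L2) UNIV"
proof (induction k arbitrary: L1 L2)
  case 0
  show ?case using g0_has_sum[of L1 L2] by (simp add: g0_const_def g0_term_def base_def split_def)
next
  case (Suc k)
  have "((\<lambda>x. Tstep 1 1 (\<lambda>l m. base (int k) x * (case x of (u, v) \<Rightarrow> vdm u v (- u - v) * Psi 2 (1 + u) (1 + v) (1 + (- u - v)) l m)) L1 L2)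
     has_sum Tstep 1 1 (\<lambda>l m. g0_const * chain k 0 0 l m) L1 L2) UNIV"
    by (rule Tstep_has_sum[OF Suc.IH])
  then show ?case
  proof (rule has_sum_eqI)
    show "Tstep 1 1 (\<lambda>l m. base (int k) x * (case x of (u, v) \<Rightarrow> vdm u v (- u - v) * Psi 2 (1 + u) (1 + v) (1 + (- u - v)) l m)) L1 L2
      = base (int (Suc k)) x * (case x of (u, v) \<Rightarrow> vdm u v (- u - v) * Psi 2 (1 + u) (1 + v) (1 + (- u - v)) L1 L2)" for x
      unfolding base_Suc Tstep_cmult[of _ _ "base (int k) x"] split_def Tstep_vdm_Psi2[OF refl] by simp
  qed (simp add: Tstep_cmult)
qed

definition term2 :: "nat \<Rightarrow> nat \<Rightarrow> nat \<Rightarrow> int \<times> int \<Rightarrow> int \<Rightarrow> int \<Rightarrow> int \<Rightarrow> complex" where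
  "term2 a l m x \<alpha> \<beta> \<gamma> = dcoef \<alpha> \<beta> \<gamma> * qp (int a * (hexn (fst x) (snd x) + \<alpha>)) * Psi 1 (1 + \<alpha>) \<beta> \<gamma> l m"

text \<open>Expanding the determinant once replaces \<open>Psi 2\<close> by three kernels
  \<open>Psi 1\<close>. From then on each has its own eigenvalue q^(n + \<alpha>) for n =
  \<open>hexn\<close>, so they are followed separately.\<close>

lemma chain_a0:
  assumes "a \<le> k"
  shows "((\<lambda>x. base (int (k - a)) x * cyc (term2 a L1 L2 x) x) has_sum g0_const * chain k a 0 L1 L2) UNIV"
  using assms
proof (induction a arbitrary: k L1 L2)
  case 0
  have "cyc (term2 0 L1 L2 x) x = (case x of (u, v) \<Rightarrow> vdm u v (- u - v) * Psi 2 (1 + u) (1 + v) (1 + (- u - v)) L1 L2)" for x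
    by (simp add: cyc_def term2_def split_def vdm_Psi2)
  then show ?case using chain_00[of k L1 L2] by simp
next
  case (Suc a)
  then obtain k' where k: "k = Suc k'" "a \<le> k'" by (cases k) auto
  have "((\<lambda>x. Tstep 0 1 (\<lambda>l m. base (int (k' - a)) x * cyc (term2 a l m x) x) L1 L2)
     has_sum Tstep 0 1 (\<lambda>l m. g0_const * chain k' a 0 l m) L1 L2) UNIV"
    by (rule Tstep_has_sum[OF Suc.IH[OF k(2)]])
  then show ?case
  proof (rule has_sum_eqI)
    fix x
    show "Tstep 0 1 (\<lambda>l m. base (int (k' - a)) x * cyc (term2 a l m x) x) L1 L2
      = base (int (k - Suc a)) x * cyc (term2 (Suc a) L1 L2 x) x"
    proof -
      have "cyc (\<lambda>\<alpha> \<beta> \<gamma>. Tstep 0 1 (\<lambda>l m. term2 a l m x \<alpha> \<beta> \<gamma>) L1 L2) x = cyc (term2 (Suc a) L1 L2 x) x"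
      proof (rule cyc_cong)
        fix \<alpha> \<beta> \<gamma> :: int assume "\<alpha> + \<beta> + \<gamma> = 0" "hexn \<alpha> \<beta> = hexn (fst x) (snd x)"
        then show "Tstep 0 1 (\<lambda>l m. term2 a l m x \<alpha> \<beta> \<gamma>) L1 L2 = term2 (Suc a) L1 L2 x \<alpha> \<beta> \<gamma>"
          unfolding term2_def Tstep_cmult
          by (subst Tstep_Psi1[where n = "hexn (fst x) (snd x)"]) (simp_all add: algebra_simps qp_add)
      qed
      then show ?thesis unfolding Tstep_cmult[of _ _ "base (int (k' - a)) x"] Tstep_cyc[of 0 1 "\<lambda>\<alpha> \<beta> \<gamma> l m. term2 a l m x \<alpha> \<beta> \<gamma>" x]
        using k by simp
    qed
  qed (use k in \<open>simp add: Tstep_cmult\<close>)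
qed

definition termK :: "nat \<Rightarrow> nat \<Rightarrow> nat \<Rightarrow> int \<times> int \<Rightarrow> int \<Rightarrow> int \<Rightarrow> int \<Rightarrow> complex" where
  "termK a l m x \<alpha> \<beta> \<gamma> = dcoef \<alpha> \<beta> \<gamma> * qp (int a * (hexn (fst x) (snd x) + \<alpha>)) * Kker \<alpha> \<beta> \<gamma> l m"

text \<open>The two sums in the difference differ termwise by the factor \<open>q^(1 + m) q^(-1 - \<alpha>)\<close>, which
  produces the missing factor \<open>1 - q^(m - \<alpha>)\<close> of \<open>Kker\<close>.\<close>

lemma chain_difference_inner:
  assumes "a \<le> k"
  shows "((\<lambda>x. base (int (k - a)) x * cyc (termK a l m x) x)
    has_sum g0_const * (chain k a 0 l m - q * (qp ((if a = 0 then 1 else 0) * int l + int m) * chain k (a - 1) 0 l m))) UNIV"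
proof (cases a)
  \<comment> \<open>Now \<open>a - 1\<close> is again 0 and the two chains coincide; the factor 1 -
    q^(l+m+1) is common to all summands and \<open>vdm_Psi2_Kker\<close> absorbs it.\<close>
  case 0
  have e: "q * qp (int l + int m) = qp (int (l + m + 1))"
    using qp_nat[of 1] qp_add[of 1 "int l + int m"] by (simp add: algebra_simps)
  have H: "((\<lambda>x. (1 - qp (int (l + m + 1))) * (base (int k) x * (case x of (u, v) \<Rightarrow> vdm u v (- u - v) * Psi 2 (1 + u) (1 + v) (1 + (- u - v)) l m)))
     has_sum (1 - qp (int (l + m + 1))) * (g0_const * chain k 0 0 l m)) UNIV"
    by (rule has_sum_cmult_right[OF chain_00])
  have P: "(1 - qp (int (l + m + 1))) * (base (int k) x * (case x of (u, v) \<Rightarrow> vdm u v (- u - v) * Psi 2 (1 + u) (1 + v) (1 + (- u - v)) l m))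
     = base (int k) x * cyc (termK 0 l m x) x" for x
  proof -
    obtain u v where x: "x = (u, v)" by force
    show ?thesis
      unfolding x prod.case cyc_def termK_def mult.left_commute[of "1 - qp (int (l + m + 1))"] vdm_Psi2_Kker by simp
  qed
  have E: "(1 - qp (int (l + m + 1))) * (g0_const * chain k 0 0 l m) = g0_const * (chain k 0 0 l m - q * (qp (int l + int m) * chain k 0 0 l m))"
    unfolding mult.assoc[symmetric] e by (simp add: algebra_simps)
  show ?thesis by (rule has_sum_eqI[OF H]) (use P E 0 in simp_all)
next
  case (Suc a')
  let ?A = "\<lambda>x. base (int (k - a)) x * cyc (term2 a l m x) x"
  let ?B = "\<lambda>x. base (int (k - a')) x * cyc (term2 a' l m x) x"
  have H: "((\<lambda>x. ?A x + - qp (1 + int m) * ?B x) has_sum (g0_const * chain k a 0 l m + - qp (1 + int m) * (g0_const * chain k a' 0 l m))) UNIV"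
    by (intro has_sum_add has_sum_cmult_right chain_a0) (use assms Suc in auto)
  have P: "?A x + - qp (1 + int m) * ?B x = base (int (k - a)) x * cyc (termK a l m x) x" for x
  proof -
    let ?n = "hexn (fst x) (snd x)"
    have k: "k - a' = Suc (k - a)" using assms Suc by simp
    have "cyc (term2 a l m x) x - qp (1 + int m) * (qp (?n - 1) * cyc (term2 a' l m x) x)
       = cyc (\<lambda>\<alpha> \<beta> \<gamma>. term2 a l m x \<alpha> \<beta> \<gamma> - qp (1 + int m) * (qp (?n - 1) * term2 a' l m x \<alpha> \<beta> \<gamma>)) x"
      unfolding cyc_diff cyc_cmult ..
    also have "\<dots> = cyc (termK a l m x) x"
    proof (rule cyc_cong)
      fix \<alpha> \<beta> \<gamma>
      have "qp (1 + int m) * qp (?n - 1) * qp (int a' * (?n + \<alpha>)) = qp (int m - \<alpha>) * qp (int a * (?n + \<alpha>))"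
        unfolding Suc by (simp add: algebra_simps flip: qp_add)
      then have "qp (1 + int m) * qp (?n - 1) * qp (int a' * (?n + \<alpha>)) * X = qp (int m - \<alpha>) * qp (int a * (?n + \<alpha>)) * X" for X
        by simp
      from this[of "dcoef \<alpha> \<beta> \<gamma> * Psi 1 (1 + \<alpha>) \<beta> \<gamma> l m"]
      show "term2 a l m x \<alpha> \<beta> \<gamma> - qp (1 + int m) * (qp (?n - 1) * term2 a' l m x \<alpha> \<beta> \<gamma>) = termK a l m x \<alpha> \<beta> \<gamma>"
        unfolding term2_def termK_def Kker_def by (auto simp: algebra_simps)
    qed
    finally have c: "cyc (term2 a l m x) x - qp (1 + int m) * (qp (?n - 1) * cyc (term2 a' l m x) x) = cyc (termK a l m x) x" .
    show ?thesis unfolding k base_Suc c[symmetric] by (simp add: algebra_simps)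
  qed
  have E: "g0_const * chain k a 0 l m + - qp (1 + int m) * (g0_const * chain k a' 0 l m)
     = g0_const * (chain k a 0 l m - q * (qp (int m) * chain k (a - 1) 0 l m))"
    unfolding qp_add Suc using qp_nat[of 1] by (simp add: algebra_simps)
  show ?thesis by (rule has_sum_eqI[OF H]) (use P E Suc in simp_all)
qed

text \<open>The two kernels from \<open>Kker_Psi0\<close>. A layer with exponents (0, 0) multiplies
  them by q to the power \<open>hexn (1 + \<alpha>) (\<beta> - 1)\<close> and
  \<open>hexn (1 + \<alpha>) (\<gamma> - 1)\<close>, respectively, written here through
  \<open>hexn\<close> of x; b counts these layers and c those with exponents (0, 1).\<close>

definition term0 :: "nat \<Rightarrow> nat \<Rightarrow> nat \<Rightarrow> nat \<Rightarrow> int \<times> int \<Rightarrow> int \<Rightarrow> int \<Rightarrow> int \<Rightarrow> complex" where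
  "term0 c b l m x \<alpha> \<beta> \<gamma> = qp (int c * (hexn (fst x) (snd x) + \<alpha>)) * (qp (1 + \<alpha>))\<^sup>2
     * (qp (1 + \<gamma>) * (qp (int b * (hexn (fst x) (snd x) + \<alpha> - \<beta> + 1)) * Psi 0 (1 + \<alpha>) (\<beta> - 1) \<gamma> l m)
      - qp (1 + \<beta>) * (qp (int b * (hexn (fst x) (snd x) + \<alpha> - \<gamma> + 1)) * Psi 0 (1 + \<alpha>) \<beta> (\<gamma> - 1) l m))"

lemma termK_term0: "termK a l m x \<alpha> \<beta> \<gamma> = term0 a 0 l m x \<alpha> \<beta> \<gamma>"
  unfolding termK_def term0_def dcoef_def using Kker_Psi0[of \<gamma> \<beta> \<alpha> l m]
  by (simp add: mult_ac)

lemma Tstep_term0: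
  assumes "\<alpha> + \<beta> + \<gamma> = 0" "hexn \<alpha> \<beta> = hexn (fst x) (snd x)"
  shows "Tstep 0 0 (\<lambda>l m. term0 c b l m x \<alpha> \<beta> \<gamma>) L1 L2 = term0 c (Suc b) L1 L2 x \<alpha> \<beta> \<gamma>"
proof -
  have \<gamma>: "\<gamma> = - \<alpha> - \<beta>" using assms(1) by simp
  have 1: "Tstep 0 0 (Psi 0 (1 + \<alpha>) (\<beta> - 1) \<gamma>) L1 L2 = qp (hexn (fst x) (snd x) + \<alpha> - \<beta> + 1) * Psi 0 (1 + \<alpha>) (\<beta> - 1) \<gamma> L1 L2"
    unfolding assms(2)[symmetric] by (rule Tstep_Psi0) (simp_all add: \<gamma> hexn_def algebra_simps)
  have 2: "Tstep 0 0 (Psi 0 (1 + \<alpha>) \<beta> (\<gamma> - 1)) L1 L2 = qp (hexn (fst x) (snd x) + \<alpha> - \<gamma> + 1) * Psi 0 (1 + \<alpha>) \<beta> (\<gamma> - 1) L1 L2"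
    unfolding assms(2)[symmetric] by (rule Tstep_Psi0) (simp_all add: \<gamma> hexn_def algebra_simps)
  have e: "qp (int (Suc b) * y) = qp (int b * y) * qp y" for y
    by (simp add: algebra_simps flip: qp_add)
  show ?thesis unfolding term0_def Tstep_cmult Tstep_diff 1 2 e by (simp only: mult_ac)
qed

lemma Tstep_base_cyc_term0:
  "Tstep 0 0 (\<lambda>l m. base j x * cyc (term0 c b l m x) x) L1 L2 = base j x * cyc (term0 c (Suc b) L1 L2 x) x"
  unfolding Tstep_cmult[of _ _ "base j x"] Tstep_cyc[of 0 0 "\<lambda>\<alpha> \<beta> \<gamma> l m. term0 c b l m x \<alpha> \<beta> \<gamma>" x]
  by (rule arg_cong[of _ _ "(*) (base j x)"], rule cyc_cong, rule Tstep_term0)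

text \<open>Both chains lose the same outer layer (0, 0) as long as b > 1. At b = 1 their outer
  layers differ, and it is this difference that \<open>chain_difference_inner\<close> has
  prepared.\<close>

lemma chain_difference:
  assumes "b \<le> a" "a \<le> k" "b > 0"
  shows "((\<lambda>x. base (int (k - a)) x * cyc (term0 (a - b) b L1 L2 x) x)
     has_sum g0_const * (chain k a b L1 L2 - q * chain k (a - 1) (b - 1) L1 L2)) UNIV"
  using assms
proof (induction b arbitrary: a k L1 L2)
  case 0
  then show ?case by simp
next
  case (Suc b)
  then obtain k' a' where k: "k = Suc k'" "a = Suc a'" "b \<le> a'" "a' \<le> k'" by (cases k; cases a) auto
  show ?case
  proof (cases "b = 0")
    case True
    let ?F = "\<lambda>l m. g0_const * (chain k' a' 0 l m - q * (qp ((if a' = 0 then 1 else 0) * int l + 1 * int m) * chain k' (a' - 1) 0 l m))"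
    have inner: "((\<lambda>x. base (int (k' - a')) x * cyc (term0 a' 0 l m x) x) has_sum ?F l m) UNIV" for l m
      using chain_difference_inner[OF k(4), of l m] unfolding termK_term0[abs_def] term0_def[abs_def] by simp
    have "((\<lambda>x. Tstep 0 0 (\<lambda>l m. base (int (k' - a')) x * cyc (term0 a' 0 l m x) x) L1 L2) has_sum Tstep 0 0 ?F L1 L2) UNIV"
      by (rule Tstep_has_sum) (rule inner)
    then show ?thesis
      unfolding Tstep_base_cyc_term0 unfolding Tstep_cmult Tstep_diff
      \<comment> \<open>The power q^m, or q^(l+m) if a' = 0, becomes the linear exponent of the
        outer layer of \<open>chain k (a - 1) 0\<close>.\<close>
      unfolding Tstep_absorb[symmetric]
      using True k by simp
  next
    case False
    have "((\<lambda>x. Tstep 0 0 (\<lambda>l m. base (int (k' - a')) x * cyc (term0 (a' - b) b l m x) x) L1 L2)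
      has_sum Tstep 0 0 (\<lambda>l m. g0_const * (chain k' a' b l m - q * chain k' (a' - 1) (b - 1) l m)) L1 L2) UNIV"
      by (rule Tstep_has_sum) (rule Suc.IH, use k False in auto)
    then show ?thesis
      unfolding Tstep_base_cyc_term0 unfolding Tstep_cmult Tstep_diff
      using False k by simp
  qed
qed

end

section \<open>Limits\<close>

text \<open>Tannery's theorem, the dominated convergence of series.\<close>

lemma tannery_has_sum:
  fixes f :: "nat \<Rightarrow> 'a \<Rightarrow> complex"
  assumes S: "\<And>n. (f n has_sum S n) A"
    and lim: "\<And>x. x \<in> A \<Longrightarrow> (\<lambda>n. f n x) \<longlonglongrightarrow> g x"
    and bound: "\<And>n x. x \<in> A \<Longrightarrow> norm (f n x) \<le> M x"
    and M: "M summable_on A"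
  shows "S \<longlonglongrightarrow> infsum g A" and "g summable_on A"
proof -
  have gM: "norm (g x) \<le> M x" if "x \<in> A" for x
    by (rule LIMSEQ_le_const2[OF tendsto_norm[OF lim[OF that]]]) (use bound[OF that] in auto)
  show g: "g summable_on A"
    by (rule abs_summable_summable) (rule Infinite_Sum.abs_summable_on_comparison_test'[OF M gM])
  \<comment> \<open>The limit is adjoined to the sequence as index \<open>None\<close>, so that a
    single M-test yields one finite set that approximates all S n and the limit sum at once.\<close>
  define h where "h x y = (case y of None \<Rightarrow> g x | Some n \<Rightarrow> f n x)" for x and y :: "nat option"
  define T where "T y = (case y of None \<Rightarrow> infsum g A | Some n \<Rightarrow> S n)" for y :: "nat option"
  have ul: "uniform_limit UNIV (\<lambda>X y. \<Sum>x\<in>X. h x y) T (finite_subsets_at_top A)"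
  proof (rule Weierstrass_m_test_general'[OF _ _ M])
    show "norm (h x y) \<le> M x" if "x \<in> A" for x y
      using gM[OF that] bound[OF that] by (auto simp: h_def split: option.splits)
    show "((\<lambda>x. h x y) has_sum T y) A" for y
      using S g by (auto simp: h_def T_def split: option.splits)
  qed
  show "S \<longlonglongrightarrow> infsum g A"
  proof (rule tendstoI)
    fix e :: real assume e: "e > 0"
    then have "eventually (\<lambda>X. \<forall>y\<in>UNIV. dist (\<Sum>x\<in>X. h x y) (T y) < e / 3) (finite_subsets_at_top A)"
      by (intro uniform_limitD[OF ul]) auto
    then obtain X where X: "finite X" "X \<subseteq> A" "\<forall>y. dist (\<Sum>x\<in>X. h x y) (T y) < e / 3"
      unfolding eventually_finite_subsets_at_top by (metis UNIV_I order_refl)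
    have "(\<lambda>n. \<Sum>x\<in>X. f n x) \<longlonglongrightarrow> (\<Sum>x\<in>X. g x)"
      using X lim by (intro tendsto_sum) auto
    then have "eventually (\<lambda>n. dist (\<Sum>x\<in>X. f n x) (\<Sum>x\<in>X. g x) < e / 3) sequentially"
      using e by (intro tendstoD) auto
    then show "eventually (\<lambda>n. dist (S n) (infsum g A) < e) sequentially"
    proof eventually_elim
      case (elim n)
      have "dist (\<Sum>x\<in>X. f n x) (S n) < e / 3" using X(3)[rule_format, of "Some n"] by (simp add: h_def T_def)
      moreover have "dist (\<Sum>x\<in>X. g x) (infsum g A) < e / 3" using X(3)[rule_format, of None] by (simp add: h_def T_def)
      moreover have "dist (S n) (infsum g A) \<le> dist (S n) (\<Sum>x\<in>X. f n x) + (dist (\<Sum>x\<in>X. f n x) (\<Sum>x\<in>X. g x) + dist (\<Sum>x\<in>X. g x) (infsum g A))"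
        by (meson add_left_mono dist_triangle order_trans)
      ultimately show ?case using elim by (simp add: dist_commute)
    qed
  qed
qed

lemma summable_on_times_real:
  fixes f :: "'a \<Rightarrow> real" and g :: "'b \<Rightarrow> real"
  assumes "f summable_on A" "g summable_on B" "\<And>x. f x \<ge> 0" "\<And>x. g x \<ge> 0"
  shows "(\<lambda>(x, y). f x * g y) summable_on A \<times> B"
proof -
  have "(\<lambda>x. norm (case x of (x, y) \<Rightarrow> f x * g y)) summable_on A \<times> B"
    unfolding Infinite_Sum.abs_summable_on_Sigma_iff
    using assms by (auto simp: abs_mult infsum_cmult_right' intro!: summable_on_cmult_right summable_on_cmult_left)
  then show ?thesis using assms by (simp add: split_def abs_mult)
qed

lemma summable_on_int_geometric:
  fixes r :: real
  assumes "0 \<le> r" "r < 1"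
  shows "(\<lambda>n :: int. r ^ nat \<bar>n\<bar>) summable_on UNIV"
proof -
  have geo: "(\<lambda>n :: nat. r ^ n) summable_on UNIV"
    using assms by (subst summable_on_UNIV_nonneg_real_iff) (auto intro: summable_geometric)
  have 1: "(\<lambda>n :: int. r ^ nat \<bar>n\<bar>) summable_on range int"
    by (subst summable_on_reindex) (use geo in \<open>auto simp: o_def\<close>)
  have 2: "(\<lambda>n :: int. r ^ nat \<bar>n\<bar>) summable_on range (\<lambda>n. - int n)"
    by (subst summable_on_reindex) (use geo in \<open>auto simp: o_def inj_on_def\<close>)
  have "range int \<union> range (\<lambda>n. - int n) = UNIV"
    by (auto, metis int_cases2 rangeI)
  then show ?thesis using summable_on_union[OF 1 2] by simp
qed

text \<open>Since 2 \<open>hexn\<close> is at least u^2 + v^2, completing the squares at |A| + 1 and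
  |B| + 1 leaves one spare |u| and |v|, enough for a geometric majorant.\<close>

lemma hexn_lower_bound:
  fixes n A B u v :: int
  assumes "n \<ge> 1"
  shows "n * hexn u v + A * u + B * v \<ge> \<bar>u\<bar> + \<bar>v\<bar> - ((\<bar>A\<bar> + 1)\<^sup>2 + (\<bar>B\<bar> + 1)\<^sup>2)"
proof -
  have two_hexn: "2 * hexn u v = u\<^sup>2 + v\<^sup>2 + (u + v)\<^sup>2"
    by (simp add: hexn_def power2_eq_square algebra_simps)
  then have hexn_nonneg: "hexn u v \<ge> 0" by (smt (verit) zero_le_power2)
  have "n * hexn u v \<ge> hexn u v" using assms hexn_nonneg by (simp add: mult_le_cancel_right1)
  moreover have "A * u \<ge> - (\<bar>A\<bar> * \<bar>u\<bar>)" "B * v \<ge> - (\<bar>B\<bar> * \<bar>v\<bar>)"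
    using abs_ge_minus_self[of "A * u"] abs_ge_minus_self[of "B * v"] by (simp_all add: abs_mult)
  moreover have "(\<bar>u\<bar> - (\<bar>A\<bar> + 1))\<^sup>2 \<ge> 0" "(\<bar>v\<bar> - (\<bar>B\<bar> + 1))\<^sup>2 \<ge> 0" "(u + v)\<^sup>2 \<ge> 0" by simp_all
  moreover have "(\<bar>u\<bar> - (\<bar>A\<bar> + 1))\<^sup>2 = u\<^sup>2 - 2 * (\<bar>A\<bar> * \<bar>u\<bar>) - 2 * \<bar>u\<bar> + (\<bar>A\<bar> + 1)\<^sup>2" 
     "(\<bar>v\<bar> - (\<bar>B\<bar> + 1))\<^sup>2 = v\<^sup>2 - 2 * (\<bar>B\<bar> * \<bar>v\<bar>) - 2 * \<bar>v\<bar> + (\<bar>B\<bar> + 1)\<^sup>2"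
    by (simp_all add: power2_diff algebra_simps)
  moreover have "(\<bar>A\<bar> + 1)\<^sup>2 \<ge> 0" "(\<bar>B\<bar> + 1)\<^sup>2 \<ge> 0" by simp_all
  ultimately show ?thesis using two_hexn by linarith
qed

lemma qpoch_tendsto:
  assumes "norm p < 1"
  shows "(\<lambda>n. qpoch z p n) \<longlonglongrightarrow> qpoch_inf z p"
    and "(\<And>j. 1 - z * p ^ j \<noteq> 0) \<Longrightarrow> qpoch_inf z p \<noteq> 0"
proof -
  have "summable (\<lambda>j. norm (1 - z * p ^ j - 1))"
    using assms by (simp add: norm_mult norm_power summable_mult)
  then have c: "convergent_prod (\<lambda>j. 1 - z * p ^ j)"
    by (intro abs_convergent_prod_imp_convergent_prod summable_imp_abs_convergent_prod)
  have "(\<lambda>n. qpoch z p (Suc n)) \<longlonglongrightarrow> qpoch_inf z p"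
    using convergent_prod_LIMSEQ[OF c] by (simp add: qpoch_def qpoch_inf_def lessThan_Suc_atMost)
  then show "(\<lambda>n. qpoch z p n) \<longlonglongrightarrow> qpoch_inf z p" by (rule LIMSEQ_imp_Suc)
  show "qpoch_inf z p \<noteq> 0" if "\<And>j. 1 - z * p ^ j \<noteq> 0"
    unfolding qpoch_inf_def using c that by (intro prodinf_nonzero) auto
qed

text \<open>The five nontrivial permutations of the coordinates of (u, v, -u - v).\<close>

lemma has_sum_reindex_perms:
  fixes z :: "int \<Rightarrow> int \<Rightarrow> 'b :: {topological_comm_monoid_add, t2_space}"
  assumes "((\<lambda>(u, v). z u v) has_sum s) UNIV"
  shows "((\<lambda>(u, v). z u (- u - v)) has_sum s) UNIV" "((\<lambda>(u, v). z v (- u - v)) has_sum s) UNIV"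
    "((\<lambda>(u, v). z v u) has_sum s) UNIV" "((\<lambda>(u, v). z (- u - v) u) has_sum s) UNIV"
    "((\<lambda>(u, v). z (- u - v) v) has_sum s) UNIV"
proof -
  have *: "((\<lambda>x. case_prod z (j x)) has_sum s) UNIV" if "bij j" for j
    using assms has_sum_reindex_bij_betw[of j UNIV UNIV "case_prod z" s] that by simp
  have w: "bij j" if "\<And>x. j' (j x) = x" "\<And>x. j (j' x) = x" for j j' :: "int \<times> int \<Rightarrow> int \<times> int"
    using that by (metis bijI')
  have b1: "bij (\<lambda>(u :: int, v :: int). (u, - u - v))"
    by (rule w[of "\<lambda>(u, v). (u, - u - v)"]) auto
  have b2: "bij (\<lambda>(u :: int, v :: int). (v, - u - v))"
    by (rule w[of "\<lambda>(u, v). (- u - v, u)"]) auto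
  have b3: "bij (\<lambda>(u :: int, v :: int). (v, u))"
    by (rule w[of "\<lambda>(u, v). (v, u)"]) auto
  have b4: "bij (\<lambda>(u :: int, v :: int). (- u - v, u))"
    by (rule w[of "\<lambda>(u, v). (v, - u - v)"]) auto
  have b5: "bij (\<lambda>(u :: int, v :: int). (- u - v, v))"
    by (rule w[of "\<lambda>(u, v). (- u - v, v)"]) auto
  show "((\<lambda>(u, v). z u (- u - v)) has_sum s) UNIV" using *[OF b1] by (simp add: split_def)
  show "((\<lambda>(u, v). z v (- u - v)) has_sum s) UNIV" using *[OF b2] by (simp add: split_def)
  show "((\<lambda>(u, v). z v u) has_sum s) UNIV" using *[OF b3] by (simp add: split_def)
  show "((\<lambda>(u, v). z (- u - v) u) has_sum s) UNIV" using *[OF b4] by (simp add: split_def)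
  show "((\<lambda>(u, v). z (- u - v) v) has_sum s) UNIV" using *[OF b5] by (simp add: split_def)
qed

context nome
begin

definition qinf :: complex where "qinf = qpoch_inf q q"

lemma qpoch_q_tendsto: "(\<lambda>n. qpoch q q n) \<longlonglongrightarrow> qinf"
  unfolding qinf_def by (rule qpoch_tendsto(1)[OF norm_q])

lemma qinf_nz: "qinf \<noteq> 0"
  unfolding qinf_def using one_minus_power_nz[of "Suc _"] by (intro qpoch_tendsto(2)[OF norm_q]) simp

lemma rq_tendsto: "(\<lambda>n. rq (int n)) \<longlonglongrightarrow> 1 / qinf"
  unfolding rq_nat by (intro tendsto_intros qpoch_q_tendsto qinf_nz)

lemma rq_shift_tendsto: "(\<lambda>n. rq (int n + j)) \<longlonglongrightarrow> 1 / qinf"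
proof -
  have "filterlim (\<lambda>n. nat (int n + j)) at_top sequentially"
    unfolding filterlim_at_top
  proof
    fix Z :: nat
    show "\<forall>\<^sub>F n in sequentially. Z \<le> nat (int n + j)"
      using eventually_ge_at_top[of "Z + nat \<bar>j\<bar>"] by eventually_elim linarith
  qed
  then have "(\<lambda>n. rq (int (nat (int n + j)))) \<longlonglongrightarrow> 1 / qinf"
    by (rule filterlim_compose[OF rq_tendsto])
  moreover have "\<forall>\<^sub>F n in sequentially. rq (int (nat (int n + j))) = rq (int n + j)"
    using eventually_ge_at_top[of "nat \<bar>j\<bar>"] by eventually_elim simp
  ultimately show ?thesis by (rule Lim_transform_eventually)
qed

lemma rq_bounded: obtains B where "B \<ge> 1" "\<And>n. norm (rq n) \<le> B" "\<And>n. norm (qpoch q q n) \<le> B"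
proof -
  obtain B1 where B1: "\<And>n. norm (rq (int n)) \<le> B1"
    using rq_tendsto convergent_imp_Bseq[of "\<lambda>n. rq (int n)"] by (auto simp: convergent_def Bseq_def)
  obtain B2 where B2: "\<And>n. norm (qpoch q q n) \<le> B2"
    using qpoch_q_tendsto convergent_imp_Bseq[of "\<lambda>n. qpoch q q n"] by (auto simp: convergent_def Bseq_def)
  show ?thesis
  proof (rule that[of "max 1 (max B1 B2)"])
    show "norm (rq n) \<le> max 1 (max B1 B2)" for n
      using B1[of "nat n"] by (cases "n < 0") auto
    show "norm (qpoch q q n) \<le> max 1 (max B1 B2)" for n
      using B2[of n] by auto
  qed simp
qed

text \<open>One numerator against six denominators; neither w nor the parameters survive in the
  limit.\<close>

lemma Psi_tendsto: "(\<lambda>L. Psi w a1 a2 a3 L L) \<longlonglongrightarrow> 1 / qinf ^ 5"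
proof -
  have m: "(\<lambda>L. rq (int L + int w - a)) \<longlonglongrightarrow> 1 / qinf" for a
    using rq_shift_tendsto[of "int w - a"] by (simp add: algebra_simps)
  have "filterlim (\<lambda>L. L + L + w) at_top sequentially"
    by (rule filterlim_at_top_mono[OF filterlim_ident]) (auto intro: always_eventually)
  then have p: "(\<lambda>L. qpoch q q (L + L + w)) \<longlonglongrightarrow> qinf"
    by (rule filterlim_compose[OF qpoch_q_tendsto])
  have "(\<lambda>L. Psi w a1 a2 a3 L L) \<longlonglongrightarrow> qinf * (1 / qinf) * (1 / qinf) * (1 / qinf) * (1 / qinf) * (1 / qinf) * (1 / qinf)"
    unfolding Psi_def by (intro tendsto_mult p m rq_shift_tendsto)
  then show ?thesis using qinf_nz by (simp add: field_simps power_def numeral_eq_Suc)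
qed

text \<open>The bound is uniform in the parameters too, hence over the lattice, as domination
  requires.\<close>

lemma Psi_bounded: obtains B where "B \<ge> 0" "\<And>w a1 a2 a3 l m. norm (Psi w a1 a2 a3 l m) \<le> B"
proof -
  obtain B where B: "B \<ge> 1" "\<And>n. norm (rq n) \<le> B" "\<And>n. norm (qpoch q q n) \<le> B" using rq_bounded by metis
  show ?thesis
  proof (rule that)
    show "norm (Psi w a1 a2 a3 l m) \<le> B * B * B * B * B * B * B" for w a1 a2 a3 l m
      unfolding Psi_def norm_mult using B by (intro mult_mono) auto
    show "B * B * B * B * B * B * B \<ge> 0" using B(1) by simp
  qed
qed

lemma norm_qp: "norm (qp n) = norm q powi n"
  by (simp add: qp_def norm_power_int)

lemma qp_hexn_summable:
  assumes "n \<ge> 1"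
  shows "(\<lambda>(u, v). norm (qp (n * hexn u v + A * u + B * v + C))) summable_on UNIV"
proof -
  let ?r = "norm q"
  have r: "0 < ?r" "?r < 1" using norm_q q_nz by auto
  let ?M = "(\<bar>A\<bar> + 1)\<^sup>2 + (\<bar>B\<bar> + 1)\<^sup>2 - C"
  have s: "(\<lambda>(u :: int, v :: int). ?r ^ nat \<bar>u\<bar> * ?r ^ nat \<bar>v\<bar>) summable_on UNIV \<times> UNIV"
    by (rule summable_on_times_real; (rule summable_on_int_geometric)?) (use r in auto)
  have "(\<lambda>x. norm (case x of (u, v) \<Rightarrow> qp (n * hexn u v + A * u + B * v + C))) summable_on UNIV"
  proof (rule Infinite_Sum.abs_summable_on_comparison_test')
    show "(\<lambda>x. ?r powi (- ?M) * (case x of (u, v) \<Rightarrow> ?r ^ nat \<bar>u\<bar> * ?r ^ nat \<bar>v\<bar>)) summable_on UNIV"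
      using s by (intro summable_on_cmult_right) simp
    fix x :: "int \<times> int"
    obtain u v where x: "x = (u, v)" by force
    have e: "?r powi (\<bar>u\<bar> + \<bar>v\<bar> - ?M) = ?r powi (- ?M) * (?r ^ nat \<bar>u\<bar> * ?r ^ nat \<bar>v\<bar>)"
    proof -
      have "?r powi (\<bar>u\<bar> + \<bar>v\<bar> - ?M) = ?r powi (- ?M) * (?r powi \<bar>u\<bar> * ?r powi \<bar>v\<bar>)"
        using r by (simp add: power_int_add[symmetric] algebra_simps)
      then show ?thesis by (simp add: power_int_def)
    qed
    have "n * hexn u v + A * u + B * v + C \<ge> \<bar>u\<bar> + \<bar>v\<bar> - ?M"
      using hexn_lower_bound[OF assms, of u v A B] by linarith
    then have "?r powi (n * hexn u v + A * u + B * v + C) \<le> ?r powi (\<bar>u\<bar> + \<bar>v\<bar> - ?M)"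
      using r by (intro power_int_decreasing) auto
    then show "norm (case x of (u, v) \<Rightarrow> qp (n * hexn u v + A * u + B * v + C))
      \<le> ?r powi (- ?M) * (case x of (u, v) \<Rightarrow> ?r ^ nat \<bar>u\<bar> * ?r ^ nat \<bar>v\<bar>)"
      unfolding x prod.case norm_qp e .
  qed
  then show ?thesis by (simp add: split_def)
qed

end

lemma hexn_third: "\<alpha> + \<beta> + \<gamma> = 0 \<Longrightarrow> hexn \<alpha> \<gamma> = hexn \<alpha> \<beta>"
proof -
  assume "\<alpha> + \<beta> + \<gamma> = 0"
  then have \<gamma>: "\<gamma> = - \<alpha> - \<beta>" by simp
  show ?thesis unfolding \<gamma> hexn_def by (simp add: algebra_simps)
qed

context nome
begin

text \<open>Rotations preserve u - v modulo 3, so the three terms with z \<alpha> \<beta> have equal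
  sums. The terms with z \<alpha> \<gamma> come from odd permutations, which negate u - v modulo 3;
  hence the antisymmetrised character.\<close>

lemma cyc_sum_has_sum:
  fixes z :: "int \<Rightarrow> int \<Rightarrow> complex"
  assumes z: "(\<lambda>(u, v). norm (z u v)) summable_on UNIV"
  shows "((\<lambda>x. (case x of (u, v) \<Rightarrow> wp (u - v)) * cyc (\<lambda>\<alpha> \<beta> \<gamma>. z \<alpha> \<beta> - z \<alpha> \<gamma>) x)
     has_sum 3 * infsum (\<lambda>(u, v). (wp (u - v) - wp (v - u)) * z u v) UNIV) UNIV"
proof -
  define h where "h u v = wp (u - v) * z u v" for u v
  define h' where "h' u v = - (wp (v - u) * z u v)" for u v
  have z': "(\<lambda>x. norm (case x of (u, v) \<Rightarrow> wp (f u v) * z u v)) summable_on UNIV" for f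
    using z by (simp add: split_def norm_mult wp_abs)
  have "(\<lambda>(u, v). h u v) summable_on UNIV"
    unfolding h_def by (rule abs_summable_summable[OF z'])
  then obtain s where s: "((\<lambda>(u, v). h u v) has_sum s) UNIV" by (auto simp: summable_on_def)
  have "(\<lambda>x. - (case x of (u, v) \<Rightarrow> wp (v - u) * z u v)) summable_on UNIV"
    unfolding summable_on_uminus by (rule abs_summable_summable[OF z'])
  then have "(\<lambda>(u, v). h' u v) summable_on UNIV" by (simp add: h'_def split_def)
  then obtain s' where s': "((\<lambda>(u, v). h' u v) has_sum s') UNIV" by (auto simp: summable_on_def)
  have "((\<lambda>x. (case x of (u, v) \<Rightarrow> h u v) + (case x of (u, v) \<Rightarrow> h' u v)) has_sum s + s') UNIV"
    by (intro has_sum_add s s')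
  then have inf: "infsum (\<lambda>(u, v). (wp (u - v) - wp (v - u)) * z u v) UNIV = s + s'"
    by (intro infsumI) (simp add: split_def h_def h'_def algebra_simps)
  have "((\<lambda>x. (case x of (u, v) \<Rightarrow> h u v) + (case x of (u, v) \<Rightarrow> h v (- u - v)) + (case x of (u, v) \<Rightarrow> h (- u - v) u)
      + (case x of (u, v) \<Rightarrow> h' u (- u - v)) + (case x of (u, v) \<Rightarrow> h' v u) + (case x of (u, v) \<Rightarrow> h' (- u - v) v))
      has_sum s + s + s + s' + s' + s') UNIV"
    by (intro has_sum_add s has_sum_reindex_perms[OF s] has_sum_reindex_perms[OF s'])
  then show ?thesis
  proof (rule has_sum_eqI)
    fix x :: "int \<times> int"
    obtain u v where x: "x = (u, v)" by force
    have w: "wp (v - (- u - v)) = wp (u - v)" "wp (- u - v - u) = wp (u - v)"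
      by (rule wp_cong[of _ _ v], simp) (rule wp_cong[of _ _ "- u"], simp)
    show "(case x of (u, v) \<Rightarrow> h u v) + (case x of (u, v) \<Rightarrow> h v (- u - v)) + (case x of (u, v) \<Rightarrow> h (- u - v) u)
      + (case x of (u, v) \<Rightarrow> h' u (- u - v)) + (case x of (u, v) \<Rightarrow> h' v u) + (case x of (u, v) \<Rightarrow> h' (- u - v) v)
      = (case x of (u, v) \<Rightarrow> wp (u - v)) * cyc (\<lambda>\<alpha> \<beta> \<gamma>. z \<alpha> \<beta> - z \<alpha> \<gamma>) x"
      unfolding x prod.case h_def h'_def cyc_def w by (simp add: algebra_simps)
  qed (simp add: inf)
qed

text \<open>The kernels X and Y may depend on the rotated triple; only their common limit and
  uniform bound enter.\<close>

lemma cyc_sum_tendsto: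
  fixes z :: "int \<Rightarrow> int \<Rightarrow> complex"
  assumes z: "(\<lambda>(u, v). norm (z u v)) summable_on UNIV"
    and S: "\<And>L. ((\<lambda>x. (case x of (u, v) \<Rightarrow> wp (u - v))
        * cyc (\<lambda>\<alpha> \<beta> \<gamma>. z \<alpha> \<beta> * X \<alpha> \<beta> \<gamma> L - z \<alpha> \<gamma> * Y \<alpha> \<beta> \<gamma> L) x) has_sum S L) UNIV"
    and lim: "\<And>\<alpha> \<beta> \<gamma>. X \<alpha> \<beta> \<gamma> \<longlonglongrightarrow> c" "\<And>\<alpha> \<beta> \<gamma>. Y \<alpha> \<beta> \<gamma> \<longlonglongrightarrow> c"
    and bound: "B \<ge> 0" "\<And>\<alpha> \<beta> \<gamma> L. norm (X \<alpha> \<beta> \<gamma> L) \<le> B" "\<And>\<alpha> \<beta> \<gamma> L. norm (Y \<alpha> \<beta> \<gamma> L) \<le> B"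
  shows "S \<longlonglongrightarrow> c * (3 * infsum (\<lambda>(u, v). (wp (u - v) - wp (v - u)) * z u v) UNIV)"
proof -
  let ?g = "\<lambda>x. (case x of (u, v) \<Rightarrow> wp (u - v)) * cyc (\<lambda>\<alpha> \<beta> \<gamma>. z \<alpha> \<beta> * c - z \<alpha> \<gamma> * c) x"
  let ?M = "\<lambda>x. (case x of (u, v) \<Rightarrow> norm (z u v)) + (case x of (u, v) \<Rightarrow> norm (z u (- u - v))) + (case x of (u, v) \<Rightarrow> norm (z v (- u - v)))
     + (case x of (u, v) \<Rightarrow> norm (z v u)) + (case x of (u, v) \<Rightarrow> norm (z (- u - v) u)) + (case x of (u, v) \<Rightarrow> norm (z (- u - v) v))"
  obtain s where s: "((\<lambda>(u, v). norm (z u v)) has_sum s) UNIV" using z by (auto simp: summable_on_def)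
  note p = has_sum_reindex_perms[of "\<lambda>u v. norm (z u v)", OF s, THEN has_sum_imp_summable]
  have "S \<longlonglongrightarrow> infsum ?g UNIV"
  proof (rule tannery_has_sum(1)[OF S])
    show "(\<lambda>L. (case x of (u, v) \<Rightarrow> wp (u - v)) * cyc (\<lambda>\<alpha> \<beta> \<gamma>. z \<alpha> \<beta> * X \<alpha> \<beta> \<gamma> L - z \<alpha> \<gamma> * Y \<alpha> \<beta> \<gamma> L) x) \<longlonglongrightarrow> ?g x" for x
      unfolding cyc_def split_def by (intro tendsto_intros lim)
    show "(\<lambda>x. B * ?M x) summable_on UNIV"
      by (intro summable_on_cmult_right summable_on_add z p)
    fix L :: nat and x :: "int \<times> int"
    obtain u v where x: "x = (u, v)" by force
    have *: "norm (z a b * X a' b' c' L - z a d * Y a' b' c' L) \<le> norm (z a b) * B + norm (z a d) * B" for a b d a' b' c'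
      by (rule order_trans[OF norm_triangle_ineq4]) (auto simp: norm_mult intro!: add_mono mult_left_mono bound)
    have "norm (cyc (\<lambda>\<alpha> \<beta> \<gamma>. z \<alpha> \<beta> * X \<alpha> \<beta> \<gamma> L - z \<alpha> \<gamma> * Y \<alpha> \<beta> \<gamma> L) x) \<le> B * ?M x"
      unfolding cyc_def x prod.case
      by (rule order_trans[OF norm_triangle_mono[OF norm_triangle_mono[OF * *] *]]) (simp add: algebra_simps)
    then show "norm ((case x of (u, v) \<Rightarrow> wp (u - v)) * cyc (\<lambda>\<alpha> \<beta> \<gamma>. z \<alpha> \<beta> * X \<alpha> \<beta> \<gamma> L - z \<alpha> \<gamma> * Y \<alpha> \<beta> \<gamma> L) x) \<le> B * ?M x"
      by (simp add: norm_mult wp_abs x)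
  qed
  moreover have "infsum ?g UNIV = c * (3 * infsum (\<lambda>(u, v). (wp (u - v) - wp (v - u)) * z u v) UNIV)"
  proof (rule infsumI)
    show "(?g has_sum c * (3 * infsum (\<lambda>(u, v). (wp (u - v) - wp (v - u)) * z u v) UNIV)) UNIV"
      by (rule has_sum_eqI[OF has_sum_cmult_right[OF cyc_sum_has_sum[OF z], of c]]) (auto simp: cyc_def split_def algebra_simps)
  qed
  ultimately show ?thesis by simp
qed

text \<open>The collected exponent: \<open>hexn\<close> occurs once from the expansion of
  \<open>g0\<close> and once for each of the k layers, and the linear part comes from
  \<open>dcoef\<close> and the shifted eigenvalues.\<close>

definition zterm :: "nat \<Rightarrow> nat \<Rightarrow> nat \<Rightarrow> int \<Rightarrow> int \<Rightarrow> complex" where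
  "zterm k a b u v = qp (int (k + 1) * hexn u v + int (a + 1) * u + - int (b + 1) * v + (3 - int k + int a + int b))"

lemma base_cyc:
  "base j x * cyc f x = (case x of (u, v) \<Rightarrow> wp (u - v))
     * cyc (\<lambda>\<alpha> \<beta> \<gamma>. qp (hexn (fst x) (snd x) + j * (hexn (fst x) (snd x) - 1)) * f \<alpha> \<beta> \<gamma>) x"
  unfolding cyc_cmult by (simp add: base_def split_def qp_add)

lemma base_cyc_term0:
  assumes "b \<le> a" "a \<le> k"
  shows "base (int (k - a)) x * cyc (term0 (a - b) b L L x) x
    = (case x of (u, v) \<Rightarrow> wp (u - v)) * cyc (\<lambda>\<alpha> \<beta> \<gamma>. zterm k a b \<alpha> \<beta> * Psi 0 (1 + \<alpha>) (\<beta> - 1) \<gamma> L L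
        - zterm k a b \<alpha> \<gamma> * Psi 0 (1 + \<alpha>) \<beta> (\<gamma> - 1) L L) x"
  unfolding base_cyc
proof (rule arg_cong[of _ _ "(*) _"], rule cyc_cong)
  fix \<alpha> \<beta> \<gamma> :: int
  let ?n = "hexn (fst x) (snd x)"
  assume s: "\<alpha> + \<beta> + \<gamma> = 0" and n: "hexn \<alpha> \<beta> = ?n"
  have \<gamma>: "\<gamma> = - \<alpha> - \<beta>" using s by simp
  have z1: "zterm k a b \<alpha> \<beta> = qp (?n + int (k - a) * (?n - 1)) * qp (int (a - b) * (?n + \<alpha>)) * (qp (1 + \<alpha>) * qp (1 + \<alpha>)) * qp (1 + \<gamma>) * qp (int b * (?n + \<alpha> - \<beta> + 1))"
    unfolding zterm_def qp_add[symmetric] n \<gamma> using assms by (simp add: of_nat_diff algebra_simps)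
  have z2: "zterm k a b \<alpha> \<gamma> = qp (?n + int (k - a) * (?n - 1)) * qp (int (a - b) * (?n + \<alpha>)) * (qp (1 + \<alpha>) * qp (1 + \<alpha>)) * qp (1 + \<beta>) * qp (int b * (?n + \<alpha> - \<gamma> + 1))"
    unfolding zterm_def qp_add[symmetric] hexn_third[OF s] n unfolding \<gamma> using assms by (simp add: of_nat_diff algebra_simps)
  show "qp (?n + int (k - a) * (?n - 1)) * term0 (a - b) b L L x \<alpha> \<beta> \<gamma>
     = zterm k a b \<alpha> \<beta> * Psi 0 (1 + \<alpha>) (\<beta> - 1) \<gamma> L L - zterm k a b \<alpha> \<gamma> * Psi 0 (1 + \<alpha>) \<beta> (\<gamma> - 1) L L"
    unfolding z1 z2 term0_def power2_eq_square right_diff_distrib by (simp only: mult_ac)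
qed

lemma base_cyc_term2:
  assumes "a \<le> k"
  shows "base (int (k - a)) x * cyc (term2 a L L x) x
    = (case x of (u, v) \<Rightarrow> wp (u - v)) * cyc (\<lambda>\<alpha> \<beta> \<gamma>. zterm k a 0 \<alpha> \<beta> * Psi 1 (1 + \<alpha>) \<beta> \<gamma> L L
        - zterm k a 0 \<alpha> \<gamma> * Psi 1 (1 + \<alpha>) \<beta> \<gamma> L L) x"
  unfolding base_cyc
proof (rule arg_cong[of _ _ "(*) _"], rule cyc_cong)
  fix \<alpha> \<beta> \<gamma> :: int
  let ?n = "hexn (fst x) (snd x)"
  assume s: "\<alpha> + \<beta> + \<gamma> = 0" and n: "hexn \<alpha> \<beta> = ?n"
  have \<gamma>: "\<gamma> = - \<alpha> - \<beta>" using s by simp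
  have z1: "zterm k a 0 \<alpha> \<beta> = qp (?n + int (k - a) * (?n - 1)) * qp (int a * (?n + \<alpha>)) * (qp (1 + \<alpha>) * qp (1 + \<alpha>)) * qp (1 + \<gamma>)"
    unfolding zterm_def qp_add[symmetric] n \<gamma> using assms by (simp add: of_nat_diff algebra_simps)
  have z2: "zterm k a 0 \<alpha> \<gamma> = qp (?n + int (k - a) * (?n - 1)) * qp (int a * (?n + \<alpha>)) * (qp (1 + \<alpha>) * qp (1 + \<alpha>)) * qp (1 + \<beta>)"
    unfolding zterm_def qp_add[symmetric] hexn_third[OF s] n unfolding \<gamma> using assms by (simp add: of_nat_diff algebra_simps)
  show "qp (?n + int (k - a) * (?n - 1)) * term2 a L L x \<alpha> \<beta> \<gamma>
     = zterm k a 0 \<alpha> \<beta> * Psi 1 (1 + \<alpha>) \<beta> \<gamma> L L - zterm k a 0 \<alpha> \<gamma> * Psi 1 (1 + \<alpha>) \<beta> \<gamma> L L"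
    unfolding z1 z2 term2_def dcoef_def power2_eq_square by (simp only: right_diff_distrib left_diff_distrib mult_ac)
qed

lemma zterm_summable: "(\<lambda>(u, v). norm (zterm k a b u v)) summable_on UNIV"
  unfolding zterm_def by (rule qp_hexn_summable) simp

text \<open>For b = 0 the convention q^(\<mu>_0) = 0 removes the second chain and
  \<open>chain_a0\<close> suffices; for b > 0 \<open>chain_difference\<close> is used. The kernels
  differ in the two cases, the exponent \<open>zterm\<close> does not.\<close>

lemma chain_tendsto:
  assumes "b \<le> a" "a \<le> k"
  shows "(\<lambda>L. g0_const * (chain k a b L L - (if b = 0 then 0 else q * chain k (a - 1) (b - 1) L L)))
     \<longlonglongrightarrow> 1 / qinf ^ 5 * (3 * infsum (\<lambda>(u, v). (wp (u - v) - wp (v - u)) * zterm k a b u v) UNIV)"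
proof -
  obtain B where B: "B \<ge> 0" "\<And>w a1 a2 a3 l m. norm (Psi w a1 a2 a3 l m) \<le> B" using Psi_bounded by metis
  show ?thesis
  proof (cases "b = 0")
    case True
    have "((\<lambda>x. (case x of (u, v) \<Rightarrow> wp (u - v)) * cyc (\<lambda>\<alpha> \<beta> \<gamma>. zterm k a 0 \<alpha> \<beta> * Psi 1 (1 + \<alpha>) \<beta> \<gamma> L L
        - zterm k a 0 \<alpha> \<gamma> * Psi 1 (1 + \<alpha>) \<beta> \<gamma> L L) x) has_sum g0_const * chain k a 0 L L) UNIV" for L
      using chain_a0[OF assms(2), of L L] unfolding base_cyc_term2[OF assms(2)] .
    from cyc_sum_tendsto[OF zterm_summable this Psi_tendsto Psi_tendsto B(1) B(2) B(2)]
    show ?thesis using True by simp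
  next
    case False
    have "((\<lambda>x. (case x of (u, v) \<Rightarrow> wp (u - v)) * cyc (\<lambda>\<alpha> \<beta> \<gamma>. zterm k a b \<alpha> \<beta> * Psi 0 (1 + \<alpha>) (\<beta> - 1) \<gamma> L L
        - zterm k a b \<alpha> \<gamma> * Psi 0 (1 + \<alpha>) \<beta> (\<gamma> - 1) L L) x)
        has_sum g0_const * (chain k a b L L - q * chain k (a - 1) (b - 1) L L)) UNIV" for L
      using chain_difference[OF assms, of L L] False unfolding base_cyc_term0[OF assms] by simp
    from cyc_sum_tendsto[OF zterm_summable this Psi_tendsto Psi_tendsto B(1) B(2) B(2)]
    show ?thesis using False by simp
  qed
qed

end

section \<open>The multisum as a limit of the chain\<close>

definition pcons :: "nat \<Rightarrow> (nat \<Rightarrow> nat) \<Rightarrow> nat \<Rightarrow> nat" where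
  "pcons n l = (\<lambda>i. if i = 0 then 0 else if i = 1 then n else l (i - 1))"

definition ptail :: "(nat \<Rightarrow> nat) \<Rightarrow> nat \<Rightarrow> nat" where
  "ptail l = (\<lambda>i. if i = 0 then 0 else l (Suc i))"

definition bparts :: "nat \<Rightarrow> nat \<Rightarrow> (nat \<Rightarrow> nat) set" where
  "bparts k L = {l \<in> parts k. l 1 \<le> L}"

lemma bparts_0: "bparts 0 L = {\<lambda>_. 0}"
  by (auto simp: bparts_def parts_def)

lemma parts_at_0: "l \<in> parts k \<Longrightarrow> l 0 = 0"
  by (simp add: parts_def)

lemma pcons_mem: "l \<in> bparts k n \<Longrightarrow> n \<le> L \<Longrightarrow> pcons n l \<in> bparts (Suc k) L"
proof -
  assume l: "l \<in> bparts k n" and n: "n \<le> L"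
  have "pcons n l (Suc i) \<le> pcons n l i" if "i \<in> {1..<Suc k}" for i
    using that l by (cases i; cases "i = 1") (auto simp: pcons_def bparts_def parts_def)
  moreover have "pcons n l i = 0" if "i \<notin> {1..Suc k}" for i
    using that l by (cases i) (auto simp: pcons_def bparts_def parts_def)
  ultimately show ?thesis using n by (auto simp: bparts_def parts_def) (simp add: pcons_def)
qed

lemma ptail_mem: "l \<in> bparts (Suc k) L \<Longrightarrow> ptail l \<in> bparts k (l 1) \<and> l 1 \<le> L"
proof -
  assume l: "l \<in> bparts (Suc k) L"
  have "l (Suc 1) \<le> l 1" using l by (cases k) (auto simp: bparts_def parts_def)
  then show ?thesis using l by (auto simp: ptail_def bparts_def parts_def)
qed

lemma sum_bparts_Suc:
  fixes h :: "(nat \<Rightarrow> nat) \<Rightarrow> 'a :: comm_monoid_add"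
  shows "finite (bparts k L)" and "(\<Sum>l\<in>bparts (Suc k) L. h l) = (\<Sum>n\<le>L. \<Sum>l\<in>bparts k n. h (pcons n l))"
proof -
  have bij: "bij_betw (\<lambda>(n, l). pcons n l) (Sigma {..L} (bparts k)) (bparts (Suc k) L)" for k L
  proof (rule bij_betw_byWitness[where f' = "\<lambda>l. (l 1, ptail l)"])
    show "\<forall>x\<in>Sigma {..L} (bparts k). (\<lambda>l. (l 1, ptail l)) ((\<lambda>(n, l). pcons n l) x) = x"
      by (auto simp: pcons_def ptail_def bparts_def fun_eq_iff parts_at_0)
    show "\<forall>l\<in>bparts (Suc k) L. (\<lambda>(n, l). pcons n l) (l 1, ptail l) = l"
      by (auto simp: pcons_def ptail_def bparts_def fun_eq_iff parts_at_0)
    show "(\<lambda>(n, l). pcons n l) ` Sigma {..L} (bparts k) \<subseteq> bparts (Suc k) L"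
      using pcons_mem by auto
    show "(\<lambda>l. (l 1, ptail l)) ` bparts (Suc k) L \<subseteq> Sigma {..L} (bparts k)"
      using ptail_mem by auto
  qed
  show fin: "finite (bparts k L)" for k L
  proof (induction k arbitrary: L)
    case (Suc k)
    then have "finite (Sigma {..L} (bparts k))" by auto
    then show ?case using bij_betw_finite[OF bij] by blast
  qed (simp add: bparts_0)
  have "(\<Sum>l\<in>bparts (Suc k) L. h l) = (\<Sum>x\<in>Sigma {..L} (bparts k). h ((\<lambda>(n, l). pcons n l) x))"
    by (rule sum.reindex_bij_betw[OF bij, symmetric])
  also have "\<dots> = (\<Sum>n\<le>L. \<Sum>l\<in>bparts k n. h (pcons n l))"
    by (subst sum.Sigma) (auto simp: fin split_def)
  finally show "(\<Sum>l\<in>bparts (Suc k) L. h l) = (\<Sum>n\<le>L. \<Sum>l\<in>bparts k n. h (pcons n l))" .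
qed

text \<open>Peeling off the first part bounds every truncated sum by a power of 1 / (1 - s),
  uniformly in L, and every finite set of partitions lies in a truncation.\<close>

lemma parts_weight_summable:
  fixes s :: real
  assumes "0 \<le> s" "s < 1"
  shows "(\<lambda>l. \<Prod>i<k. s ^ l (Suc i)) summable_on parts k"
proof (rule nonneg_bdd_above_summable_on)
  have bound: "(\<Sum>l\<in>bparts k L. \<Prod>i<k. s ^ l (Suc i)) \<le> (1 / (1 - s)) ^ k" for L
  proof (induction k arbitrary: L)
    case 0
    then show ?case by (simp add: bparts_0)
  next
    case (Suc k)
    have p: "(\<Prod>i<Suc k. s ^ pcons n l (Suc i)) = s ^ n * (\<Prod>i<k. s ^ l (Suc i))" for n l
      unfolding prod.lessThan_Suc_shift by (simp add: pcons_def)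
    have "(\<Sum>l\<in>bparts (Suc k) L. \<Prod>i<Suc k. s ^ l (Suc i)) = (\<Sum>n\<le>L. s ^ n * (\<Sum>l\<in>bparts k n. \<Prod>i<k. s ^ l (Suc i)))"
      unfolding sum_bparts_Suc p sum_distrib_left ..
    also have "\<dots> \<le> (\<Sum>n\<le>L. s ^ n * (1 / (1 - s)) ^ k)"
      using Suc.IH assms by (intro sum_mono mult_left_mono) auto
    also have "\<dots> = (\<Sum>n\<le>L. s ^ n) * (1 / (1 - s)) ^ k"
      by (simp only: sum_distrib_right)
    also have "(\<Sum>n\<le>L. s ^ n) \<le> 1 / (1 - s)"
    proof -
      have "(\<Sum>n\<le>L. s ^ n) \<le> suminf (\<lambda>n. s ^ n)"
        by (rule sum_le_suminf) (use assms in auto)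
      then show ?thesis using assms by (simp add: suminf_geometric)
    qed
    finally show ?case using assms by (simp add: mult_right_mono)
  qed
  show "bdd_above (sum (\<lambda>l. \<Prod>i<k. s ^ l (Suc i)) ` {F. F \<subseteq> parts k \<and> finite F})"
  proof (rule bdd_aboveI2)
    fix F assume F: "F \<in> {F. F \<subseteq> parts k \<and> finite F}"
    define L where "L = Max (insert 0 ((\<lambda>l. l 1) ` F))"
    have "F \<subseteq> bparts k L"
      using F by (auto simp: bparts_def L_def intro!: Max_ge)
    then have "sum (\<lambda>l. \<Prod>i<k. s ^ l (Suc i)) F \<le> sum (\<lambda>l. \<Prod>i<k. s ^ l (Suc i)) (bparts k L)"
      by (intro sum_mono2 sum_bparts_Suc(1)) (use assms in \<open>auto intro!: prod_nonneg\<close>)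
    also note bound
    finally show "sum (\<lambda>l. \<Prod>i<k. s ^ l (Suc i)) F \<le> (1 / (1 - s)) ^ k" .
  qed
qed (use assms in \<open>auto intro!: prod_nonneg\<close>)

context nome
begin

text \<open>The index i starts at 0 and refers to the parts with index i + 1, so
  \<open>i < a\<close> means a part with index at most a.\<close>

definition level :: "nat \<Rightarrow> nat \<Rightarrow> nat \<Rightarrow> nat \<Rightarrow> nat \<Rightarrow> complex" where
  "level a b i n m = qp (int n * int n - int n * int m + int m * int m
      + (if i < a then 0 else 1) * int n + (if i < b then 0 else 1) * int m)"

text \<open>Position 0 of l and m holds the outer bounds, so the factor for i = 0 contains 1/(q)_(L
  - \<lambda>_1) and its analogue for \<mu>_1.\<close>

definition cwt :: "nat \<Rightarrow> nat \<Rightarrow> nat \<Rightarrow> (nat \<Rightarrow> nat) \<Rightarrow> (nat \<Rightarrow> nat) \<Rightarrow> complex" where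
  "cwt k a b l m = (\<Prod>i<k. level a b i (l (Suc i)) (m (Suc i)) * rq (int (l i) - int (l (Suc i))) * rq (int (m i) - int (m (Suc i))))
     * g0 (l k) (m k) q"

lemma chain_eq_sum:
  "chain k a b L1 L2 = (\<Sum>l\<in>bparts k L1. \<Sum>m\<in>bparts k L2. cwt k a b (l(0 := L1)) (m(0 := L2)))"
proof (induction k arbitrary: a b L1 L2)
  case 0
  then show ?case by (simp add: bparts_0 cwt_def)
next
  case (Suc k)
  have c: "((pcons n l)(0 := L)) (Suc i) = (l(0 := n)) i" for n l L i
    by (cases i) (auto simp: pcons_def)
  have lev: "level a b (Suc i) n m = level (a - 1) (b - 1) i n m" for i n m
    by (auto simp: level_def)
  have "cwt (Suc k) a b ((pcons n l)(0 := L1)) ((pcons n' m)(0 := L2))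
     = level a b 0 n n' * rq (int L1 - int n) * rq (int L2 - int n') * cwt k (a - 1) (b - 1) (l(0 := n)) (m(0 := n'))" for n n' l m
    unfolding cwt_def prod.lessThan_Suc_shift c lev by (simp add: mult.assoc pcons_def)
  then have "(\<Sum>l\<in>bparts (Suc k) L1. \<Sum>m\<in>bparts (Suc k) L2. cwt (Suc k) a b (l(0 := L1)) (m(0 := L2)))
    = (\<Sum>n\<le>L1. \<Sum>l\<in>bparts k n. \<Sum>n'\<le>L2. \<Sum>m\<in>bparts k n'. level a b 0 n n' * rq (int L1 - int n) * rq (int L2 - int n') * cwt k (a - 1) (b - 1) (l(0 := n)) (m(0 := n')))"
    unfolding sum_bparts_Suc by simp
  also have "\<dots> = (\<Sum>n\<le>L1. \<Sum>n'\<le>L2. \<Sum>l\<in>bparts k n. \<Sum>m\<in>bparts k n'. level a b 0 n n' * rq (int L1 - int n) * rq (int L2 - int n') * cwt k (a - 1) (b - 1) (l(0 := n)) (m(0 := n')))"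
    by (intro sum.cong refl sum.swap)
  also have "\<dots> = (\<Sum>n\<le>L1. \<Sum>n'\<le>L2. level a b 0 n n' * rq (int L1 - int n) * rq (int L2 - int n') * chain k (a - 1) (b - 1) n n')"
    unfolding Suc.IH sum_distrib_left ..
  also have "\<dots> = chain (Suc k) a b L1 L2"
    unfolding chain.simps Tstep_def level_def by (auto intro!: sum.cong)
  finally show ?case ..
qed

text \<open>The summand of the chain without the two factors that involve L, and at the same time
  that of \<F> without its first factor.\<close>

definition hterm :: "nat \<Rightarrow> nat \<Rightarrow> nat \<Rightarrow> (nat \<Rightarrow> nat) \<times> (nat \<Rightarrow> nat) \<Rightarrow> complex" where
  "hterm k a b = (\<lambda>(l, m). (\<Prod>i<k. level a b i (l (Suc i)) (m (Suc i)))
     * (\<Prod>i\<in>{1..<k}. rq (int (l i) - int (l (Suc i))) * rq (int (m i) - int (m (Suc i)))) * g0 (l k) (m k) q)"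

lemma cwt_hterm:
  assumes "k > 0"
  shows "cwt k a b (l(0 := L1)) (m(0 := L2)) = hterm k a b (l, m) * (rq (int L1 - int (l 1)) * rq (int L2 - int (m 1)))"
proof -
  obtain k' where k: "k = Suc k'" using assms by (cases k) auto
  have "(\<Prod>i<k. rq (int ((l(0 := L1)) i) - int ((l(0 := L1)) (Suc i))) * rq (int ((m(0 := L2)) i) - int ((m(0 := L2)) (Suc i))))
     = rq (int L1 - int (l 1)) * rq (int L2 - int (m 1)) * (\<Prod>i\<in>{1..<k}. rq (int (l i) - int (l (Suc i))) * rq (int (m i) - int (m (Suc i))))"
    unfolding k prod.lessThan_Suc_shift
    by (simp add: prod.atLeast_Suc_lessThan_Suc_shift lessThan_atLeast0 del: prod.op_ivl_Suc)
  then show ?thesis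
    unfolding cwt_def hterm_def prod.case using assms by (simp add: prod.distrib mult.assoc)
qed

lemma g0_bounded: obtains G where "\<And>n m. norm (g0 n m q) \<le> G"
proof -
  interpret c: nome "q ^ 3" by (rule nome_power) simp
  obtain B where B: "B \<ge> 1" "\<And>n. norm (rq n) \<le> B" "\<And>n. norm (qpoch q q n) \<le> B" using rq_bounded by metis
  obtain C where C: "C \<ge> 1" "\<And>n. norm (c.rq n) \<le> C" "\<And>n. norm (qpoch (q ^ 3) (q ^ 3) n) \<le> C" using c.rq_bounded by metis
  have e: "g0 n m q = (1 - q) * (rq (int (n + m)) * rq (int (Suc (n + m)))) * (qpoch (q ^ 3) (q ^ 3) (n + m) * c.rq (int n) * c.rq (int m))" for n m
  proof -
    have "1 - q \<noteq> 0" using norm_q by auto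
    then have "qpoch (q\<^sup>2) q (n + m) = qpoch q q (Suc (n + m)) / (1 - q)"
      using qpoch_q2[of "n + m"] by (simp add: field_simps)
    then show ?thesis unfolding g0_def qbinom_def rq_nat c.rq_nat by (simp add: field_simps)
  qed
  have "norm (g0 n m q) \<le> norm (1 - q) * (B * B) * (C * C * C)" for n m
    unfolding e norm_mult using B C by (intro mult_mono) auto
  then show ?thesis using that by metis
qed

text \<open>From 2 (n^2 - n m + m^2) = n^2 + m^2 + (n - m)^2 \<ge> n + m; the factor 2 is the reason
  for the square root.\<close>

lemma level_bound: "norm (level a b i n m) \<le> sqrt (norm q) ^ n * sqrt (norm q) ^ m"
proof -
  let ?r = "norm q" and ?s = "sqrt (norm q)"
  have r: "0 < ?r" "?r < 1" using norm_q q_nz by auto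
  let ?e = "int n * int n - int n * int m + int m * int m + (if i < a then 0 else 1) * int n + (if i < b then 0 else 1) * int m"
  have sq: "int j \<le> int j * int j" for j by (cases j) (auto simp: algebra_simps)
  have "0 \<le> (int n - int m) * (int n - int m)" by simp
  then have e: "2 * ?e \<ge> int n + int m" using sq[of n] sq[of m] by (auto simp: algebra_simps)
  have "norm (level a b i n m) = ?r powi ?e" unfolding level_def norm_qp ..
  also have "?r powi ?e = ?s powi (2 * ?e)"
  proof -
    have "?s powi 2 = ?r" using r by simp
    then show ?thesis by (simp only: power_int_mult)
  qed
  also have "\<dots> \<le> ?s powi (int n + int m)"
    by (rule power_int_decreasing[OF e]) (use r in auto)
  also have "\<dots> = ?s ^ n * ?s ^ m"
    using r by (simp add: power_int_add)
  finally show ?thesis .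
qed

lemma hterm_bound:
  obtains C where "C \<ge> 0" "\<And>l m. norm (hterm k a b (l, m)) \<le> C * ((\<Prod>i<k. sqrt (norm q) ^ l (Suc i)) * (\<Prod>i<k. sqrt (norm q) ^ m (Suc i)))"
proof -
  let ?s = "sqrt (norm q)"
  obtain B where B: "B \<ge> 1" "\<And>n. norm (rq n) \<le> B" using rq_bounded by metis
  obtain G where G: "\<And>n m. norm (g0 n m q) \<le> G" using g0_bounded by metis
  have G0: "G \<ge> 0" using G[of 0 0] norm_ge_zero order_trans by blast
  have "norm (hterm k a b (l, m)) \<le> ((\<Prod>i<k. ?s ^ l (Suc i)) * (\<Prod>i<k. ?s ^ m (Suc i))) * (\<Prod>i\<in>{1..<k}. B * B) * G" for l m
  proof -
    have "norm (\<Prod>i<k. level a b i (l (Suc i)) (m (Suc i))) \<le> (\<Prod>i<k. ?s ^ l (Suc i)) * (\<Prod>i<k. ?s ^ m (Suc i))"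
      unfolding prod_norm[symmetric] prod.distrib[symmetric] by (intro prod_mono conjI level_bound) auto
    moreover have "norm (\<Prod>i\<in>{1..<k}. rq (int (l i) - int (l (Suc i))) * rq (int (m i) - int (m (Suc i)))) \<le> (\<Prod>i\<in>{1..<k}. B * B)"
      unfolding prod_norm[symmetric] norm_mult using B by (intro prod_mono conjI mult_mono) auto
    ultimately show ?thesis unfolding hterm_def prod.case norm_mult
      using B by (intro mult_mono G) (auto intro!: mult_nonneg_nonneg prod_nonneg)
  qed
  then show ?thesis using G0 B by (intro that[of "(\<Prod>i\<in>{1..<k}. B * B) * G"]) (auto simp: mult_ac intro!: mult_nonneg_nonneg)
qed

text \<open>Only the two outer factors depend on L, and each tends to 1/(q)_\<infinity>.\<close>

lemma chain_tendsto_hterm: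
  assumes k: "k > 0"
  shows "(\<lambda>L. chain k a b L L) \<longlonglongrightarrow> infsum (hterm k a b) (parts k \<times> parts k) / qinf\<^sup>2"
    and "hterm k a b summable_on parts k \<times> parts k"
proof -
  let ?s = "sqrt (norm q)" and ?A = "parts k \<times> parts k"
  have s: "0 \<le> ?s" "?s < 1" using norm_q by auto
  obtain B where B: "B \<ge> 1" "\<And>n. norm (rq n) \<le> B" using rq_bounded by metis
  obtain C where C: "C \<ge> 0" "\<And>l m. norm (hterm k a b (l, m)) \<le> C * ((\<Prod>i<k. ?s ^ l (Suc i)) * (\<Prod>i<k. ?s ^ m (Suc i)))"
    using hterm_bound by metis
  let ?w = "\<lambda>l. \<Prod>i<k. ?s ^ l (Suc i)"
  let ?f = "\<lambda>L (l, m). hterm k a b (l, m) * (rq (int L - int (l 1)) * rq (int L - int (m 1)))"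
  let ?M = "\<lambda>x. C * (B * B) * (case x of (l, m) \<Rightarrow> ?w l * ?w m)"
  have hs: "(?f L has_sum chain k a b L L) ?A" for L
  proof (rule has_sum_finite_neutralI)
    show "finite (bparts k L \<times> bparts k L)" by (intro finite_cartesian_product sum_bparts_Suc(1))
    show "bparts k L \<times> bparts k L \<subseteq> ?A" by (auto simp: bparts_def)
    show "?f L x = 0" if xA: "x \<in> ?A - bparts k L \<times> bparts k L" for x
    proof -
      obtain l m where x: "x = (l, m)" "l \<in> parts k" "m \<in> parts k" using xA by (cases x) auto
      then have "int L - int (l 1) < 0 \<or> int L - int (m 1) < 0" using xA by (auto simp: bparts_def)
      then show ?thesis unfolding x prod.case by (elim disjE) (simp_all only: rq_neg mult_zero_left mult_zero_right)
    qed
    show "chain k a b L L = (\<Sum>x\<in>bparts k L \<times> bparts k L. ?f L x)"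
      unfolding chain_eq_sum cwt_hterm[OF k] by (simp add: sum.cartesian_product split_def)
  qed
  have M: "?M summable_on ?A"
  proof (rule summable_on_cmult_right)
    have "(\<lambda>(l, m). ?w l * ?w m) summable_on ?A"
      by (intro summable_on_times_real parts_weight_summable s) (auto intro!: prod_nonneg)
    then show "(\<lambda>x. case x of (l, m) \<Rightarrow> ?w l * ?w m) summable_on ?A" .
  qed
  have w0: "?w l \<ge> 0" for l by (auto intro!: prod_nonneg)
  have bd: "norm (?f L x) \<le> ?M x" for L x
  proof -
    obtain l m where x: "x = (l, m)" by force
    have "norm (?f L x) \<le> C * (?w l * ?w m) * (B * B)"
      unfolding x prod.case norm_mult using B C w0 by (intro mult_mono) (auto intro!: mult_nonneg_nonneg)
    then show ?thesis by (simp add: x mult_ac)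
  qed
  have lim: "(\<lambda>L. ?f L x) \<longlonglongrightarrow> hterm k a b x / qinf\<^sup>2" for x
  proof -
    obtain l m where x: "x = (l, m)" by force
    have "(\<lambda>L. ?f L x) \<longlonglongrightarrow> hterm k a b x * (1 / qinf * (1 / qinf))"
      unfolding x prod.case
      using rq_shift_tendsto[of "- int (l 1)"] rq_shift_tendsto[of "- int (m 1)"] by (intro tendsto_intros) simp_all
    then show ?thesis by (simp add: power2_eq_square)
  qed
  have "(\<lambda>L. chain k a b L L) \<longlonglongrightarrow> infsum (\<lambda>x. hterm k a b x / qinf\<^sup>2) ?A" "(\<lambda>x. hterm k a b x / qinf\<^sup>2) summable_on ?A"
    by (rule tannery_has_sum[OF hs lim bd M])+
  moreover have "hterm k a b x = (hterm k a b x / qinf\<^sup>2) * qinf\<^sup>2" for x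
    using qinf_nz by simp
  ultimately show sm: "hterm k a b summable_on ?A"
    using summable_on_cmult_left[of "\<lambda>x. hterm k a b x / qinf\<^sup>2" ?A "qinf\<^sup>2"] by simp
  have "infsum (\<lambda>x. hterm k a b x / qinf\<^sup>2) ?A = infsum (hterm k a b) ?A / qinf\<^sup>2"
    using infsum_cmult_left'[of "hterm k a b" "1 / qinf\<^sup>2" ?A] by simp
  with \<open>(\<lambda>L. chain k a b L L) \<longlonglongrightarrow> infsum (\<lambda>x. hterm k a b x / qinf\<^sup>2) ?A\<close>
  show "(\<lambda>L. chain k a b L L) \<longlonglongrightarrow> infsum (hterm k a b) ?A / qinf\<^sup>2" by simp
qed

lemma hterm_explicit:
  assumes "l \<in> parts k" "m \<in> parts k"
  shows "hterm k a b (l, m) = q ^ ((\<Sum>i=1..k. (l i)^2 + (m i)^2 - l i * m i) + (\<Sum>i\<in>{a+1..k}. l i) + (\<Sum>i\<in>{b+1..k}. m i))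
     / (\<Prod>i\<in>{1..<k}. qpoch q q (l i - l (Suc i)) * qpoch q q (m i - m (Suc i))) * g0 (l k) (m k) q"
proof -
  have lev: "level a b i n n' = q ^ (n^2 + n'^2 - n * n' + (if i < a then 0 else n) + (if i < b then 0 else n'))" for i n n'
  proof -
    \<comment> \<open>The subtraction of natural numbers in the exponent of \<open>Fterm\<close>
      therefore never truncates.\<close>
    have le: "n * n' \<le> n^2 + n'^2"
    proof -
      have "n * n' \<le> (max n n')^2" unfolding power2_eq_square by (intro mult_mono) auto
      also have "\<dots> \<le> n^2 + n'^2" by (auto simp: max_def)
      finally show ?thesis .
    qed
    show ?thesis unfolding level_def qp_nat[symmetric]
      by (rule arg_cong[of _ _ qp]) (simp add: of_nat_diff[OF le[unfolded power2_eq_square]] power2_eq_square)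
  qed
  have s: "(\<Sum>i<k. if i < a then 0 else f (Suc i)) = (\<Sum>i\<in>{a+1..k}. f i)" for a and f :: "nat \<Rightarrow> nat"
  proof -
    have "(\<Sum>i<k. if i < a then 0 else f (Suc i)) = (\<Sum>i\<in>{1..k}. if i - 1 < a then 0 else f i)"
      unfolding One_nat_def sum.atLeast1_atMost_eq by simp
    also have "\<dots> = (\<Sum>i\<in>{a+1..k}. f i)"
      by (rule sum.mono_neutral_cong_right) auto
    finally show ?thesis .
  qed
  have "(\<Prod>i<k. level a b i (l (Suc i)) (m (Suc i))) = q ^ (\<Sum>i<k. (l (Suc i))^2 + (m (Suc i))^2 - l (Suc i) * m (Suc i) + (if i < a then 0 else l (Suc i)) + (if i < b then 0 else m (Suc i)))"
    unfolding lev power_sum ..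
  also have "(\<Sum>i<k. (l (Suc i))^2 + (m (Suc i))^2 - l (Suc i) * m (Suc i) + (if i < a then 0 else l (Suc i)) + (if i < b then 0 else m (Suc i)))
     = (\<Sum>i=1..k. (l i)^2 + (m i)^2 - l i * m i) + (\<Sum>i\<in>{a+1..k}. l i) + (\<Sum>i\<in>{b+1..k}. m i)"
    unfolding sum.distrib s One_nat_def sum.atLeast1_atMost_eq ..
  finally have p: "(\<Prod>i<k. level a b i (l (Suc i)) (m (Suc i))) = q ^ ((\<Sum>i=1..k. (l i)^2 + (m i)^2 - l i * m i) + (\<Sum>i\<in>{a+1..k}. l i) + (\<Sum>i\<in>{b+1..k}. m i))" .
  have "(\<Prod>i\<in>{1..<k}. rq (int (l i) - int (l (Suc i))) * rq (int (m i) - int (m (Suc i))))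
     = (\<Prod>i\<in>{1..<k}. 1 / (qpoch q q (l i - l (Suc i)) * qpoch q q (m i - m (Suc i))))"
  proof (intro prod.cong refl)
    fix i assume "i \<in> {1..<k}"
    then have "l (Suc i) \<le> l i" "m (Suc i) \<le> m i" using assms by (auto simp: parts_def)
    then have e: "int (l i) - int (l (Suc i)) = int (l i - l (Suc i))" "int (m i) - int (m (Suc i)) = int (m i - m (Suc i))"
      by (simp_all add: of_nat_diff)
    show "rq (int (l i) - int (l (Suc i))) * rq (int (m i) - int (m (Suc i))) = 1 / (qpoch q q (l i - l (Suc i)) * qpoch q q (m i - m (Suc i)))"
      unfolding e rq_nat by simp
  qed
  also have "\<dots> = 1 / (\<Prod>i\<in>{1..<k}. qpoch q q (l i - l (Suc i)) * qpoch q q (m i - m (Suc i)))"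
    unfolding prod_dividef by simp
  finally show ?thesis unfolding hterm_def prod.case p by simp
qed

text \<open>Multiplication by q^(\<lambda>_a + \<mu>_b) adds \<lambda>_a and \<mu>_b to the linear
  exponents, that is, lowers a and b by one. If b > 0 then a > 0 as well, so the convention at index
  0 matters for b = 0 only.\<close>

lemma Fcal_hterm:
  assumes "k > 0" "a \<le> k" "b \<le> a"
  shows "Fcal a b k q = (infsum (hterm k a b) (parts k \<times> parts k)
      - (if b = 0 then 0 else q * infsum (hterm k (a - 1) (b - 1)) (parts k \<times> parts k))) / (1 - q)"
proof -
  let ?A = "parts k \<times> parts k"
  let ?c = "if b = 0 then 0 else q"
  have "Fterm a b k q x = (hterm k a b x + - ?c * hterm k (a - 1) (b - 1) x) * (1 / (1 - q))" if "x \<in> ?A" for x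
  proof -
    obtain l m where x: "x = (l, m)" and lm: "l \<in> parts k" "m \<in> parts k" using \<open>x \<in> ?A\<close> by auto
    let ?E = "(\<Sum>i=1..k. (l i)^2 + (m i)^2 - l i * m i)"
    show ?thesis
    proof (cases "b = 0")
      case True
      then show ?thesis unfolding x Fterm_def prod.case hterm_explicit[OF lm] by (simp add: qpow_conv_def)
    next
      case False
      have s: "(\<Sum>i\<in>{a-1+1..k}. f i) = f a + (\<Sum>i\<in>{a+1..k}. f i)" if "0 < a" "a \<le> k" for a and f :: "nat \<Rightarrow> nat"
        using that by (simp add: sum.atLeast_Suc_atMost)
      have e: "?E + (\<Sum>i\<in>{a-1+1..k}. l i) + (\<Sum>i\<in>{b-1+1..k}. m i)
        = l a + m b + (?E + (\<Sum>i\<in>{a+1..k}. l i) + (\<Sum>i\<in>{b+1..k}. m i))"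
        using assms False by (subst (1 2) s) auto
      show ?thesis unfolding x Fterm_def prod.case hterm_explicit[OF lm] e power_add[of q "l a + m b"]
        using False assms by (simp add: qpow_conv_def diff_divide_distrib power_add algebra_simps)
    qed
  qed
  then have "Fcal a b k q = infsum (\<lambda>x. (hterm k a b x + - ?c * hterm k (a - 1) (b - 1) x) * (1 / (1 - q))) ?A"
    unfolding Fcal_def by (rule infsum_cong)
  also have "\<dots> = (infsum (hterm k a b) ?A + - ?c * infsum (hterm k (a - 1) (b - 1)) ?A) * (1 / (1 - q))"
  proof -
    have 1: "hterm k a b summable_on ?A" by (rule chain_tendsto_hterm(2)[OF assms(1)])
    have 2: "(\<lambda>x. - ?c * hterm k (a - 1) (b - 1) x) summable_on ?A"
      by (intro summable_on_cmult_right chain_tendsto_hterm(2)[OF assms(1)])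
    show ?thesis unfolding infsum_cmult_left' infsum_add[OF 1 2] infsum_cmult_right' ..
  qed
  finally show ?thesis by simp
qed

definition Msum :: "nat \<Rightarrow> int \<Rightarrow> int \<Rightarrow> complex" where
  "Msum n A B = infsum (\<lambda>(u, v). (wp (u - v) - wp (v - u)) * qp (int n * hexn u v + A * u - B * v)) UNIV"

text \<open>Two evaluations of one limit: (q)_\<infinity>^(-2) from the outer factors against
  (q)_\<infinity>^(-5) from the kernels leaves the third power. The 3 in \<open>g0_const\<close>
  cancels against the three rotations, its q^2 against part of the exponent in
  \<open>zterm\<close>.\<close>

lemma Fcal_eq_Msum:
  assumes "k > 0" "a \<le> k" "b \<le> a"
  shows "Fcal a b k q = qp (1 - int k + int a + int b) * Msum (k + 1) (int a + 1) (int b + 1) / ((wp 1 - wp (- 1)) * qinf ^ 3)"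
proof -
  define H where "H = infsum (hterm k a b) (parts k \<times> parts k) - (if b = 0 then 0 else q * infsum (hterm k (a - 1) (b - 1)) (parts k \<times> parts k))"
  have q1: "1 - q \<noteq> 0" using norm_q by auto
  have "(\<lambda>L. g0_const * (chain k a b L L - (if b = 0 then 0 else q * chain k (a - 1) (b - 1) L L))) \<longlonglongrightarrow> g0_const * (H / qinf\<^sup>2)"
  proof (cases "b = 0")
    case True
    then show ?thesis using tendsto_mult[OF tendsto_const[of g0_const] chain_tendsto_hterm(1)[OF assms(1), of a 0]]
      unfolding H_def by simp
  next
    case False
    then show ?thesis
      using tendsto_mult[OF tendsto_const[of g0_const] tendsto_diff[OF chain_tendsto_hterm(1)[OF assms(1), of a b]
          tendsto_mult[OF tendsto_const[of q] chain_tendsto_hterm(1)[OF assms(1), of "a - 1" "b - 1"]]]]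
      unfolding H_def by (simp add: diff_divide_distrib)
  qed
  from LIMSEQ_unique[OF this chain_tendsto[OF assms(3,2)]]
  have *: "g0_const * (H / qinf\<^sup>2) = 1 / qinf ^ 5 * (3 * infsum (\<lambda>(u, v). (wp (u - v) - wp (v - u)) * zterm k a b u v) UNIV)" .
  have "infsum (\<lambda>(u, v). (wp (u - v) - wp (v - u)) * zterm k a b u v) UNIV
     = infsum (\<lambda>x. qp (3 - int k + int a + int b) * (case x of (u, v) \<Rightarrow> (wp (u - v) - wp (v - u)) * qp (int (k + 1) * hexn u v + (int a + 1) * u - (int b + 1) * v))) UNIV"
  proof (rule infsum_cong)
    fix x :: "int \<times> int"
    obtain u v where x: "x = (u, v)" by force
    have "zterm k a b u v = qp (3 - int k + int a + int b) * qp (int (k + 1) * hexn u v + (int a + 1) * u - (int b + 1) * v)"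
      unfolding zterm_def qp_add[symmetric] by (rule arg_cong[of _ _ qp]) (simp add: algebra_simps)
    then show "(case x of (u, v) \<Rightarrow> (wp (u - v) - wp (v - u)) * zterm k a b u v) =
       qp (3 - int k + int a + int b) * (case x of (u, v) \<Rightarrow> (wp (u - v) - wp (v - u)) * qp (int (k + 1) * hexn u v + (int a + 1) * u - (int b + 1) * v))"
      by (simp add: x)
  qed
  then have i: "infsum (\<lambda>(u, v). (wp (u - v) - wp (v - u)) * zterm k a b u v) UNIV
     = qp (3 - int k + int a + int b) * Msum (k + 1) (int a + 1) (int b + 1)"
    unfolding infsum_cmult_right' Msum_def .
  have q2: "qp (3 - int k + int a + int b) = q\<^sup>2 * qp (1 - int k + int a + int b)"
    using qp_add[of 2 "1 - int k + int a + int b"] qp_nat[of 2] by (simp add: algebra_simps)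
  have "q\<^sup>2 * ((wp 1 - wp (- 1)) * qinf ^ 3 * (H / (1 - q))) = q\<^sup>2 * (qp (1 - int k + int a + int b) * Msum (k + 1) (int a + 1) (int b + 1))"
  proof -
    have "3 * (q\<^sup>2 * ((wp 1 - wp (- 1)) * qinf ^ 3 * (H / (1 - q)))) = g0_const * (H / qinf\<^sup>2) * qinf ^ 5"
      using qinf_nz q1 by (simp add: g0_const_def field_simps power_def numeral_eq_Suc)
    also have "\<dots> = 3 * (q\<^sup>2 * (qp (1 - int k + int a + int b) * Msum (k + 1) (int a + 1) (int b + 1)))"
      unfolding * i q2 using qinf_nz by simp
    finally show ?thesis by (rule mult_left_cancel[THEN iffD1, rotated]) simp
  qed
  then have "(wp 1 - wp (- 1)) * qinf ^ 3 * (H / (1 - q)) = qp (1 - int k + int a + int b) * Msum (k + 1) (int a + 1) (int b + 1)"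
    by (rule mult_left_cancel[THEN iffD1, rotated]) (use q_nz in simp)
  then show ?thesis
    unfolding Fcal_hterm[OF assms] H_def[symmetric] using wp_1_neq qinf_nz by (simp add: eq_divide_eq mult_ac)
qed

end

section \<open>Jacobi triple product and pentagonal numbers\<close>

lemma minus_one_powi_add: "(- 1 :: complex) powi (m + n) = (- 1) powi m * (- 1) powi n"
  by (simp add: power_int_add)

lemma has_sum_times:
  fixes f :: "'a \<Rightarrow> complex" and g :: "'b \<Rightarrow> complex"
  assumes "(f has_sum S) A" "(g has_sum T) B" "(\<lambda>x. norm (f x)) summable_on A" "(\<lambda>x. norm (g x)) summable_on B"
  shows "((\<lambda>(x, y). f x * g y) has_sum S * T) (A \<times> B)" "(\<lambda>x. norm (case x of (x, y) \<Rightarrow> f x * g y)) summable_on A \<times> B"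
proof -
  show *: "(\<lambda>x. norm (case x of (x, y) \<Rightarrow> f x * g y)) summable_on A \<times> B"
    using summable_on_times_real[OF assms(3,4)] by (simp add: split_def norm_mult)
  show "((\<lambda>(x, y). f x * g y) has_sum S * T) (A \<times> B)"
  proof (rule has_sum_SigmaI)
    show "((\<lambda>y. case (x, y) of (x, y) \<Rightarrow> f x * g y) has_sum f x * T) B" for x
      using has_sum_cmult_right[OF assms(2)] by simp
    show "((\<lambda>x. f x * T) has_sum S * T) A" by (rule has_sum_cmult_left[OF assms(1)])
    show "(\<lambda>(x, y). f x * g y) summable_on A \<times> B" by (rule abs_summable_summable[OF *])
  qed
qed

context nome
begin

definition theta_term :: "complex \<Rightarrow> int \<Rightarrow> complex" where
  "theta_term z m = (- 1) powi m * qp (tri m) * z powi m"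

lemma theta_term_summable:
  assumes "z \<noteq> 0"
  shows "(\<lambda>m. norm (theta_term z m)) summable_on UNIV"
proof -
  let ?r = "norm q"
  have r: "0 < ?r" "?r < 1" using norm_q q_nz by auto
  \<comment> \<open>With this c both |z| and 1/|z| are bounded by |q|^(-c).\<close>
  obtain c :: nat where c: "(1 / ?r) ^ c > max (norm z) (1 / norm z)"
    using real_arch_pow[of "1 / ?r" "max (norm z) (1 / norm z)"] r by auto
  \<comment> \<open>The constant left by the square of |m| - (c + 2) in the bound b below.\<close>
  let ?M = "int (c + 2) * int (c + 2)"
  have zb: "norm z powi m \<le> ?r powi (- int c * \<bar>m\<bar>)" for m
  proof -
    have e: "?r powi (- int c * \<bar>m\<bar>) = ((1 / ?r) ^ c) ^ nat \<bar>m\<bar>"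
    proof -
      have "?r powi (- int c * \<bar>m\<bar>) = (?r powi (- int c)) powi \<bar>m\<bar>" by (rule power_int_mult)
      also have "?r powi (- int c) = (1 / ?r) ^ c" by (simp add: power_int_minus power_one_over inverse_eq_divide)
      finally show ?thesis by (simp add: power_int_def)
    qed
    show ?thesis
    proof (cases "m \<ge> 0")
      case True
      then have "norm z powi m = norm z ^ nat \<bar>m\<bar>" by (simp add: power_int_def)
      also have "\<dots> \<le> ((1 / ?r) ^ c) ^ nat \<bar>m\<bar>" using c by (intro power_mono) auto
      finally show ?thesis unfolding e .
    next
      case False
      then have "norm z powi m = (1 / norm z) ^ nat \<bar>m\<bar>" by (simp add: power_int_def inverse_eq_divide)
      also have "\<dots> \<le> ((1 / ?r) ^ c) ^ nat \<bar>m\<bar>" using c by (intro power_mono) auto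
      finally show ?thesis unfolding e .
    qed
  qed
  have b: "tri m + - int c * \<bar>m\<bar> \<ge> \<bar>m\<bar> + - ?M" for m
  proof -
    have "(\<bar>m\<bar> - int (c + 2)) * (\<bar>m\<bar> - int (c + 2)) \<ge> 0" by simp
    moreover have "(\<bar>m\<bar> - int (c + 2)) * (\<bar>m\<bar> - int (c + 2)) = m * m - 2 * int c * \<bar>m\<bar> - 4 * \<bar>m\<bar> + ?M"
      by (simp add: algebra_simps abs_mult_self_eq)
    moreover have "2 * tri m = m * m - m" unfolding two_tri by (simp add: algebra_simps)
    moreover have "?M \<ge> 0" by simp
    moreover have "2 * (int c * \<bar>m\<bar>) = 2 * int c * \<bar>m\<bar>" by simp
    ultimately show ?thesis by linarith
  qed
  show ?thesis
  proof (rule Infinite_Sum.abs_summable_on_comparison_test')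
    show "(\<lambda>m. ?r powi (- ?M) * ?r ^ nat \<bar>m\<bar>) summable_on UNIV"
      by (intro summable_on_cmult_right summable_on_int_geometric) (use r in auto)
    fix m
    have "norm (theta_term z m) = ?r powi (tri m) * norm z powi m"
      unfolding theta_term_def norm_mult norm_qp norm_power_int by simp
    also have "\<dots> \<le> ?r powi (tri m) * ?r powi (- int c * \<bar>m\<bar>)"
      by (intro mult_left_mono zb) (use r in auto)
    also have "\<dots> = ?r powi (tri m + - int c * \<bar>m\<bar>)" by (rule power_int_add[symmetric]) (use r in simp)
    also have "\<dots> \<le> ?r powi (\<bar>m\<bar> + - ?M)" by (rule power_int_decreasing[OF b]) (use r in auto)
    also have "\<dots> = ?r powi (- ?M) * ?r ^ nat \<bar>m\<bar>"
      using r by (subst power_int_add) (auto simp: power_int_def)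
    finally show "norm (theta_term z m) \<le> ?r powi (- ?M) * ?r ^ nat \<bar>m\<bar>" .
  qed
qed

text \<open>The q-binomial theorem with 2 n factors at w = z q^(-n): the upper n factors give (z;
  q)_n, the lower n give (q/z; q)_n after multiplication by C. Summation is then centred at
  n.\<close>

lemma finite_triple_product:
  assumes z: "z \<noteq> 0"
  shows "((\<lambda>m. qpoch q q (2 * n) * (theta_term z m * (rq (int n + m) * rq (int n - m)))) has_sum qpoch z q n * qpoch (q / z) q n) UNIV"
proof -
  define w where "w = z * qp (- int n)"
  \<comment> \<open>The product of -q^j / z over j = 1, ..., n, which inverts the lower n factors
    one by one.\<close>
  define C where "C = (- 1) powi int n * qp (tri (int n + 1)) * z powi (- int n)"
  have split: "C * qpoch w q (2 * n) = qpoch z q n * qpoch (q / z) q n"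
  proof -
    have low: "qpoch w q n = (\<Prod>j<n. 1 - z * qp (- int (Suc j)))"
      unfolding qpoch_def
    proof (rule prod.reindex_bij_witness[of _ "\<lambda>j. n - Suc j" "\<lambda>j. n - Suc j"])
      fix j assume "j \<in> {..<n}"
      then have "- int n + int j = - int (Suc (n - Suc j))" by (auto simp: of_nat_diff)
      then have "qp (- int n) * q ^ j = qp (- int (Suc (n - Suc j)))"
        unfolding qp_nat[symmetric] qp_add[symmetric] by (rule arg_cong)
      then have "w * q ^ j = z * qp (- int (Suc (n - Suc j)))" unfolding w_def mult.assoc by (rule arg_cong)
      then show "1 - z * qp (- int (Suc (n - Suc j))) = 1 - w * q ^ j" by simp
    qed auto
    have c: "C * qpoch w q n = qpoch (q / z) q n"
      unfolding C_def low
    proof (induction n)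
      case 0
      then show ?case by (simp add: qpoch_def tri_def)
    next
      case (Suc n)
      have t: "tri (int (Suc n) + 1) = tri (int n + 1) + int (Suc n)" using tri_add1[of "int (Suc n)"] by (simp add: algebra_simps)
      have s: "(- 1 :: complex) powi int (Suc n) = - ((- 1) powi int n)" using minus_one_powi_add[of "int n" 1] by (simp add: add.commute)
      have zz: "z powi (- int (Suc n)) = z powi (- int n) / z"
        using power_int_add[of z "- int n" "- 1"] z by (simp add: power_int_minus field_simps)
      have f: "- qp (int (Suc n)) / z * (1 - z * qp (- int (Suc n))) = 1 - q / z * q ^ n"
      proof -
        have "qp (int (Suc n)) * qp (- int (Suc n)) = 1" by (simp flip: qp_add)
        moreover have "qp (int (Suc n)) = q * q ^ n" unfolding qp_nat by simp
        ultimately show ?thesis using z by (simp add: field_simps)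
      qed
      have "(- 1) powi int (Suc n) * qp (tri (int (Suc n) + 1)) * z powi (- int (Suc n)) * (\<Prod>j<Suc n. 1 - z * qp (- int (Suc j)))
        = ((- 1) powi int n * qp (tri (int n + 1)) * z powi (- int n) * (\<Prod>j<n. 1 - z * qp (- int (Suc j))))
          * (- qp (int (Suc n)) / z * (1 - z * qp (- int (Suc n))))"
        unfolding t s zz qp_add by (simp add: mult_ac)
      also have "\<dots> = qpoch (q / z) q (Suc n)" unfolding f Suc.IH qpoch_Suc ..
      finally show ?case .
    qed
    have d: "qpoch w q (2 * n) = qpoch w q n * qpoch z q n"
    proof -
      have "qpoch w q (n + n') = qpoch w q n * (\<Prod>j<n'. 1 - w * q ^ (n + j))" for n'
        by (induction n') (simp_all add: qpoch_def mult.assoc)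
      from this[of n]
      have "qpoch w q (n + n) = qpoch w q n * (\<Prod>j<n. 1 - w * q ^ (n + j))" .
      moreover have "w * q ^ (n + j) = z * q ^ j" for j
      proof -
        have "qp (- int n) * qp (int (n + j)) = qp (int j)" unfolding qp_add[symmetric] by simp
        then show ?thesis unfolding w_def qp_nat by (simp add: mult.assoc)
      qed
      ultimately show ?thesis by (simp add: qpoch_def mult_2)
    qed
    show ?thesis unfolding d mult.assoc[symmetric] c by (rule mult.commute)
  qed
  let ?f = "\<lambda>m. qpoch q q (2 * n) * (theta_term z m * (rq (int n + m) * rq (int n - m)))"
  have "(?f has_sum C * qpoch w q (2 * n)) UNIV"
  proof (rule has_sum_finite_neutralI)
    let ?g = "\<lambda>j. int j - int n"
    have inj: "inj_on ?g {..2 * n}" by (auto simp: inj_on_def)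
    show "finite (?g ` {..2 * n})" by simp
    show "?f m = 0" if "m \<in> UNIV - ?g ` {..2 * n}" for m
    proof -
      have "m < - int n \<or> m > int n"
      proof (rule ccontr)
        assume "\<not> (m < - int n \<or> m > int n)"
        then have "m = ?g (nat (m + int n))" "nat (m + int n) \<in> {..2 * n}" by auto
        then show False using that by blast
      qed
      then show ?thesis by (auto simp: rq_def)
    qed
    have "C * qpoch w q (2 * n) = (\<Sum>j\<le>2 * n. C * (qpoch q q (2 * n) * (rothe_coeff (2 * n) (int j) * w ^ j)))"
      unfolding q_binomial_theorem[of w] sum_distrib_left ..
    also have "\<dots> = (\<Sum>j\<le>2 * n. ?f (?g j))"
    proof (intro sum.cong refl)
      fix j
      have t: "2 * tri (int n + 1) + 2 * tri (int j) = 2 * (int n * int j) + 2 * tri (int j - int n)"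
        unfolding two_tri by (simp add: algebra_simps)
      have wj: "w ^ j = z powi int j * qp (- int n * int j)"
      proof -
        have "qp (- int n) ^ j = qp (- int n * int j)" unfolding qp_def by (simp only: power_int_mult power_int_of_nat)
        then show ?thesis unfolding w_def power_mult_distrib by simp
      qed
      have p: "qp (tri (int n + 1)) * qp (tri (int j)) * qp (- int n * int j) = qp (tri (int j - int n))"
        unfolding qp_add[symmetric] by (rule arg_cong[of _ _ qp]) (use t in simp)
      have s: "(- 1 :: complex) powi int n * (- 1) powi int j = (- 1) powi (int j - int n)"
      proof -
        have "(- 1 :: complex) powi (int j - int n) * (- 1) powi (2 * int n) = (- 1) powi int n * (- 1) powi int j"
          unfolding minus_one_powi_add[symmetric] by (rule arg_cong[of _ _ "\<lambda>x. (- 1) powi x"]) simp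
        then show ?thesis by (simp add: power_int_mult)
      qed
      have zz: "z powi (- int n) * z powi int j = z powi (int j - int n)"
        using power_int_add[of z "- int n" "int j"] z by simp
      have "C * (qpoch q q (2 * n) * (rothe_coeff (2 * n) (int j) * w ^ j))
        = qpoch q q (2 * n) * (((- 1) powi int n * (- 1) powi int j) * (qp (tri (int n + 1)) * qp (tri (int j)) * qp (- int n * int j))
           * (z powi (- int n) * z powi int j) * (rq (int j) * rq (int (2 * n) - int j)))"
        unfolding C_def rothe_coeff_def wj by (simp only: mult_ac)
      also have "\<dots> = ?f (?g j)"
        unfolding s p zz theta_term_def by (simp add: algebra_simps)
      finally show "C * (qpoch q q (2 * n) * (rothe_coeff (2 * n) (int j) * w ^ j)) = ?f (?g j)" .
    qed
    also have "\<dots> = (\<Sum>x\<in>?g ` {..2 * n}. ?f x)"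
      by (subst sum.reindex[OF inj]) simp
    finally show "C * qpoch w q (2 * n) = (\<Sum>x\<in>?g ` {..2 * n}. ?f x)" .
  qed simp
  then show ?thesis unfolding split .
qed

lemma jacobi_triple_product:
  assumes z: "z \<noteq> 0"
  shows "(theta_term z has_sum qinf * qtheta z q) UNIV"
proof -
  obtain B where B: "B \<ge> 1" "\<And>n. norm (rq n) \<le> B" "\<And>n. norm (qpoch q q n) \<le> B" using rq_bounded by metis
  have "(\<lambda>n. qpoch z q n * qpoch (q / z) q n) \<longlonglongrightarrow> infsum (\<lambda>m. theta_term z m / qinf) UNIV"
  proof (rule tannery_has_sum(1)[OF finite_triple_product[OF z]])
    fix m
    have "filterlim (\<lambda>n :: nat. 2 * n) at_top sequentially"
      by (rule filterlim_at_top_mono[OF filterlim_ident]) (auto intro: always_eventually)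
    then have p: "(\<lambda>n. qpoch q q (2 * n)) \<longlonglongrightarrow> qinf"
      by (rule filterlim_compose[OF qpoch_q_tendsto])
    have "(\<lambda>n. qpoch q q (2 * n) * (theta_term z m * (rq (int n + m) * rq (int n - m)))) \<longlonglongrightarrow> qinf * (theta_term z m * (1 / qinf * (1 / qinf)))"
      using rq_shift_tendsto[of m] rq_shift_tendsto[of "- m"] by (intro tendsto_intros p) simp_all
    then show "(\<lambda>n. qpoch q q (2 * n) * (theta_term z m * (rq (int n + m) * rq (int n - m)))) \<longlonglongrightarrow> theta_term z m / qinf"
      using qinf_nz by simp
    show "norm (qpoch q q (2 * n) * (theta_term z m * (rq (int n + m) * rq (int n - m)))) \<le> B * B * B * norm (theta_term z m)" for n
    proof -
      have "norm (qpoch q q (2 * n) * (theta_term z m * (rq (int n + m) * rq (int n - m)))) \<le> B * (norm (theta_term z m) * (B * B))"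
        unfolding norm_mult using B by (intro mult_mono) auto
      then show ?thesis by (simp add: mult_ac)
    qed
    show "(\<lambda>m. B * B * B * norm (theta_term z m)) summable_on UNIV"
      by (intro summable_on_cmult_right theta_term_summable z)
  qed
  moreover have "(\<lambda>n. qpoch z q n * qpoch (q / z) q n) \<longlonglongrightarrow> qtheta z q"
    unfolding qtheta_def by (intro tendsto_mult qpoch_tendsto norm_q)
  ultimately have "qtheta z q = infsum (\<lambda>m. theta_term z m / qinf) UNIV" using LIMSEQ_unique by blast
  also have "\<dots> = infsum (theta_term z) UNIV / qinf"
    using infsum_cmult_left'[of "theta_term z" "1 / qinf" UNIV] by simp
  finally have "infsum (theta_term z) UNIV = qinf * qtheta z q" using qinf_nz by simp
  moreover have "theta_term z summable_on UNIV" by (rule abs_summable_summable[OF theta_term_summable[OF z]])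
  ultimately show ?thesis by (simp add: has_sum_iff)
qed

section \<open>Pentagonal numbers\<close>

lemma qinf_trisection: "qinf = qpoch_inf (q ^ 3) (q ^ 3) * (qpoch_inf q (q ^ 3) * qpoch_inf (q ^ 3 / q) (q ^ 3))"
proof -
  have q3: "norm (q ^ 3) < 1" using norm_q by (simp add: norm_power power_less_one_iff)
  have qq: "q ^ 3 / q = q\<^sup>2" using q_nz by (simp add: power3_eq_cube power2_eq_square)
  have "qpoch q q (3 * n) = qpoch (q ^ 3) (q ^ 3) n * (qpoch q (q ^ 3) n * qpoch (q\<^sup>2) (q ^ 3) n)" for n
  proof (induction n)
    case 0
    then show ?case by (simp add: qpoch_def)
  next
    case (Suc n)
    have "3 * Suc n = Suc (Suc (Suc (3 * n)))" by simp
    then have "qpoch q q (3 * Suc n) = qpoch q q (3 * n) * (1 - q * q ^ (3 * n)) * (1 - q * q ^ Suc (3 * n)) * (1 - q * q ^ Suc (Suc (3 * n)))"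
      by (simp only: qpoch_Suc)
    also have "\<dots> = qpoch (q ^ 3) (q ^ 3) (Suc n) * (qpoch q (q ^ 3) (Suc n) * qpoch (q\<^sup>2) (q ^ 3) (Suc n))"
    proof -
      have "(q ^ 3) ^ n = q ^ (3 * n)" by (simp add: power_mult)
      then show ?thesis unfolding Suc.IH
        by (simp only: qpoch_Suc power2_eq_square power3_eq_cube power_Suc mult_ac)
    qed
    finally show ?case .
  qed
  moreover have "filterlim (\<lambda>n :: nat. 3 * n) at_top sequentially"
    by (rule filterlim_at_top_mono[OF filterlim_ident]) (auto intro: always_eventually)
  then have "(\<lambda>n. qpoch q q (3 * n)) \<longlonglongrightarrow> qinf"
    by (rule filterlim_compose[OF qpoch_q_tendsto])
  ultimately have "(\<lambda>n. qpoch (q ^ 3) (q ^ 3) n * (qpoch q (q ^ 3) n * qpoch (q\<^sup>2) (q ^ 3) n)) \<longlonglongrightarrow> qinf" by simp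
  moreover have "(\<lambda>n. qpoch (q ^ 3) (q ^ 3) n * (qpoch q (q ^ 3) n * qpoch (q\<^sup>2) (q ^ 3) n))
      \<longlonglongrightarrow> qpoch_inf (q ^ 3) (q ^ 3) * (qpoch_inf q (q ^ 3) * qpoch_inf (q\<^sup>2) (q ^ 3))"
    by (intro tendsto_mult qpoch_tendsto q3)
  ultimately show ?thesis unfolding qq using LIMSEQ_unique by blast
qed

lemma qp_cube: "nome.qp (q ^ 3) n = qp (3 * n)"
proof -
  interpret c: nome "q ^ 3" by (rule nome_power) simp
  show ?thesis unfolding c.qp_def qp_def power_int_mult by simp
qed

text \<open>The triple product in base q^3 at z = q, whose product side is (q; q)_\<infinity> sorted
  by residues modulo 3. The exponent is j (3 j - 1) / 2.\<close>

lemma pentagonal: "((\<lambda>j. (- 1) powi j * qp (3 * tri j + j)) has_sum qinf) UNIV"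
proof -
  interpret c: nome "q ^ 3" by (rule nome_power) simp
  have "(c.theta_term q has_sum c.qinf * qtheta q (q ^ 3)) UNIV"
    by (rule c.jacobi_triple_product[OF q_nz])
  then show ?thesis
    unfolding qinf_trisection
    by (rule has_sum_eqI) (simp_all add: c.theta_term_def qp_cube c.qinf_def qtheta_def qp_add, simp add: qp_def)
qed

end

section \<open>The Macdonald identity and the theorem\<close>

lemma minus_one_powi_cong: "m = n + 2 * k \<Longrightarrow> (- 1 :: complex) powi m = (- 1) powi n"
  by (simp add: minus_one_powi_add power_int_mult)

context nome
begin

text \<open>Completing the square in l leaves a dependence on M + N modulo 3. Residues 0 and 1 give
  the pentagonal series in base q^3 with opposite signs, residue 2 gives 0; the quotient of
  characters takes the values 1, -1, 0 accordingly.\<close>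

lemma macdonald_inner:
  defines "D \<equiv> \<lambda>M N l. tri (M - l) + tri (N - l) + tri l"
  assumes sm: "(\<lambda>l. (- 1) powi (M + N + l) * qp (3 * D M N l)) summable_on UNIV"
  shows "((\<lambda>l. (- 1) powi (M + N + l) * qp (3 * D M N l)) has_sum
     (wp (M + N + 1) - wp (- M - N - 1)) / (wp 1 - wp (- 1)) * qp (M * M + N * N - M * N - M - N) * nome.qinf (q ^ 3)) UNIV"
    (is "(?f has_sum _) UNIV")
proof -
  interpret c: nome "q ^ 3" by (rule nome_power) simp
  let ?E = "M * M + N * N - M * N - M - N"
  define t where "t = (M + N) div 3"
  have D2: "2 * D M N l = 3 * (l * l) - (2 * (M + N) - 1) * l + M * M + N * N - M - N" for l
    unfolding D_def distrib_left two_tri by (simp add: algebra_simps)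
  have pent: "((\<lambda>j. qp ?E * ((- 1) powi j * c.qp (3 * tri j + j))) has_sum qp ?E * c.qinf) UNIV"
    by (rule has_sum_cmult_right[OF c.pentagonal])
  have p2: "2 * (3 * tri j + j) = 3 * (j * j) - j" for j
    using two_tri[of j] by (simp add: algebra_simps)
  consider "M + N = 3 * t" | "M + N = 3 * t + 1" | "M + N = 3 * t + 2"
    unfolding t_def by linarith
  then show ?thesis
  proof cases
    case 1
    then have N: "N = 3 * t - M" by simp
    have e: "3 * D M N (t - j) = ?E + 3 * (3 * tri j + j)" for j
    proof -
      have "2 * (3 * D M N (t - j)) = 2 * (?E + 3 * (3 * tri j + j))"
        using D2[of "t - j"] p2[of j] unfolding N by (simp add: algebra_simps)
      then show ?thesis by simp
    qed
    have "(?f has_sum qp ?E * c.qinf) UNIV"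
    proof (subst has_sum_reindex_bij_witness[where T = UNIV and i = "\<lambda>j. t - j" and j = "\<lambda>l. t - l"
          and h = "\<lambda>j. qp ?E * ((- 1) powi j * c.qp (3 * tri j + j))" and s' = "qp ?E * c.qinf"])
      fix l
      have "3 * D M N l = ?E + 3 * (3 * tri (t - l) + (t - l))" using e[of "t - l"] by simp
      moreover have "(- 1 :: complex) powi (M + N + l) = (- 1) powi (t - l)"
        by (rule minus_one_powi_cong[of _ _ "t + l"]) (simp add: 1)
      ultimately show "qp ?E * ((- 1) powi (t - l) * c.qp (3 * tri (t - l) + (t - l))) = ?f l"
        unfolding qp_cube by (simp add: qp_add mult_ac)
    qed (use pent in auto)
    moreover have "wp (M + N + 1) - wp (- M - N - 1) = wp 1 - wp (- 1)"
      using wp_cong[of "M + N + 1" 1 t] wp_cong[of "- M - N - 1" "- 1" "- t"] 1 by simp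
    ultimately show ?thesis using wp_1_neq by simp
  next
    case 2
    then have N: "N = 3 * t + 1 - M" by simp
    have e: "3 * D M N (t + j) = ?E + 3 * (3 * tri j + j)" for j
    proof -
      have "2 * (3 * D M N (t + j)) = 2 * (?E + 3 * (3 * tri j + j))"
        using D2[of "t + j"] p2[of j] unfolding N by (simp add: algebra_simps)
      then show ?thesis by simp
    qed
    have "((\<lambda>l. - ?f l) has_sum qp ?E * c.qinf) UNIV"
    proof (subst has_sum_reindex_bij_witness[where T = UNIV and i = "\<lambda>j. t + j" and j = "\<lambda>l. l - t"
          and h = "\<lambda>j. qp ?E * ((- 1) powi j * c.qp (3 * tri j + j))" and s' = "qp ?E * c.qinf"])
      fix l
      have "3 * D M N l = ?E + 3 * (3 * tri (l - t) + (l - t))" using e[of "l - t"] by simp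
      moreover have "(- 1 :: complex) powi (M + N + l) = (- 1) powi (l - t + 1)"
        by (rule minus_one_powi_cong[of _ _ "2 * t"]) (simp add: 2)
      ultimately show "qp ?E * ((- 1) powi (l - t) * c.qp (3 * tri (l - t) + (l - t))) = - ?f l"
        unfolding qp_cube minus_one_powi_add[of "l - t" 1] by (simp add: qp_add mult_ac)
    qed (use pent in auto)
    from has_sum_uminusI[OF this] have F: "(?f has_sum - (qp ?E * c.qinf)) UNIV" by simp
    have E: "wp (M + N + 1) - wp (- M - N - 1) = - (wp 1 - wp (- 1))"
      using wp_cong[of "M + N + 1" "- 1" "t + 1"] wp_cong[of "- M - N - 1" 1 "- t - 1"] 2 by simp
    have "- w / w = - 1" if "w \<noteq> 0" for w :: complex
      using that by simp
    from this[OF wp_1_neq] show ?thesis unfolding E using F by simp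
  next
    \<comment> \<open>The reflection l -> 2 t + 1 - l fixes the exponent and flips the sign, so the
      sum S, which exists by summability, equals -S.\<close>
    case 3
    obtain S where S: "(?f has_sum S) UNIV" using sm by (auto simp: summable_on_def)
    have N: "N = 3 * t + 2 - M" using 3 by simp
    have e: "D M N (2 * t + 1 - l) = D M N l" for l
    proof -
      have "2 * D M N (2 * t + 1 - l) = 2 * D M N l" unfolding D2 unfolding N by (simp add: algebra_simps)
      then show ?thesis by simp
    qed
    have "((\<lambda>l. - ?f l) has_sum S) UNIV"
    proof (subst has_sum_reindex_bij_witness[where T = UNIV and i = "\<lambda>l. 2 * t + 1 - l" and j = "\<lambda>l. 2 * t + 1 - l"
          and h = ?f and s' = S])
      fix l
      have "(- 1 :: complex) powi (M + N + (2 * t + 1 - l)) = (- 1) powi (M + N + l + 1)"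
        by (rule minus_one_powi_cong[of _ _ "t - l"]) simp
      then show "?f (2 * t + 1 - l) = - ?f l"
        unfolding e minus_one_powi_add[of "M + N + l" 1] by simp
    qed (use S in auto)
    from has_sum_uminusI[OF this] have "(?f has_sum - S) UNIV" by simp
    from has_sum_unique[OF S this] have "S = 0" by simp
    moreover have "wp (M + N + 1) - wp (- M - N - 1) = 0"
      using wp_cong[of "M + N + 1" 0 "t + 1"] wp_cong[of "- M - N - 1" 0 "- t - 1"] 3 by simp
    ultimately show ?thesis using S by simp
  qed
qed

text \<open>In the product of the theta series of x, y and x y, the substitution M = m + l, N = n +
  l collects the monomials x^M y^N. The remaining sum over l is \<open>macdonald_inner\<close>,
  which contributes one of the three Euler products; two are left.\<close>

lemma macdonald_A2:
  assumes x: "x \<noteq> 0" and y: "y \<noteq> 0"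
  shows "((\<lambda>(M, N). (wp (M + N + 1) - wp (- M - N - 1)) * qp (M * M + N * N - M * N - M - N) * (x powi M * y powi N))
     has_sum (wp 1 - wp (- 1)) * ((qpoch_inf (q ^ 3) (q ^ 3))\<^sup>2 * (qtheta x (q ^ 3) * qtheta y (q ^ 3) * qtheta (x * y) (q ^ 3)))) UNIV"
proof -
  interpret c: nome "q ^ 3" by (rule nome_power) simp
  let ?T = "qtheta x (q ^ 3) * qtheta y (q ^ 3) * qtheta (x * y) (q ^ 3)"
  have xy: "x * y \<noteq> 0" using x y by simp
  note J = c.jacobi_triple_product and A = c.theta_term_summable
  note 1 = has_sum_times[OF J[OF x] J[OF y] A[OF x] A[OF y]]
  note 2 = has_sum_times[OF 1(1) J[OF xy] 1(2) A[OF xy]]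
  define G where "G = (\<lambda>((M, N), l). (x powi M * y powi N) * ((- 1) powi (M + N + l) * qp (3 * (tri (M - l) + tri (N - l) + tri l))))"
  have G: "(G has_sum c.qinf ^ 3 * ?T) (UNIV \<times> UNIV)"
  proof (subst has_sum_reindex_bij_witness[where T = "(UNIV \<times> UNIV) \<times> UNIV" and i = "\<lambda>((m, n), l). ((m + l, n + l), l)"
        and j = "\<lambda>((M, N), l). ((M - l, N - l), l)"
        and h = "\<lambda>(p, l). (case p of (m, n) \<Rightarrow> c.theta_term x m * c.theta_term y n) * c.theta_term (x * y) l"
        and s' = "c.qinf * qtheta x (q ^ 3) * (c.qinf * qtheta y (q ^ 3)) * (c.qinf * qtheta (x * y) (q ^ 3))"])
    fix w :: "(int \<times> int) \<times> int"
    obtain M N l where w: "w = ((M, N), l)" by (cases w) auto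
    have s: "(- 1 :: complex) powi (M - l) * (- 1) powi (N - l) * (- 1) powi l = (- 1) powi (M + N + l)"
      unfolding minus_one_powi_add[symmetric] by (rule minus_one_powi_cong[of _ _ "- l"]) simp
    have p: "c.qp (tri (M - l)) * c.qp (tri (N - l)) * c.qp (tri l) = qp (3 * (tri (M - l) + tri (N - l) + tri l))"
      unfolding qp_cube qp_add[symmetric] by (simp add: algebra_simps)
    have z: "x powi (M - l) * y powi (N - l) * (x * y) powi l = x powi M * y powi N"
    proof -
      have "x powi M = x powi (M - l) * x powi l" "y powi N = y powi (N - l) * y powi l"
        using x y power_int_add[of x "M - l" l] power_int_add[of y "N - l" l] by simp_all
      then show ?thesis by (simp add: power_int_mult_distrib mult_ac)
    qed
    have "c.theta_term x (M - l) * c.theta_term y (N - l) * c.theta_term (x * y) l =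
       (x powi (M - l) * y powi (N - l) * (x * y) powi l) *
       ((- 1) powi (M - l) * (- 1) powi (N - l) * (- 1) powi l * (c.qp (tri (M - l)) * c.qp (tri (N - l)) * c.qp (tri l)))"
      unfolding c.theta_term_def by (simp only: mult_ac)
    also have "\<dots> = G w" unfolding z s p G_def w prod.case ..
    finally show "(case case w of (x, xa) \<Rightarrow> (case x of (M, N) \<Rightarrow> \<lambda>l. ((M - l, N - l), l)) xa of
          (p, l) \<Rightarrow> (case p of (m, n) \<Rightarrow> c.theta_term x m * c.theta_term y n) * c.theta_term (x * y) l) = G w"
      unfolding w prod.case .
  qed (use 2(1) in \<open>auto simp: power3_eq_cube mult_ac\<close>)
  define X where "X = (\<lambda>(M, N). (wp (M + N + 1) - wp (- M - N - 1)) * qp (M * M + N * N - M * N - M - N) * (x powi M * y powi N))"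
  have "((\<lambda>p. X p / (wp 1 - wp (- 1)) * c.qinf) has_sum c.qinf ^ 3 * ?T) UNIV"
  proof (rule has_sum_SigmaD[OF G])
    fix p :: "int \<times> int"
    obtain M N where p: "p = (M, N)" by force
    have xy0: "x powi M * y powi N \<noteq> 0" using x y by simp
    have "(\<lambda>l. G (p, l)) summable_on UNIV"
      using summable_on_SigmaD1[of "\<lambda>a b. G (a, b)" UNIV "\<lambda>_. UNIV" p] has_sum_imp_summable[OF G] by simp
    then have "(\<lambda>l. inverse (x powi M * y powi N) * G (p, l)) summable_on UNIV" by (rule summable_on_cmult_right)
    moreover have "inverse c * (c * d) = d" if "c \<noteq> 0" for c d :: complex
      using that by simp
    note this[OF xy0]
    ultimately have "(\<lambda>l. (- 1) powi (M + N + l) * qp (3 * (tri (M - l) + tri (N - l) + tri l))) summable_on UNIV"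
      unfolding p G_def prod.case by (simp only:)
    from has_sum_cmult_right[OF macdonald_inner[OF this], of "x powi M * y powi N"]
    show "((\<lambda>l. G (p, l)) has_sum X p / (wp 1 - wp (- 1)) * c.qinf) UNIV"
      unfolding p G_def X_def prod.case by (simp add: mult_ac)
  qed
  from has_sum_cmult_right[OF this, of "(wp 1 - wp (- 1)) / c.qinf"]
  have "(X has_sum (wp 1 - wp (- 1)) * (c.qinf\<^sup>2 * ?T)) UNIV"
    by (rule has_sum_eqI) (use c.qinf_nz wp_1_neq in \<open>simp_all add: power3_eq_cube power2_eq_square\<close>)
  then show ?thesis unfolding X_def c.qinf_def .
qed

text \<open>The form M^2 + N^2 - M N - M - N has its centre at M = N = 1. Recentring there with the
  second coordinate reversed gives \<open>hexn\<close> - 1, in base q^n with x = q^A and y =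
  q^B.\<close>

lemma Msum_product:
  assumes n: "n > 0" and A: "A = int A'" and B: "B = int B'"
  shows "qp (A + B - int n) * Msum n A B = (wp 1 - wp (- 1)) * ((qpoch_inf (q ^ (3 * n)) (q ^ (3 * n)))\<^sup>2
     * (qtheta (q ^ A') (q ^ (3 * n)) * qtheta (q ^ B') (q ^ (3 * n)) * qtheta (q ^ (A' + B')) (q ^ (3 * n))))"
proof -
  interpret d: nome "q ^ n" by (rule nome_power[OF n])
  have P: "(q ^ n) ^ 3 = q ^ (3 * n)" by (simp add: mult.commute flip: power_mult)
  have dq: "d.qp e = qp (int n * e)" for e unfolding d.qp_def qp_def power_int_mult by simp
  have pw: "(q ^ j) powi e = qp (int j * e)" for j e unfolding qp_def power_int_mult by simp
  have "((\<lambda>(u, v). qp (A + B - int n) * ((wp (u - v) - wp (v - u)) * qp (int n * hexn u v + A * u - B * v)))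
    has_sum (wp 1 - wp (- 1)) * ((qpoch_inf (q ^ (3 * n)) (q ^ (3 * n)))\<^sup>2
     * (qtheta (q ^ A') (q ^ (3 * n)) * qtheta (q ^ B') (q ^ (3 * n)) * qtheta (q ^ (A' + B')) (q ^ (3 * n))))) UNIV"
    (is "(?g has_sum ?s) UNIV")
  proof (subst has_sum_reindex_bij_witness[where T = UNIV and j = "\<lambda>(u, v). (u + 1, 1 - v)" and i = "\<lambda>(M, N). (M - 1, 1 - N)"
        and h = "\<lambda>(M, N). (wp (M + N + 1) - wp (- M - N - 1)) * d.qp (M * M + N * N - M * N - M - N) * ((q ^ A') powi M * (q ^ B') powi N)"
        and s' = ?s])
    show "((\<lambda>(M, N). (wp (M + N + 1) - wp (- M - N - 1)) * d.qp (M * M + N * N - M * N - M - N) * ((q ^ A') powi M * (q ^ B') powi N)) has_sum ?s) UNIV"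
      using d.macdonald_A2[of "q ^ A'" "q ^ B'"] q_nz unfolding P by (simp add: power_add)
    fix p :: "int \<times> int"
    obtain u v where p: "p = (u, v)" by force
    have w: "wp (u + 1 + (1 - v) + 1) = wp (u - v)" "wp (- (u + 1) - (1 - v) - 1) = wp (v - u)"
      by (rule wp_cong[of _ _ 1], simp) (rule wp_cong[of _ _ "- 1"], simp)
    have e: "d.qp ((u + 1) * (u + 1) + (1 - v) * (1 - v) - (u + 1) * (1 - v) - (u + 1) - (1 - v)) * ((q ^ A') powi (u + 1) * (q ^ B') powi (1 - v))
       = qp (A + B - int n) * qp (int n * hexn u v + A * u - B * v)"
      unfolding dq pw qp_add[symmetric] A B hexn_def by (rule arg_cong[of _ _ qp]) (simp add: algebra_simps)
    show "(case case p of (u, v) \<Rightarrow> (u + 1, 1 - v) of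
      (M, N) \<Rightarrow> (wp (M + N + 1) - wp (- M - N - 1)) * d.qp (M * M + N * N - M * N - M - N) * ((q ^ A') powi M * (q ^ B') powi N)) = ?g p"
      unfolding p prod.case w mult.assoc[of "wp (u - v) - wp (v - u)"] e by (simp only: mult_ac)
  qed auto
  then have "infsum ?g UNIV = ?s" by (rule infsumI)
  moreover have "infsum ?g UNIV = qp (A + B - int n) * Msum n A B"
    unfolding Msum_def infsum_cmult_right'[symmetric] by (simp add: split_def)
  ultimately show ?thesis by simp
qed

text \<open>The character X is odd, has period 3, and its values at f, f + 1 and f - 1 add up to
  zero. So the shifted sums S 0, S 1, S (-1) add up to zero, and an affine substitution identifies
  each \<open>Msum\<close> with one of them up to a factor.\<close>

lemma Msum_three_term:
  assumes n: "n > 0"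
  shows "qp B * Msum n (2 * int n - A) (A + B - int n) - Msum n (2 * int n - A - B) (A - int n) = qp (A + B - int n) * Msum n A B"
proof -
  define X where "X f = wp f - wp (- f)" for f
  define Z where "Z u v = qp (int n * hexn u v + A * u - B * v)" for u v
  have X3: "X (f + 3 * j) = X f" for f j
    unfolding X_def using wp_cong[of "f + 3 * j" f j] wp_cong[of "- (f + 3 * j)" "- f" "- j"] by simp
  have Xm: "X (- f) = - X f" for f by (simp add: X_def)
  have sumX: "X f + X (f + 1) + X (f - 1) = 0" for f
  proof -
    have "- (f + 1) = - f - 1" "- (f - 1) = - f + 1" by simp_all
    then show ?thesis unfolding X_def using wp_three_term[of f] wp_three_term[of "- f"] by algebra
  qed
  have Zs: "(\<lambda>x. norm (case x of (u, v) \<Rightarrow> Z u v)) summable_on UNIV"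
    using qp_hexn_summable[of "int n" A "- B" 0] n by (simp add: Z_def split_def)
  have "(\<lambda>x. norm (case x of (u, v) \<Rightarrow> X (u - v + j) * Z u v)) summable_on UNIV" for j
  proof (rule Infinite_Sum.abs_summable_on_comparison_test'[OF summable_on_cmult_right[OF Zs, of 2]])
    fix x :: "int \<times> int"
    have "norm (X f) \<le> 2" for f
      unfolding X_def using norm_triangle_ineq4[of "wp f" "wp (- f)"] by (simp add: wp_abs)
    then show "norm (case x of (u, v) \<Rightarrow> X (u - v + j) * Z u v) \<le> 2 * norm (case x of (u, v) \<Rightarrow> Z u v)"
      by (auto simp: split_def norm_mult intro!: mult_right_mono)
  qed
  then have "(\<lambda>(u, v). X (u - v + j) * Z u v) summable_on UNIV" for j
    by (rule abs_summable_summable)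
  define S where "S j = infsum (\<lambda>(u, v). X (u - v + j) * Z u v) UNIV" for j
  have S: "((\<lambda>(u, v). X (u - v + j) * Z u v) has_sum S j) UNIV" for j
    unfolding S_def by (rule has_sum_infsum) fact
  have "((\<lambda>x. (case x of (u, v) \<Rightarrow> X (u - v + 0) * Z u v) + (case x of (u, v) \<Rightarrow> X (u - v + 1) * Z u v)
     + (case x of (u, v) \<Rightarrow> X (u - v + (- 1)) * Z u v)) has_sum S 0 + S 1 + S (- 1)) UNIV"
    by (intro has_sum_add S)
  then have H: "((\<lambda>_. 0) has_sum S 0 + S 1 + S (- 1)) (UNIV :: (int \<times> int) set)"
  proof (rule has_sum_eqI)
    fix x :: "int \<times> int"
    show "(case x of (u, v) \<Rightarrow> X (u - v + 0) * Z u v) + (case x of (u, v) \<Rightarrow> X (u - v + 1) * Z u v)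
     + (case x of (u, v) \<Rightarrow> X (u - v + (- 1)) * Z u v) = 0"
      using sumX[of "fst x - snd x"] by (simp add: split_def flip: distrib_right)
  qed simp
  have s0: "S 0 + S 1 + S (- 1) = 0"
    by (rule has_sum_unique[OF H has_sum_0_simp])
  have M0: "Msum n A B = S 0"
    unfolding Msum_def by (rule infsumI, rule has_sum_eqI[OF S]) (auto simp: X_def Z_def)
  \<comment> \<open>The linear part of the substitution exchanges u and -u - v. It is an odd
    permutation, hence the minus sign.\<close>
  have M1: "Msum n (2 * int n - A) (A + B - int n) = - qp (A - int n) * S 1"
    unfolding Msum_def
  proof (rule infsumI, subst has_sum_reindex_bij_witness[where T = UNIV and j = "\<lambda>(u, v). (- u - 1 - v, v)" and i = "\<lambda>(u, v). (- u - v - 1, v)"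
        and h = "\<lambda>x. - qp (A - int n) * (case x of (u, v) \<Rightarrow> X (u - v + 1) * Z u v)" and s' = "- qp (A - int n) * S 1"])
    show "((\<lambda>x. - qp (A - int n) * (case x of (u, v) \<Rightarrow> X (u - v + 1) * Z u v)) has_sum - qp (A - int n) * S 1) UNIV"
      by (rule has_sum_cmult_right[OF S])
    fix x :: "int \<times> int"
    obtain u v where x: "x = (u, v)" by force
    have x1: "X (- u - 1 - v - v + 1) = - X (u - v)"
      using X3[of "- u + v" "- v"] Xm[of "u - v"] by (simp add: algebra_simps)
    have x2: "qp (A - int n) * Z (- u - 1 - v) v = qp (int n * hexn u v + (2 * int n - A) * u - (A + B - int n) * v)"
      unfolding Z_def qp_add[symmetric] hexn_def by (rule arg_cong[of _ _ qp]) (simp add: algebra_simps)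
    have x3: "wp (u - v) - wp (v - u) = X (u - v)" by (simp add: X_def)
    show "- qp (A - int n) * (case case x of (u, v) \<Rightarrow> (- u - 1 - v, v) of (u, v) \<Rightarrow> X (u - v + 1) * Z u v)
       = (case x of (u, v) \<Rightarrow> (wp (u - v) - wp (v - u)) * qp (int n * hexn u v + (2 * int n - A) * u - (A + B - int n) * v))"
      unfolding x prod.case x1 x3 x2[symmetric] by simp
  qed auto
  \<comment> \<open>The linear part is now a rotation, so no sign appears.\<close>
  have M2: "Msum n (2 * int n - A - B) (A - int n) = qp (A + B - int n) * S (- 1)"
    unfolding Msum_def
  proof (rule infsumI, subst has_sum_reindex_bij_witness[where T = UNIV and j = "\<lambda>(u, v). (- u - 1 - v, u + 1)" and i = "\<lambda>(u, v). (v - 1, - u - v)"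
        and h = "\<lambda>x. qp (A + B - int n) * (case x of (u, v) \<Rightarrow> X (u - v + (- 1)) * Z u v)" and s' = "qp (A + B - int n) * S (- 1)"])
    show "((\<lambda>x. qp (A + B - int n) * (case x of (u, v) \<Rightarrow> X (u - v + (- 1)) * Z u v)) has_sum qp (A + B - int n) * S (- 1)) UNIV"
      by (rule has_sum_cmult_right[OF S])
    fix x :: "int \<times> int"
    obtain u v where x: "x = (u, v)" by force
    have "X (- u - 1 - v - (u + 1) + (- 1)) = X (u - v)"
      using X3[of "u - v" "- u - 1"] by (simp add: algebra_simps)
    moreover have "qp (A + B - int n) * Z (- u - 1 - v) (u + 1) = qp (int n * hexn u v + (2 * int n - A - B) * u - (A - int n) * v)"
      unfolding Z_def qp_add[symmetric] hexn_def by (rule arg_cong[of _ _ qp]) (simp add: algebra_simps)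
    ultimately show "qp (A + B - int n) * (case case x of (u, v) \<Rightarrow> (- u - 1 - v, u + 1) of (u, v) \<Rightarrow> X (u - v + (- 1)) * Z u v)
       = (case x of (u, v) \<Rightarrow> (wp (u - v) - wp (v - u)) * qp (int n * hexn u v + (2 * int n - A - B) * u - (A - int n) * v))"
      unfolding x prod.case by (simp add: X_def)
  qed auto
  have "qp B * qp (A - int n) = qp (A + B - int n)"
    by (simp add: algebra_simps flip: qp_add)
  then have "qp B * (- qp (A - int n) * S 1) = - qp (A + B - int n) * S 1" by simp
  then have "qp B * (- qp (A - int n) * S 1) - qp (A + B - int n) * S (- 1) = qp (A + B - int n) * (- S 1 - S (- 1))"
    by (simp add: algebra_simps)
  also have "- S 1 - S (- 1) = S 0" using s0 by algebra
  finally show ?thesis unfolding M0 M1 M2 .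
qed

end

text \<open>At q = 0 only the pair of empty partitions contributes, since n^2 - n m + m^2 is
  positive definite.\<close>

lemma Fcal_at_zero:
  assumes "k > 0"
  shows "Fcal a b k 0 = 1"
proof -
  have pz: "qpoch 0 0 n = 1" for n by (simp add: qpoch_def)
  have g: "g0 0 0 0 = 1" by (simp add: g0_def qbinom_def qpoch_def)
  have z: "Fterm a b k 0 (l, m) = 0" if "i \<in> {1..k}" "l i > 0 \<or> m i > 0" for l m i
  proof -
    have "l i * m i < (l i)^2 + (m i)^2"
    proof (cases "l i \<le> m i")
      case True
      then have "l i * m i \<le> (m i)^2" by (simp add: power2_eq_square)
      moreover have "(l i)^2 > 0 \<or> l i * m i < (m i)^2" using that True by (auto simp: power2_eq_square)
      ultimately show ?thesis by linarith
    next
      case False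
      then have "l i * m i \<le> (l i)^2" by (simp add: power2_eq_square)
      moreover have "(m i)^2 > 0 \<or> l i * m i < (l i)^2" using that False by (auto simp: power2_eq_square)
      ultimately show ?thesis by linarith
    qed
    then have "0 < (l i)^2 + (m i)^2 - l i * m i" by simp
    also have "\<dots> \<le> (\<Sum>i=1..k. (l i)^2 + (m i)^2 - l i * m i)"
      by (rule member_le_sum) (use that in auto)
    finally have pos: "0 < (\<Sum>i=1..k. (l i)^2 + (m i)^2 - l i * m i)" .
    have "(0 :: complex) ^ (e + x + y) = 0" if "0 < e" for e x y :: nat
      using that by (simp add: power_0_left)
    from this[OF pos] show ?thesis by (simp only: Fterm_def prod.case) simp
  qed
  have "(Fterm a b k 0 has_sum 1) (parts k \<times> parts k)"
  proof (rule has_sum_finite_neutralI)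
    show "finite {(\<lambda>_ :: nat. 0 :: nat, \<lambda>_ :: nat. 0 :: nat)}" by simp
    show "{(\<lambda>_. 0, \<lambda>_. 0)} \<subseteq> parts k \<times> parts k" by (auto simp: parts_def)
    show "1 = sum (Fterm a b k 0) {(\<lambda>_. 0, \<lambda>_. 0)}" by (simp add: Fterm_def pz g)
    show "Fterm a b k 0 x = 0" if x: "x \<in> parts k \<times> parts k - {(\<lambda>_. 0, \<lambda>_. 0)}" for x
    proof -
      obtain l m where lm: "x = (l, m)" "l \<in> parts k" "m \<in> parts k" using x by auto
      have "\<exists>i\<in>{1..k}. l i > 0 \<or> m i > 0"
      proof (rule ccontr)
        assume "\<not> ?thesis"
        then have "l i = 0 \<and> m i = 0" for i using lm by (cases "i \<in> {1..k}") (auto simp: parts_def)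
        then have "l = (\<lambda>_. 0)" "m = (\<lambda>_. 0)" by auto
        then show False using x lm by simp
      qed
      then show ?thesis using z lm by blast
    qed
  qed
  then show ?thesis unfolding Fcal_def by (rule infsumI)
qed

theorem theorem6p1:
  fixes a b k :: nat and q :: complex
  assumes "2 \<le> k" and "k < a" and "a \<le> (3 * k) div 2" and "b + 2 * a \<le> 3 * k"
    and "norm q < 1"
  shows "Fcal (2*k - a) (a + b - k) k q - q ^ (b + 1) * Fcal (2*k - a - b - 1) (a - k - 1) k q
       = (qpoch_inf (q ^ (3*k+3)) (q ^ (3*k+3)))^2 / (qpoch_inf q q)^3
         * (qtheta (q ^ (a+1)) (q ^ (3*k+3)) * qtheta (q ^ (b+1)) (q ^ (3*k+3))
            * qtheta (q ^ (a+b+2)) (q ^ (3*k+3)))"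
proof (cases "q = 0")
  case True
  \<comment> \<open>The theta factors at q = 0 contain 0 / 0, which is 0 by convention, so all of
    them equal 1.\<close>
  have "qpoch_inf 0 0 = 1" by (simp add: qpoch_inf_def)
  then show ?thesis using assms(1) by (simp add: True Fcal_at_zero qtheta_def power_0_left)
next
  case False
  then interpret nome q using assms by unfold_locales auto
  let ?W = "wp 1 - wp (- 1)"
  let ?A = "int (a + 1)" and ?B = "int (b + 1)" and ?n = "k + 1"
  \<comment> \<open>The requirement b \<le> a of \<open>Fcal_eq_Msum\<close> amounts to b + 2 a
    \<le> 3 k, here as well as for the second sum.\<close>
  have 1: "Fcal (2*k - a) (a + b - k) k q = qp ?B * Msum ?n (2 * int ?n - ?A) (?A + ?B - int ?n) / (?W * qinf ^ 3)"
  proof -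
    have e: "1 - int k + int (2*k - a) + int (a + b - k) = ?B" "int (2*k - a) + 1 = 2 * int ?n - ?A"
      "int (a + b - k) + 1 = ?A + ?B - int ?n"
      using assms by (auto simp: of_nat_diff)
    have "Fcal (2*k - a) (a + b - k) k q = qp (1 - int k + int (2*k - a) + int (a + b - k)) * Msum ?n (int (2*k - a) + 1) (int (a + b - k) + 1) / (?W * qinf ^ 3)"
      by (rule Fcal_eq_Msum) (use assms in auto)
    then show ?thesis unfolding e .
  qed
  have 2: "Fcal (2*k - a - b - 1) (a - k - 1) k q = qp (- ?B) * Msum ?n (2 * int ?n - ?A - ?B) (?A - int ?n) / (?W * qinf ^ 3)"
  proof -
    have le: "a + b + 1 \<le> 2 * k" "k + 1 \<le> a" using assms by auto
    have i: "int (2*k - a - b - 1) = 2 * int k - int a - int b - 1" "int (a - k - 1) = int a - int k - 1"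
      using le by linarith+
    have e: "1 - int k + int (2*k - a - b - 1) + int (a - k - 1) = - ?B" "int (2*k - a - b - 1) + 1 = 2 * int ?n - ?A - ?B"
      "int (a - k - 1) + 1 = ?A - int ?n"
      unfolding i by auto
    have "Fcal (2*k - a - b - 1) (a - k - 1) k q = qp (1 - int k + int (2*k - a - b - 1) + int (a - k - 1)) * Msum ?n (int (2*k - a - b - 1) + 1) (int (a - k - 1) + 1) / (?W * qinf ^ 3)"
      by (rule Fcal_eq_Msum) (use assms in auto)
    then show ?thesis unfolding e .
  qed
  \<comment> \<open>The prefactors of the two sums are q^(b+1) and q^(-b-1); the coefficient in the
    theorem cancels the latter and leaves the combination in \<open>Msum_three_term\<close>.\<close>
  have c: "q ^ (b + 1) * qp (- ?B) = 1"
    unfolding qp_nat[symmetric] qp_add[symmetric] by simp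
  have "Fcal (2*k - a) (a + b - k) k q - q ^ (b + 1) * Fcal (2*k - a - b - 1) (a - k - 1) k q
     = (qp ?B * Msum ?n (2 * int ?n - ?A) (?A + ?B - int ?n) - (q ^ (b + 1) * qp (- ?B)) * Msum ?n (2 * int ?n - ?A - ?B) (?A - int ?n)) / (?W * qinf ^ 3)"
    unfolding 1 2 by (simp add: diff_divide_distrib mult.assoc)
  also have "\<dots> = qp (?A + ?B - int ?n) * Msum ?n ?A ?B / (?W * qinf ^ 3)"
    unfolding c using Msum_three_term[of ?n ?B ?A] by simp
  also have "\<dots> = (qpoch_inf (q ^ (3 * ?n)) (q ^ (3 * ?n)))\<^sup>2
     * (qtheta (q ^ (a + 1)) (q ^ (3 * ?n)) * qtheta (q ^ (b + 1)) (q ^ (3 * ?n)) * qtheta (q ^ ((a + 1) + (b + 1))) (q ^ (3 * ?n))) / qinf ^ 3"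
    by (subst Msum_product[OF _ refl refl]) (use wp_1_neq in simp_all)
  also have "3 * ?n = 3 * k + 3" by simp
  also have "(a + 1) + (b + 1) = a + b + 2" by simp
  finally show ?thesis unfolding qinf_def by simp
qed

end
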